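(* Let $G$ be a connected distance hereditary graph that is not a clique. Then $\psi(G)$, $an(G)$, and the number of leaves of the pruned decomposition tree of $G$ are all equal.
   Context: A graph $G$ is distance hereditary if for every connected induced subgraph $H$ of $G$, the distance between every two vertices of $H$ is the same in $H$ as in $G$ (such graphs are circle graphs). For $k\ge3$ a $k$-polygon graph is an intersection graph of chords of a convex $k$-gon with each chord's endpoints on distinct sides, and $2$-polygon graphs are permutation graphs; $\psi(G)$ is the least $k\ge2$ such that $G$ is a $k$-polygon graph. An asteroidal set of $G$ is a set $A$ of vertices such that for each $a\in A$, any two vertices of $A\setminus\{a\}$ are joined by a path in $G-N[a]$ ($N[a]$ the closed neighbourhood); $an(G)$ is the maximum size of an asteroidal set. A split of $G=(V,E)$ is a partition $\{V_1,V_2\}$ of $V$ with $|V_1|,|V_2|>1$ such that the edges between $V_1$ and $V_2$ are exactly $\{xy: x\in N(V_2), y\in N(V_1)\}$ (where $N(W)$ is the set of vertices outside $W$ adjacent to $W$); $G$ is prime if it has no split. A simple split decomposition replaces $G$ by $G[V_1]+v$ with $N(v)=N_G(V_2)$ and $G[V_2]+v$ with $N(v)=N_G(V_1)$, $v$ a new marker vertex. A split decomposition is obtained by repeating this on the pieces; it is a tree whose nodes are graphs, adjacent iff they share a marker. The standard split decomposition tree $T_G$ of a connected graph $G$ is its unique split decomposition whose nodes are all prime graphs, cliques or stars and which is not a strict refinement of another such decomposition. The pruned decomposition tree is obtained from $T_G$ by repeatedly removing a leaf node whose marker vertex is universal in that leaf's graph (the other copy of the marker becoming an ordinary vertex) until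 no such leaf remains.
   Formalization: A pruned decomposition tree consisting of a single node is counted as having two leaves; with the usual count (0 or 1) the claim already fails for the path on three vertices, where ψ = an = 2. *)

theory Defs
  imports "HOL-Analysis.Analysis" "HOL-Combinatorics.Permutations"
begin

section \<open>Finite simple graphs\<close>

record 'a ugraph =
  verts :: "'a set"
  edges :: "'a set set"

definition simple_graph :: "'a ugraph \<Rightarrow> bool" where
  "simple_graph G \<longleftrightarrow> finite (verts G) \<and> (\<forall>e\<in>edges G. e \<subseteq> verts G \<and> card e = 2)"

definition adj :: "'a ugraph \<Rightarrow> 'a \<Rightarrow> 'a \<Rightarrow> bool" where
  "adj G u v \<longleftrightarrow> {u, v} \<in> edges G"

definition adj_rel :: "'a ugraph \<Rightarrow> ('a \<times> 'a) set" where
  "adj_rel G = {(u, v). adj G u v}"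

definition induced :: "'a ugraph \<Rightarrow> 'a set \<Rightarrow> 'a ugraph" where
  "induced G W = \<lparr>verts = verts G \<inter> W, edges = {e \<in> edges G. e \<subseteq> W}\<rparr>"

definition joined :: "'a ugraph \<Rightarrow> 'a \<Rightarrow> 'a \<Rightarrow> bool" where
  "joined G u v \<longleftrightarrow> u \<in> verts G \<and> v \<in> verts G \<and> (u, v) \<in> (adj_rel G)\<^sup>*"

definition connected_graph :: "'a ugraph \<Rightarrow> bool" where
  "connected_graph G \<longleftrightarrow> verts G \<noteq> {} \<and> (\<forall>u\<in>verts G. \<forall>v\<in>verts G. joined G u v)"

text \<open>The relational power counts the edges of a walk; the value is only meaningful
  for vertices that are joined.\<close>

definition graph_dist :: "'a ugraph \<Rightarrow> 'a \<Rightarrow> 'a \<Rightarrow> nat" where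
  "graph_dist G u v = (LEAST n. (u, v) \<in> adj_rel G ^^ n)"

definition distance_hereditary :: "'a ugraph \<Rightarrow> bool" where
  "distance_hereditary G \<longleftrightarrow>
     (\<forall>W. W \<subseteq> verts G \<and> connected_graph (induced G W) \<longrightarrow>
        (\<forall>u\<in>W. \<forall>v\<in>W. graph_dist (induced G W) u v = graph_dist G u v))"

definition clique_graph :: "'a ugraph \<Rightarrow> bool" where
  "clique_graph G \<longleftrightarrow> (\<forall>u\<in>verts G. \<forall>v\<in>verts G. u \<noteq> v \<longrightarrow> adj G u v)"

definition star_graph :: "'a ugraph \<Rightarrow> bool" where
  "star_graph G \<longleftrightarrow> (\<exists>c\<in>verts G. edges G = {{c, v} | v. v \<in> verts G - {c}})"

definition universal :: "'a ugraph \<Rightarrow> 'a \<Rightarrow> bool" where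
  "universal G u \<longleftrightarrow> u \<in> verts G \<and> (\<forall>v\<in>verts G - {u}. adj G u v)"


section \<open>Polygon graphs\<close>

text \<open>Positive iff \<open>a\<close>, \<open>b\<close>, \<open>c\<close> is a counterclockwise triangle.\<close>

definition orient :: "real^2 \<Rightarrow> real^2 \<Rightarrow> real^2 \<Rightarrow> real" where
  "orient a b c = (b $ 1 - a $ 1) * (c $ 2 - a $ 2) - (b $ 2 - a $ 2) * (c $ 1 - a $ 1)"

text \<open>The vertices \<open>p 0, \<dots>, p (k - 1)\<close> are listed counterclockwise. Since every vertex
  outside a side lies strictly to the left of the line through that side, each side is an
  edge of the convex hull, so the sequence winds exactly once around the polygon.\<close>

definition convex_polygon :: "nat \<Rightarrow> (nat \<Rightarrow> real^2) \<Rightarrow> bool" where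
  "convex_polygon k p \<longleftrightarrow> k \<ge> 3 \<and>
     (\<forall>i<k. \<forall>j<k. j \<noteq> i \<and> j \<noteq> Suc i mod k \<longrightarrow> orient (p i) (p (Suc i mod k)) (p j) > 0)"

definition side :: "nat \<Rightarrow> (nat \<Rightarrow> real^2) \<Rightarrow> nat \<Rightarrow> (real^2) set" where
  "side k p i = closed_segment (p i) (p (Suc i mod k))"

definition is_chord :: "nat \<Rightarrow> (nat \<Rightarrow> real^2) \<Rightarrow> (real^2) set \<Rightarrow> bool" where
  "is_chord k p C \<longleftrightarrow>
     (\<exists>i<k. \<exists>j<k. i \<noteq> j \<and>
        (\<exists>x\<in>side k p i. \<exists>y\<in>side k p j. x \<noteq> y \<and> C = closed_segment x y))"

definition permutation_graph :: "'a ugraph \<Rightarrow> bool" where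
  "permutation_graph G \<longleftrightarrow>
     (\<exists>\<sigma> \<pi>. bij_betw \<sigma> (verts G) {..<card (verts G)} \<and> \<pi> permutes {..<card (verts G)} \<and>
        (\<forall>u\<in>verts G. \<forall>v\<in>verts G. \<sigma> u < \<sigma> v \<longrightarrow> (adj G u v \<longleftrightarrow> \<pi> (\<sigma> v) < \<pi> (\<sigma> u))))"

definition polygon_graph :: "nat \<Rightarrow> 'a ugraph \<Rightarrow> bool" where
  "polygon_graph k G \<longleftrightarrow>
     (if k = 2 then permutation_graph G
      else (\<exists>p c. convex_polygon k p \<and> (\<forall>v\<in>verts G. is_chord k p (c v)) \<and>
              (\<forall>u\<in>verts G. \<forall>v\<in>verts G. u \<noteq> v \<longrightarrow> (adj G u v \<longleftrightarrow> c u \<inter> c v \<noteq> {}))))"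

definition polygon_number :: "'a ugraph \<Rightarrow> nat" where
  "polygon_number G = (LEAST k. k \<ge> 2 \<and> polygon_graph k G)"


section \<open>Asteroidal number\<close>

definition closed_nbhd :: "'a ugraph \<Rightarrow> 'a \<Rightarrow> 'a set" where
  "closed_nbhd G a = insert a {v \<in> verts G. adj G a v}"

text \<open>The case \<open>b = c\<close> is not excluded: it says that \<open>b\<close> is a vertex of \<open>G - N[a]\<close>, so
  that asteroidal sets are independent also when they have only two elements.\<close>

definition asteroidal_set :: "'a ugraph \<Rightarrow> 'a set \<Rightarrow> bool" where
  "asteroidal_set G A \<longleftrightarrow> A \<subseteq> verts G \<and>
     (\<forall>a\<in>A. \<forall>b\<in>A - {a}. \<forall>c\<in>A - {a}. joined (induced G (verts G - closed_nbhd G a)) b c)"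

definition asteroidal_number :: "'a ugraph \<Rightarrow> nat" where
  "asteroidal_number G = Max {card A | A. asteroidal_set G A}"


section \<open>Splits and split decompositions\<close>

definition nbhd :: "'a ugraph \<Rightarrow> 'a set \<Rightarrow> 'a set" where
  "nbhd G W = {v \<in> verts G - W. \<exists>w\<in>W. adj G v w}"

definition is_split :: "'a ugraph \<Rightarrow> 'a set \<Rightarrow> 'a set \<Rightarrow> bool" where
  "is_split G V1 V2 \<longleftrightarrow>
     V1 \<union> V2 = verts G \<and> V1 \<inter> V2 = {} \<and> card V1 > 1 \<and> card V2 > 1 \<and>
     {{x, y} | x y. x \<in> V1 \<and> y \<in> V2 \<and> adj G x y} = {{x, y} | x y. x \<in> nbhd G V2 \<and> y \<in> nbhd G V1}"

definition prime_graph :: "'a ugraph \<Rightarrow> bool" where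
  "prime_graph G \<longleftrightarrow> \<not> (\<exists>V1 V2. is_split G V1 V2)"

definition add_vertex :: "'a ugraph \<Rightarrow> 'a \<Rightarrow> 'a set \<Rightarrow> 'a ugraph" where
  "add_vertex G m N = \<lparr>verts = insert m (verts G), edges = edges G \<union> {{m, x} | x. x \<in> N}\<rparr>"

datatype 'a dvertex = Orig 'a | Marker nat

definition embed :: "'a ugraph \<Rightarrow> 'a dvertex ugraph" where
  "embed G = \<lparr>verts = Orig ` verts G, edges = (\<lambda>e. Orig ` e) ` edges G\<rparr>"

text \<open>A decomposition is represented by the set of its nodes. The two copies of a marker are
  the same element \<open>Marker n\<close> in the two nodes produced by one simple decomposition; as the
  marker is fresh for all nodes, no other node contains it.\<close>

type_synonym 'a decomposition = "'a dvertex ugraph set"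

inductive simple_decomp :: "'a decomposition \<Rightarrow> 'a decomposition \<Rightarrow> bool" where
  "\<lbrakk>H \<in> D; is_split H V1 V2; Marker n \<notin> (\<Union>K\<in>D. verts K)\<rbrakk> \<Longrightarrow>
   simple_decomp D ((D - {H}) \<union>
     {add_vertex (induced H V1) (Marker n) (nbhd H V2),
      add_vertex (induced H V2) (Marker n) (nbhd H V1)})"

definition split_decomposition :: "'a ugraph \<Rightarrow> 'a decomposition \<Rightarrow> bool" where
  "split_decomposition G D \<longleftrightarrow> simple_decomp\<^sup>*\<^sup>* {embed G} D"

definition strict_refinement :: "'a decomposition \<Rightarrow> 'a decomposition \<Rightarrow> bool" where
  "strict_refinement D D' \<longleftrightarrow> simple_decomp\<^sup>+\<^sup>+ D' D"

definition prime_clique_star :: "'a decomposition \<Rightarrow> bool" where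
  "prime_clique_star D \<longleftrightarrow> (\<forall>H\<in>D. prime_graph H \<or> clique_graph H \<or> star_graph H)"

definition standard_decomposition :: "'a ugraph \<Rightarrow> 'a decomposition \<Rightarrow> bool" where
  "standard_decomposition G D \<longleftrightarrow>
     split_decomposition G D \<and> prime_clique_star D \<and>
     \<not> (\<exists>D'. split_decomposition G D' \<and> prime_clique_star D' \<and> strict_refinement D D')"


section \<open>Pruned decomposition trees\<close>

definition node_nbrs :: "'a decomposition \<Rightarrow> 'a dvertex ugraph \<Rightarrow> 'a dvertex ugraph set" where
  "node_nbrs D H = {K \<in> D. K \<noteq> H \<and> verts H \<inter> verts K \<noteq> {}}"

definition leaf_node :: "'a decomposition \<Rightarrow> 'a dvertex ugraph \<Rightarrow> bool" where
  "leaf_node D H \<longleftrightarrow> H \<in> D \<and> card (node_nbrs D H) = 1"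

text \<open>Once a leaf is removed, the other copy of its marker lies in no second node any more
  and hence no longer acts as a marker, although it keeps its name.\<close>

inductive prune_step :: "'a decomposition \<Rightarrow> 'a decomposition \<Rightarrow> bool" where
  "\<lbrakk>leaf_node D H; K \<in> node_nbrs D H; m \<in> verts H \<inter> verts K; universal H m\<rbrakk> \<Longrightarrow>
   prune_step D (D - {H})"

text \<open>The order of removals matters only up to the choice of the last node when everything
  but one node can be pruned.\<close>

definition pruned_decomposition_tree :: "'a ugraph \<Rightarrow> 'a decomposition \<Rightarrow> bool" where
  "pruned_decomposition_tree G P \<longleftrightarrow>
     (\<exists>T. standard_decomposition G T \<and> prune_step\<^sup>*\<^sup>* T P) \<and> \<not> (\<exists>P'. prune_step P P')"

text \<open>Convention: a tree with a single node is a degenerate path whose two ends coincide, and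
  it counts as having two leaves. For example, a star with at least two edges is its own
  pruned decomposition tree, while its polygon number and its asteroidal number are 2.\<close>

definition number_of_leaves :: "'a decomposition \<Rightarrow> nat" where
  "number_of_leaves D = (if card D = 1 then 2 else card {H. leaf_node D H})"

end

theory Submission
  imports Defs
begin

text \<open>
  Let \<open>L\<close> be the number of leaves of a pruned tree. The theorem is the cycle of inequalities
  \<open>L \<le> an(G) \<le> \<psi>(G) \<le> L\<close>.

  \<^item> \<open>an(G) \<le> \<psi>(G)\<close>: in a polygon representation, every chord of an asteroidal set has all the others
    on one side; the arcs cut off on the other sides are disjoint and each contains a corner.
  \<^item> \<open>\<psi>(G) \<le> L\<close>: a representation is a cyclic word in which each vertex occurs twice and which contains
    one letter per corner. Gluing a clique or a star at a marker only substitutes letters next to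
    one occurrence of that marker, and needs a corner there only if the marker is a leaf of the star.
    By induction on the tree there is a word with \<open>L\<close> corners in which a given vertex of a given leaf
    node is next to a corner, so gluing a new node to a leaf node needs no new corner. Gluing a node with a
    universal marker, which undoes a pruning step, adds twins.
  \<^item> \<open>L \<le> an(G)\<close>: a leaf of the pruned tree is a star whose marker is not the centre, so it contains a
    pendant vertex, and these vertices form an asteroidal set. Minimality of the standard decomposition is
    needed here only to exclude that the neighbouring node is a star centred at the marker.

  The nodes are cliques and stars because a distance hereditary graph which is not a clique and has
  at least four vertices has a split: look at the vertices farthest from a non-universal vertex.
\<close>

section \<open>Graphs and embeddings\<close>

text \<open>Words are only turned into polygons. So one polygon for each \<open>k\<close> suffices
  for the upper bound, and its chords can avoid all corners. The bound on asteroidal sets instead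
  meets arbitrary chords, whose ends may be corners or may lie on one line with ends of other
  chords; all that is kept there of "distinct sides" is an integer parameter, a corner, between the
  two ends of a chord. Two sides form no polygon, so permutation graphs are treated apart.

  A simple decomposition splits a node anywhere in the tree, while words and connectivity are
  handled by attaching one leaf at a time. \<open>decomp_tree\<close> is the second view, and the
  lemmas on trees translate between the two. Its recomposed graph may have markers among its
  vertices, which is what pruning produces: the remaining nodes recompose to a graph that embeds
  into \<open>G\<close>, so asteroidal sets pass from it to \<open>G\<close>, and words pass to
  \<open>G\<close> by inserting twins. The count of corners comes out right because attaching a node
  to a leaf, or to a lone node, keeps the number of leaves, and any other attachment raises it by
  one.\<close>

lemma adj_commute: "adj G u v \<longleftrightarrow> adj G v u"
  by (simp add: adj_def insert_commute)

lemma adj_induced [simp]: "adj (induced G W) u v \<longleftrightarrow> adj G u v \<and> u \<in> W \<and> v \<in> W"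
  by (auto simp: adj_def induced_def)

lemma verts_induced [simp]: "verts (induced G W) = verts G \<inter> W"
  by (simp add: induced_def)

lemma joined_invariant:
  assumes "joined G u v" "P u" "\<And>x y. adj G x y \<Longrightarrow> P x \<Longrightarrow> P y"
  shows "P v"
proof -
  have "(u, v) \<in> (adj_rel G)\<^sup>*" using assms(1) by (simp add: joined_def)
  then show ?thesis by induction (use assms(2,3) in \<open>auto simp: adj_rel_def\<close>)
qed

lemma simple_graph_adjD:
  assumes "simple_graph G" "adj G u v"
  shows "u \<in> verts G" "v \<in> verts G" "u \<noteq> v"
  using assms by (auto simp: simple_graph_def adj_def card_insert_if split: if_splits)

lemma simple_graph_induced: "simple_graph G \<Longrightarrow> simple_graph (induced G W)"
  by (auto simp: simple_graph_def induced_def)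

lemma graph_eqI:
  assumes "simple_graph G" "simple_graph H" "verts G = verts H" "\<And>u v. adj G u v \<longleftrightarrow> adj H u v"
  shows "G = (H :: 'b ugraph)"
proof -
  have "edges G = edges H"
  proof (rule set_eqI)
    fix e
    show "e \<in> edges G \<longleftrightarrow> e \<in> edges H"
    proof (cases "card e = 2")
      case True
      then obtain u v where "e = {u, v}" by (auto simp: card_2_iff)
      then show ?thesis using assms(4)[of u v] by (simp add: adj_def)
    next
      case False
      then show ?thesis using assms(1,2) by (auto simp: simple_graph_def)
    qed
  qed
  then show ?thesis using assms(3) by simp
qed

lemma joined_refl: "v \<in> verts G \<Longrightarrow> joined G v v"
  by (simp add: joined_def)

lemma joined_trans: "joined G u v \<Longrightarrow> joined G v w \<Longrightarrow> joined G u w"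
  by (auto simp: joined_def)

lemma joined_sym: "joined G u v \<Longrightarrow> joined G v u"
proof -
  have "sym (adj_rel G)" by (auto simp: sym_def adj_rel_def adj_commute)
  then show "joined G u v \<Longrightarrow> joined G v u" by (auto simp: joined_def dest: sym_rtrancl[THEN symD])
qed

lemma joined_adj: "simple_graph G \<Longrightarrow> adj G u v \<Longrightarrow> joined G u v"
  by (auto simp: joined_def adj_rel_def dest: simple_graph_adjD)

text \<open>Edges may go to joined pairs, not just to edges, because one of the maps used later
  contracts a whole side of a split to the marker, so that edges inside that side become
  trivial.\<close>

lemma joined_map:
  assumes "joined G u v" "\<And>x. x \<in> verts G \<Longrightarrow> f x \<in> verts H"
    and "\<And>x y. adj G x y \<Longrightarrow> joined H (f x) (f y)"
  shows "joined H (f u) (f v)"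
proof -
  have u: "u \<in> verts G" and uv: "(u, v) \<in> (adj_rel G)\<^sup>*" using assms(1) by (auto simp: joined_def)
  from uv show ?thesis
  proof induction
    case base
    show ?case using assms(2)[OF u] by (rule joined_refl)
  next
    case (step y z)
    then show ?case using assms(3)[of y z] joined_trans by (auto simp: adj_rel_def)
  qed
qed

lemma connected_graphI:
  assumes "r \<in> verts G" "\<And>v. v \<in> verts G \<Longrightarrow> joined G v r"
  shows "connected_graph G"
proof -
  have "joined G u v" if "u \<in> verts G" "v \<in> verts G" for u v
    using joined_trans[OF assms(2)[OF that(1)] joined_sym[OF assms(2)[OF that(2)]]] .
  then show ?thesis using assms(1) by (auto simp: connected_graph_def)
qed

text \<open>An isomorphism onto an induced subgraph. Nodes of a decomposition and pruned graphs are
  found in \<open>G\<close> in this way, each marker being replaced by a vertex that it stands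
  for.\<close>

definition embedding :: "('b \<Rightarrow> 'c) \<Rightarrow> 'b ugraph \<Rightarrow> 'c ugraph \<Rightarrow> bool" where
  "embedding f F G \<longleftrightarrow> inj_on f (verts F) \<and> f ` verts F \<subseteq> verts G \<and>
     (\<forall>u\<in>verts F. \<forall>v\<in>verts F. adj F u v \<longleftrightarrow> adj G (f u) (f v))"

lemma embedding_id: "embedding id F F"
  by (simp add: embedding_def)

lemma embedding_comp: "embedding f F G \<Longrightarrow> embedding g G H \<Longrightarrow> embedding (g \<circ> f) F H"
  by (auto simp: embedding_def inj_on_def image_subset_iff)

lemma embedding_mem: "embedding f F G \<Longrightarrow> v \<in> verts F \<Longrightarrow> f v \<in> verts G"
  by (auto simp: embedding_def)

lemma joined_embedding:
  assumes "embedding f F G" "simple_graph F" "simple_graph G" "joined F u v"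
  shows "joined G (f u) (f v)"
  using assms(4)
proof (rule joined_map)
  show "joined G (f x) (f y)" if "adj F x y" for x y
    using simple_graph_adjD[OF assms(2) that] assms(1) that
      by (intro joined_adj[OF assms(3)]) (simp add: embedding_def)
qed (rule embedding_mem[OF assms(1)])

text \<open>The closed neighbourhood of \<open>f a\<close> meets the image only in images of
  vertices of the closed neighbourhood of \<open>a\<close>, so a path that avoids the latter is
  mapped to a path that avoids the former.\<close>

lemma asteroidal_set_embedding:
  assumes e: "embedding f F G" and "simple_graph F" "simple_graph G" "asteroidal_set F A"
  shows "asteroidal_set G (f ` A)" "card (f ` A) = card A"
proof -
  have A: "A \<subseteq> verts F" using assms(4) by (simp add: asteroidal_set_def)
  have inj: "inj_on f (verts F)" using e by (simp add: embedding_def)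
  show "card (f ` A) = card A" using A inj by (meson card_image inj_on_subset)
  have "joined (induced G (verts G - closed_nbhd G (f a))) (f b) (f c)"
    if abc: "a \<in> A" "b \<in> A" "c \<in> A" "f b \<noteq> f a" "f c \<noteq> f a" for a b c
  proof -
    have j: "joined (induced F (verts F - closed_nbhd F a)) b c"
      using assms(4) abc unfolding asteroidal_set_def by auto
    have m: "f x \<in> verts G \<and> f x \<notin> closed_nbhd G (f a)" if "x \<in> verts F" "x \<notin> closed_nbhd F a" for x
    proof -
      have "f x \<noteq> f a" using that abc(1) A inj by (auto simp: closed_nbhd_def dest: inj_onD)
      moreover have "\<not> adj G (f a) (f x)" using that abc(1) A e
        by (auto simp: closed_nbhd_def embedding_def)
      ultimately show ?thesis using embedding_mem[OF e that(1)] by (simp add: closed_nbhd_def)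
    qed
    show ?thesis using j
    proof (rule joined_map)
      show "joined (induced G (verts G - closed_nbhd G (f a))) (f x) (f y)"
        if xy: "adj (induced F (verts F - closed_nbhd F a)) x y" for x y
      proof (rule joined_adj)
        show "adj (induced G (verts G - closed_nbhd G (f a))) (f x) (f y)"
          using xy m[of x] m[of y] e by (auto simp: embedding_def)
      qed (use assms(3) simple_graph_induced in auto)
    qed (use m in auto)
  qed
  moreover have "f ` A \<subseteq> verts G" using A e embedding_mem by fastforce
  ultimately show "asteroidal_set G (f ` A)" unfolding asteroidal_set_def by auto
qed

section \<open>Convex polygons\<close>

lemma orient_rotate: "orient a b c = orient b c a"
  by (simp add: orient_def algebra_simps)

lemma orient_swap: "orient a b c = - orient b a c"
  by (simp add: orient_def algebra_simps)

lemma orient_self [simp]: "orient a a b = 0" "orient a b a = 0" "orient a b b = 0"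
  by (simp_all add: orient_def algebra_simps)

lemma orient_convex: "orient a b ((1 - t) *\<^sub>R c + t *\<^sub>R d) =
    (1 - t) * orient a b c + t * orient a b d"
  by (simp add: orient_def algebra_simps)

lemma orient_convex1: "orient ((1 - t) *\<^sub>R c + t *\<^sub>R d) a b =
    (1 - t) * orient c a b + t * orient d a b"
  by (simp add: orient_def algebra_simps)

lemma orient_convex2: "orient a ((1 - t) *\<^sub>R c + t *\<^sub>R d) b =
    (1 - t) * orient a c b + t * orient a d b"
  by (simp add: orient_def algebra_simps)

text \<open>The three-term Pluecker relation for the directions from \<open>o'\<close> to
  \<open>a\<close>, \<open>x\<close>, \<open>y\<close>, \<open>z\<close>. Within the half plane left
  of the ray to \<open>a\<close> it makes the angular order transitive.\<close>

lemma orient_trans: "orient o' a y * orient o' x z =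
    orient o' a x * orient o' y z + orient o' a z * orient o' x y"
  by (simp add: orient_def algebra_simps)

text \<open>The boundary is parametrised by \<open>[0, k)\<close>: side \<open>i\<close> is the image of \<open>[i, i + 1]\<close>, and \<open>k\<close> wraps to \<open>0\<close>.\<close>

definition bd :: "nat \<Rightarrow> (nat \<Rightarrow> real^2) \<Rightarrow> real \<Rightarrow> real^2" where
  "bd k p s = (let i = nat \<lfloor>s\<rfloor> in (1 - frac s) *\<^sub>R p i + frac s *\<^sub>R p (Suc i mod k))"

lemma bd_eq:
  assumes "real i \<le> s" "s < real i + 1"
  shows "bd k p s = (1 - (s - i)) *\<^sub>R p i + (s - i) *\<^sub>R p (Suc i mod k)"
proof -
  have "\<lfloor>s\<rfloor> = int i" using assms by linarith
  then show ?thesis by (simp add: bd_def frac_def)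
qed

lemma bd_in_side:
  assumes "real i \<le> s" "s < real i + 1" shows "bd k p s \<in> side k p i"
  using assms unfolding bd_eq[OF assms] side_def closed_segment_def by force

text \<open>The final corner of a side is parametrised as the start of the next side, so the
  parameter tells the side only when it is not an integer.\<close>

lemma side_param:
  assumes "i < k" "x \<in> side k p i"
  obtains s where "0 \<le> s" "s < real k" "bd k p s = x"
    "s \<noteq> of_int \<lfloor>s\<rfloor> \<Longrightarrow> nat \<lfloor>s\<rfloor> = i"
proof -
  obtain t where t: "0 \<le> t" "t \<le> 1" "x = (1 - t) *\<^sub>R p i + t *\<^sub>R p (Suc i mod k)"
    using assms by (auto simp: side_def closed_segment_def)
  show ?thesis
  proof (cases "t = 1")
    case False
    have *: "real i \<le> i + t" "i + t < real i + 1" using t False by auto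
    have "i + t < real k" using assms(1) * by linarith
    moreover have "bd k p (i + t) = x" using bd_eq[OF *] t by simp
    moreover have "nat \<lfloor>i + t\<rfloor> = i" using * by linarith
    ultimately show ?thesis using that[of "i + t"] t by simp
  next
    case True
    let ?j = "Suc i mod k"
    have "?j < k" using assms(1) by simp
    moreover have "bd k p (real ?j) = x" using bd_eq[of ?j "real ?j"] t True by simp
    ultimately show ?thesis using that[of "real ?j"] by simp
  qed
qed

context
  fixes k :: nat and p :: "nat \<Rightarrow> real^2"
  assumes poly: "convex_polygon k p"
begin

section \<open>Orientation of boundary points in cyclic order\<close>

lemma at_least_three_corners: "k \<ge> 3" using poly by (simp add: convex_polygon_def)

lemma orient_side: "i < k \<Longrightarrow> j < k \<Longrightarrow> j \<noteq> i \<Longrightarrow> j \<noteq> Suc i mod k \<Longrightarrow>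
    orient (p i) (p (Suc i mod k)) (p j) > 0"
  using poly by (simp add: convex_polygon_def)

lemma orient_side_nonneg: "i < k \<Longrightarrow> j < k \<Longrightarrow> orient (p i) (p (Suc i mod k)) (p j) \<ge> 0"
  using orient_side[of i j] by (cases "j = i"; cases "j = Suc i mod k") auto

lemma orient_side': "Suc i < k \<Longrightarrow> j < k \<Longrightarrow> j \<noteq> i \<Longrightarrow> j \<noteq> Suc i \<Longrightarrow> orient (p i) (p (Suc i)) (p j) > 0"
  using orient_side[of i j] by simp

text \<open>Convexity is only given for triples that contain a side. Seen from \<open>p i\<close>,
  all later corners beyond \<open>p (Suc i)\<close> lie left of the ray to \<open>p (Suc i)\<close>,
  and there \<open>orient_trans\<close> composes the turn from \<open>j\<close> to \<open>l\<close>
  with the turn from \<open>l\<close> to \<open>Suc l\<close>.\<close>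

lemma orient_vertices:
  assumes "i < j" "j < l" "l < k"
  shows "orient (p i) (p j) (p l) > 0"
  using assms(2,3)
proof (induction l)
  case (Suc l)
  show ?case
  proof (cases "l = j")
    case True
    show ?thesis using orient_side'[of j i] assms(1) Suc True by (simp add: orient_rotate[of "p i"])
  next
    case False
    then have IH: "orient (p i) (p j) (p l) > 0" using Suc by simp
    show ?thesis
    proof (cases "j = Suc i")
      case True
      then show ?thesis using orient_side'[of i "Suc l"] Suc.prems by simp
    next
      case nj: False
      let ?a = "p (Suc i)"
      have 1: "orient (p i) ?a (p x) > 0" if "x < k" "x > Suc i" for x
        using orient_side'[of i x] that by simp
      have jl: "j < l" using False Suc.prems by simp
      have 2: "orient (p i) (p l) (p (Suc l)) > 0"
        using orient_side'[of l i] assms(1) jl Suc.prems by (simp add: orient_rotate[of "p i"])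
      have "orient (p i) ?a (p l) * orient (p i) (p j) (p (Suc l)) > 0"
        unfolding orient_trans[of "p i" ?a "p l" "p j" "p (Suc l)"]
          using 1[of j] 1[of "Suc l"] 2 IH assms(1) nj jl Suc.prems
        by (intro add_pos_pos mult_pos_pos) auto
      then show ?thesis using 1[of l] assms(1) nj jl Suc.prems
        by (metis Suc_lessD Suc_lessI less_trans zero_less_mult_pos)
    qed
  qed
qed simp

text \<open>The index \<open>l = k\<close> stands for \<open>p 0\<close> as the end of the last
  side; rotating the triple brings it to the front, where it is the smallest index.\<close>

lemma orient_vertices_nonneg:
  assumes "i \<le> j" "j \<le> l" "l \<le> k" "j < k"
  shows "orient (p i) (p j) (p (l mod k)) \<ge> 0"
proof -
  have 1: "orient (p a) (p b) (p c) \<ge> 0" if "a \<le> b" "b \<le> c" "c < k" for a b c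
    using that orient_vertices[of a b c]
    by (cases "a = b"; cases "b = c") (simp_all add: less_imp_le)
  show ?thesis
  proof (cases "l = k")
    case True
    then show ?thesis using 1[of 0 i j] assms orient_rotate[of "p 0" "p i" "p j"] by simp
  next
    case False
    then show ?thesis using 1[of i j l] assms by simp
  qed
qed

text \<open>From here on corners are replaced by boundary points one argument at a time, the last
  one first. Each replacement writes the orientation as a convex combination of two known values;
  the weight of the corner that starts the side is positive, which carries strictness along.\<close>

lemma orient_vertices_bd:
  assumes "a \<le> b" "b \<le> l" "l < k" "real l \<le> z" "z < real l + 1"
  shows "orient (p a) (p b) (bd k p z) \<ge> 0"
    and "a < b \<Longrightarrow> b < l \<Longrightarrow> orient (p a) (p b) (bd k p z) > 0"
proof -
  have e: "orient (p a) (p b) (bd k p z) = (1 - (z - l)) * orient (p a) (p b) (p l) +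
      (z - l) * orient (p a) (p b) (p (Suc l mod k))"
    unfolding bd_eq[OF assms(4,5)] orient_convex ..
  have 1: "orient (p a) (p b) (p (l mod k)) \<ge> 0" "orient (p a) (p b) (p (Suc l mod k)) \<ge> 0"
    using assms orient_vertices_nonneg[of a b l] orient_vertices_nonneg[of a b "Suc l"] by auto
  then have 2: "orient (p a) (p b) (p l) \<ge> 0" using assms by simp
  have 3: "1 - (z - l) > 0" "z - l \<ge> 0" using assms by auto
  show "orient (p a) (p b) (bd k p z) \<ge> 0" unfolding e using 1(2) 2 3 by simp
  show "orient (p a) (p b) (bd k p z) > 0" if "a < b" "b < l"
    unfolding e using 1(2) 3 orient_vertices[OF that assms(3)] by (simp add: add_pos_nonneg)
qed

lemma orient_vertex_bd_bd:
  assumes "a \<le> j" "j < l" "l < k" "real j \<le> y" "y < real j + 1" "real l \<le> z" "z < real l + 1"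
  shows "orient (p a) (bd k p y) (bd k p z) \<ge> 0"
    and "a < j \<Longrightarrow> orient (p a) (bd k p y) (bd k p z) > 0"
proof -
  have e: "orient (p a) (bd k p y) (bd k p z) = (1 - (y - j)) * orient (p a) (p j) (bd k p z) +
      (y - j) * orient (p a) (p (Suc j)) (bd k p z)"
    unfolding bd_eq[OF assms(4,5)] orient_convex2 using assms by simp
  have 1: "orient (p a) (p j) (bd k p z) \<ge> 0" "orient (p a) (p (Suc j)) (bd k p z) \<ge> 0"
    using assms by (auto intro!: orient_vertices_bd[where l = l])
  have 3: "1 - (y - j) > 0" "y - j \<ge> 0" using assms by auto
  show "orient (p a) (bd k p y) (bd k p z) \<ge> 0" unfolding e using 1 3 by simp
  show "orient (p a) (bd k p y) (bd k p z) > 0" if "a < j"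
    unfolding e using 1(2) 3 orient_vertices_bd(2)[OF _ _ assms(3,6,7)] that assms
      by (simp add: add_pos_nonneg)
qed

lemma orient_collinear: "orient ((1 - s) *\<^sub>R a + s *\<^sub>R b) ((1 - t) *\<^sub>R a + t *\<^sub>R b) q =
    (t - s) * orient a b q"
  by (simp add: orient_def algebra_simps)

text \<open>The conditions for strictness exclude the collinear positions: all three points on one
  half-open side, \<open>z\<close> the corner that ends the side of \<open>x\<close> and
  \<open>y\<close>, and \<open>x\<close> the corner 0, which also ends the last side.\<close>

lemma orient_bd:
  assumes "0 \<le> x" "x < y" "y < z" "z < real k"
  shows orient_bd_nonneg: "orient (bd k p x) (bd k p y) (bd k p z) \<ge> 0"
    and orient_bd_pos: "\<lfloor>x\<rfloor> \<noteq> \<lfloor>z\<rfloor> \<Longrightarrow> (\<lfloor>x\<rfloor> \<noteq> \<lfloor>y\<rfloor> \<or> z \<noteq> of_int \<lfloor>z\<rfloor> \<or> \<lfloor>z\<rfloor> \<noteq> \<lfloor>y\<rfloor> + 1) \<Longrightarrow>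
        (\<lfloor>y\<rfloor> \<noteq> \<lfloor>z\<rfloor> \<or> x \<noteq> 0) \<Longrightarrow>
      orient (bd k p x) (bd k p y) (bd k p z) > 0"
proof -
  define i where "i = nat \<lfloor>x\<rfloor>"
  define j where "j = nat \<lfloor>y\<rfloor>"
  define l where "l = nat \<lfloor>z\<rfloor>"
  have x: "real i \<le> x" "x < real i + 1" and y: "real j \<le> y" "y < real j + 1"
    and z: "real l \<le> z" "z < real l + 1" and ijl: "i \<le> j" "j \<le> l" "l < k"
    and fl: "\<lfloor>x\<rfloor> = int i" "\<lfloor>y\<rfloor> = int j" "\<lfloor>z\<rfloor> = int l"
    using assms unfolding i_def j_def l_def by linarith+
  let ?o = "orient (bd k p x) (bd k p y) (bd k p z)"
  have "?o \<ge> 0 \<and> (i \<noteq> l \<and> (i \<noteq> j \<or> z \<noteq> real l \<or> l \<noteq> Suc j) \<and> (j \<noteq> l \<or> x \<noteq> 0) \<longrightarrow> ?o > 0)"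
  proof (cases "i < j"; cases "j < l")
    assume ij: "i < j" and jl: "j < l"
    have e: "?o = (1 - (x - i)) * orient (p i) (bd k p y) (bd k p z) +
        (x - i) * orient (p (Suc i)) (bd k p y) (bd k p z)"
      unfolding bd_eq[OF x] orient_convex1 using ij ijl by simp
    have "orient (p i) (bd k p y) (bd k p z) > 0" "orient (p (Suc i)) (bd k p y) (bd k p z) \<ge> 0"
      using ij jl ijl x y z by (auto intro!: orient_vertex_bd_bd[where j = j and l = l])
    then have "?o > 0" unfolding e using x by (simp add: add_pos_nonneg)
    then show ?thesis by simp
  next
    assume "\<not> i < j" and jl: "j < l"
    then have ij: "i = j" using ijl by simp
    have e: "?o = (y - x) * orient (p i) (p (Suc i)) (bd k p z)"
      unfolding bd_eq[OF x] bd_eq[OF y[folded ij]] orient_collinear using ij jl ijl by simp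
    have 1: "orient (p i) (p (Suc i)) (bd k p z) \<ge> 0"
      using ij jl ijl z by (intro orient_vertices_bd[where l = l]) auto
    have 2: "orient (p i) (p (Suc i)) (bd k p z) > 0" if h: "z \<noteq> real l \<or> l \<noteq> Suc j"
    proof (cases "l = Suc j")
      case False
      then show ?thesis using ij jl ijl z by (intro orient_vertices_bd(2)[where l = l]) auto
    next
      case True
      then have zl: "z > real l" using h z by simp
      \<comment> \<open>Here \<open>p l\<close> is on the line through side \<open>i\<close>, so
        positivity must come from the share of \<open>z\<close> in the following corner.\<close>
      have "orient (p i) (p (Suc i)) (p (Suc l mod k)) > 0"
        using orient_side'[of i "Suc l mod k"] True ij ijl at_least_three_corners
          by (auto simp: mod_Suc split: if_splits)
      moreover have "orient (p i) (p (Suc i)) (bd k p z) =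
          (z - l) * orient (p i) (p (Suc i)) (p (Suc l mod k))"
        unfolding bd_eq[OF z] orient_convex using True ij by simp
      ultimately show ?thesis using zl by simp
    qed
    show ?thesis unfolding e using 1 2 ij assms by (auto simp: zero_less_mult_iff)
  next
    assume ij: "i < j" and "\<not> j < l"
    then have jl: "j = l" using ijl by simp
    let ?s = "orient (p j) (p (Suc j mod k)) (bd k p x)"
    have e: "?o = (z - y) * ?s"
      unfolding orient_rotate[of "bd k p x"] bd_eq[OF y] bd_eq[OF z[folded jl]] orient_collinear
        by simp
    have s: "?s =
        (1 - (x - i)) * orient (p j) (p (Suc j mod k)) (p i) + (x - i) * orient (p j) (p (Suc j mod k)) (p (Suc i))"
      unfolding bd_eq[OF x] orient_convex using ij ijl by simp
    have 1: "orient (p j) (p (Suc j mod k)) (p i) \<ge> 0"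
        "orient (p j) (p (Suc j mod k)) (p (Suc i)) \<ge> 0"
      using ij ijl by (auto intro!: orient_side_nonneg)
    then have 2: "?s \<ge> 0" unfolding s using x by simp
    have 3: "?s > 0" if "x \<noteq> 0"
    proof (cases "Suc j mod k = i")
      case False
      then have "orient (p j) (p (Suc j mod k)) (p i) > 0" using ij ijl by (intro orient_side) auto
      then show ?thesis unfolding s using 1 x by (simp add: add_pos_nonneg)
    next
      case True
      \<comment> \<open>Side \<open>j\<close> can end at an earlier corner only by wrapping round.
        So \<open>x\<close> is on side 0 and, being nonzero, off the corner
        \<open>p 0\<close>.\<close>
      then have i0: "i = 0" "Suc j = k" using ij ijl by (auto simp: mod_Suc split: if_splits)
      have "orient (p j) (p (Suc j mod k)) (p (Suc i)) > 0"
        using i0 ij ijl at_least_three_corners by (intro orient_side) auto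
      then show ?thesis unfolding s using 1 x i0 that by (simp add: add_nonneg_pos)
    qed
    show ?thesis unfolding e using 2 3 jl assms by (auto simp: zero_less_mult_iff)
  next
    assume "\<not> i < j" "\<not> j < l"
    then have ij: "i = j" "j = l" using ijl by auto
    have "?o = (y - x) * orient (p i) (p (Suc i mod k)) (bd k p z)"
      unfolding bd_eq[OF x] bd_eq[OF y[folded ij]] orient_collinear using ij by simp
    also have "orient (p i) (p (Suc i mod k)) (bd k p z) = 0"
      unfolding bd_eq[OF z[folded ij]] orient_convex using ij by simp
    finally show ?thesis using ij by simp
  qed
  then show "?o \<ge> 0"
    and "\<lfloor>x\<rfloor> \<noteq> \<lfloor>z\<rfloor> \<Longrightarrow> (\<lfloor>x\<rfloor> \<noteq> \<lfloor>y\<rfloor> \<or> z \<noteq> of_int \<lfloor>z\<rfloor> \<or> \<lfloor>z\<rfloor> \<noteq> \<lfloor>y\<rfloor> + 1) \<Longrightarrow> (\<lfloor>y\<rfloor> \<noteq> \<lfloor>z\<rfloor> \<or> x \<noteq> 0) \<Longrightarrow> ?o > 0"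
    unfolding fl by auto
qed

text \<open>By \<open>orient_bd_pos\<close>, collinear points with \<open>0 < x\<close> lie on one
  closed side, and along that side the parametrisation is affine.\<close>

lemma bd_between:
  assumes "0 < x" "x < y" "y < z" "z < real k" "orient (bd k p x) (bd k p y) (bd k p z) = 0"
  shows "bd k p y \<in> closed_segment (bd k p x) (bd k p z)"
proof -
  define i where "i = nat \<lfloor>x\<rfloor>"
  have x: "real i \<le> x" "x < real i + 1" using assms unfolding i_def by linarith+
  have h: "\<lfloor>x\<rfloor> = \<lfloor>z\<rfloor> \<or> (\<lfloor>x\<rfloor> = \<lfloor>y\<rfloor> \<and> z = of_int \<lfloor>z\<rfloor> \<and> \<lfloor>z\<rfloor> = \<lfloor>y\<rfloor> + 1)"
    using orient_bd_pos[of x y z] assms by auto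
  have fx: "\<lfloor>x\<rfloor> = int i" using x by linarith
  have yz: "y < real i + 1 \<and> z \<le> real i + 1"
  proof (cases "\<lfloor>x\<rfloor> = \<lfloor>z\<rfloor>")
    case True
    then show ?thesis using fx assms(3) by linarith
  next
    case False
    then have "\<lfloor>y\<rfloor> = int i" and "z = of_int (int i + 1)" using h fx by auto
    then show ?thesis by linarith
  qed
  then have yz: "y < real i + 1" "z \<le> real i + 1" "real i \<le> y" using x assms by auto
  \<comment> \<open>If \<open>z\<close> is the next corner, \<open>bd\<close> already uses the
    formula of the next side; the two formulas agree at the corner.\<close>
  have bz: "bd k p z = (1 - (z - i)) *\<^sub>R p i + (z - i) *\<^sub>R p (Suc i mod k)"
  proof (cases "z = real i + 1")
    case True
    then have "Suc i < k" using assms by linarith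
    moreover have "bd k p z = p (Suc i)" using bd_eq[of "Suc i" z k p] True by simp
    ultimately show ?thesis using True by simp
  next
    case False
    then show ?thesis using bd_eq[of i z k p] yz assms by simp
  qed
  define t where "t = (y - x) / (z - x)"
  have t: "0 \<le> t" "t \<le> 1" using assms by (auto simp: t_def)
  have "t * (z - x) = y - x" using assms by (simp add: t_def)
  then have ty: "y = (1 - t) * x + t * z" by (simp add: algebra_simps)
  have "bd k p y = (1 - t) *\<^sub>R bd k p x + t *\<^sub>R bd k p z"
    unfolding bz bd_eq[OF x] bd_eq[OF yz(3,1)] by (simp add: ty algebra_simps)
  then show ?thesis unfolding closed_segment_def using t by blast
qed

section \<open>Meeting and disjoint chords\<close>

text \<open>Four points of the plane satisfy an affine relation whose coefficients are signed areas
  of their triangles. For points in cyclic order the signs put the first and third against the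
  second and fourth, so the normalised relation exhibits a common point of the two segments.\<close>

lemma crossing_chords_meet:
  assumes "0 \<le> a" "a < b" "b < c" "c < d" "d < real k"
  shows "closed_segment (bd k p a) (bd k p c) \<inter> closed_segment (bd k p b) (bd k p d) \<noteq> {}"
proof -
  let ?A = "bd k p a" and ?B = "bd k p b" and ?C = "bd k p c" and ?D = "bd k p d"
  have n: "orient ?A ?B ?C \<ge> 0" "orient ?A ?B ?D \<ge> 0" "orient ?A ?C ?D \<ge> 0" "orient ?B ?C ?D \<ge> 0"
    using assms by (auto intro!: orient_bd_nonneg)
  have sum: "orient ?B ?C ?D + orient ?A ?B ?D = orient ?A ?C ?D + orient ?A ?B ?C"
    by (simp add: orient_def algebra_simps)
  have id: "orient ?B ?C ?D *\<^sub>R ?A + orient ?A ?B ?D *\<^sub>R ?C =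
      orient ?A ?C ?D *\<^sub>R ?B + orient ?A ?B ?C *\<^sub>R ?D"
    by (simp add: vec_eq_iff forall_2 orient_def algebra_simps)
  define S where "S = orient ?B ?C ?D + orient ?A ?B ?D"
  show ?thesis
  proof (cases "S = 0")
    case True
    \<comment> \<open>All weights of the relation on one side vanish, so it gives no point; instead
      the third point itself lies on the other chord. \<open>bd_between\<close> wants a positive
      first parameter, and \<open>b > a \<ge> 0\<close>.\<close>
    then have "orient ?B ?C ?D = 0" using n by (simp add: S_def)
    then have "?C \<in> closed_segment ?B ?D" using assms by (intro bd_between) auto
    then show ?thesis by auto
  next
    case False
    then have S: "S > 0" using n by (simp add: S_def)
    let ?t = "orient ?A ?B ?D / S" and ?s = "orient ?A ?B ?C / S"
    have S1: "S - orient ?A ?B ?D = orient ?B ?C ?D" by (simp add: S_def)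
    have S2: "S - orient ?A ?B ?C = orient ?A ?C ?D" using sum by (simp add: S_def)
    have t: "1 - ?t = orient ?B ?C ?D / S" "1 - ?s = orient ?A ?C ?D / S"
      using S by (simp_all add: S1[symmetric] S2[symmetric] diff_divide_distrib)
    have ts: "0 \<le> ?t" "?t \<le> 1" "0 \<le> ?s" "?s \<le> 1"
      using n S t by (auto simp: S1[symmetric] S2[symmetric] field_simps)
    have "S *\<^sub>R ((1 - ?t) *\<^sub>R ?A + ?t *\<^sub>R ?C) = S *\<^sub>R ((1 - ?s) *\<^sub>R ?B + ?s *\<^sub>R ?D)"
      unfolding t using S id by (simp add: scaleR_add_right)
    then have e: "(1 - ?t) *\<^sub>R ?A + ?t *\<^sub>R ?C = (1 - ?s) *\<^sub>R ?B + ?s *\<^sub>R ?D" using S by simp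
    have "(1 - ?t) *\<^sub>R ?A + ?t *\<^sub>R ?C \<in> closed_segment ?A ?C" unfolding closed_segment_def using ts
      by blast
    moreover have "(1 - ?s) *\<^sub>R ?B + ?s *\<^sub>R ?D \<in> closed_segment ?B ?D" unfolding closed_segment_def
      using ts by blast
    ultimately show ?thesis using e by (metis IntI empty_iff)
  qed
qed

lemma noninteger_between:
  assumes "x < (y::real)"
  obtains z where "x < z" "z < y" "z \<noteq> of_int \<lfloor>z\<rfloor>"
proof -
  obtain q where q: "x < q" "q < y" using assms dense by blast
  show ?thesis
  proof (cases "q = of_int \<lfloor>q\<rfloor>")
    case False
    then show ?thesis using that q by blast
  next
    case True
    define z where "z = min ((q + y) / 2) (q + 1/2)"
    have z: "q < z" "z < y" "z < q + 1" using q by (auto simp: z_def min_def field_simps)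
    have "z \<noteq> of_int \<lfloor>z\<rfloor>"
    proof
      assume zi: "z = of_int \<lfloor>z\<rfloor>"
      have "real_of_int \<lfloor>q\<rfloor> < of_int \<lfloor>z\<rfloor>" using z(1) True zi by linarith
      moreover have "real_of_int \<lfloor>z\<rfloor> < of_int (\<lfloor>q\<rfloor> + 1)" using z(3) True zi by linarith
      ultimately show False unfolding of_int_less_iff by linarith
    qed
    then show ?thesis using that[of z] q z by auto
  qed
qed

text \<open>The line through two non-corner points of different sides, one in each of the two gaps between the
  chords, separates the chords.\<close>

lemma noncrossing_chords_disjoint:
  assumes st: "s < t" "t < real k" "0 \<le> x" "0 \<le> y" "x < real k" "y < real k"
    and corner: "s \<le> of_int r" "of_int r \<le> t"
    and x: "x < s \<or> t < x" and y: "y < s \<or> t < y" and xy: "x < s \<or> y < s"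
  shows "closed_segment (bd k p x) (bd k p y) \<inter> closed_segment (bd k p s) (bd k p t) = {}"
proof -
  \<comment> \<open>Both gaps, from \<open>e0\<close> to \<open>s\<close> and from \<open>t\<close>
    to \<open>f0\<close>, are free of ends of the other chord. The bounds 0 and \<open>k\<close> are
    used when that chord has no end on the respective side; \<open>xy\<close> makes \<open>s\<close>
    positive, so the first gap is never empty.\<close>
  define e0 where "e0 = max (if x < s then x else 0) (if y < s then y else 0)"
  define f0 where "f0 = min (if t < x then x else k) (if t < y then y else k)"
  have e0: "0 \<le> e0" "e0 < s" "x < s \<Longrightarrow> x \<le> e0" "y < s \<Longrightarrow> y \<le> e0"
    using assms by (auto simp: e0_def)
  have f0: "f0 \<le> k" "t < f0" "t < x \<Longrightarrow> f0 \<le> x" "t < y \<Longrightarrow> f0 \<le> y"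
    using assms by (auto simp: f0_def)
  obtain e where e: "e0 < e" "e < s" "e \<noteq> of_int \<lfloor>e\<rfloor>" using noninteger_between[OF e0(2)] .
  obtain f where f: "t < f" "f < f0" "f \<noteq> of_int \<lfloor>f\<rfloor>" using noninteger_between[OF f0(2)] .
  \<comment> \<open>The corner between \<open>s\<close> and \<open>t\<close> puts \<open>e\<close>
    and \<open>f\<close> on different sides, which makes all orientations with respect to their line
    strict.\<close>
  have ef: "\<lfloor>e\<rfloor> < r" "r \<le> \<lfloor>f\<rfloor>" using e f corner by linarith+
  let ?E = "bd k p e" and ?F = "bd k p f"
  have mid: "orient ?E ?F (bd k p q) < 0" if "s \<le> q" "q \<le> t" for q
  proof -
    have "orient ?E (bd k p q) ?F > 0"
      using that e f ef e0 f0 by (intro orient_bd_pos) auto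
    then show ?thesis
      using orient_rotate[of ?E "bd k p q" ?F] orient_rotate[of "bd k p q" ?F ?E] orient_swap[of ?F
        ?E "bd k p q"] by simp
  qed
  have out: "orient ?E ?F (bd k p q) > 0" if q: "0 \<le> q" "q < real k" "q \<le> e0 \<or> f0 \<le> q" for q
  proof (cases "q \<le> e0")
    case True
    have "\<lfloor>q\<rfloor> \<le> \<lfloor>e\<rfloor>" using True e by linarith
    then have "orient (bd k p q) ?E ?F > 0"
      using q True e f ef e0 f0 st by (intro orient_bd_pos) auto
    then show ?thesis using orient_rotate[of "bd k p q" ?E ?F] by simp
  next
    case False
    have "\<lfloor>f\<rfloor> \<le> \<lfloor>q\<rfloor>" using False q f by linarith
    then show ?thesis
      using q False e f ef e0 f0 st by (intro orient_bd_pos) auto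
  qed
  have conv': "orient ?E ?F ((1 - u) *\<^sub>R a + u *\<^sub>R b) < 0"
    if "orient ?E ?F a < 0" "orient ?E ?F b < 0" "0 \<le> u" "u \<le> 1" for a b u
    unfolding orient_convex using convex_bound_lt[OF that(1,2), of "1 - u" u] that by simp
  have conv: "orient ?E ?F ((1 - u) *\<^sub>R a + u *\<^sub>R b) > 0"
    if "orient ?E ?F a > 0" "orient ?E ?F b > 0" "0 \<le> u" "u \<le> 1" for a b u
    unfolding orient_convex
    using convex_bound_lt[of "- orient ?E ?F a" 0 "- orient ?E ?F b" "1 - u" u] that by simp
  have xy': "orient ?E ?F (bd k p x) > 0" "orient ?E ?F (bd k p y) > 0"
    using out[of x] out[of y] st(3-6) x y e0(3,4) f0(3,4) by blast+
  have st': "orient ?E ?F (bd k p s) < 0" "orient ?E ?F (bd k p t) < 0"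
    using mid[of s] mid[of t] st(1) by simp_all
  have "orient ?E ?F a > 0" if a: "a \<in> closed_segment (bd k p x) (bd k p y)" for a
  proof -
    obtain u where "a = (1 - u) *\<^sub>R bd k p x + u *\<^sub>R bd k p y" "0 \<le> u" "u \<le> 1"
      using a unfolding closed_segment_def by blast
    then show ?thesis using conv[OF xy'] by blast
  qed
  moreover have "orient ?E ?F a < 0" if a: "a \<in> closed_segment (bd k p s) (bd k p t)" for a
  proof -
    obtain u where "a = (1 - u) *\<^sub>R bd k p s + u *\<^sub>R bd k p t" "0 \<le> u" "u \<le> 1"
      using a unfolding closed_segment_def by blast
    then show ?thesis using conv'[OF st'] by blast
  qed
  ultimately show ?thesis by (meson disjoint_iff less_asym)
qed

end

section \<open>Words with corners\<close>

definition proj :: "'s \<Rightarrow> 's \<Rightarrow> 's list \<Rightarrow> 's list" where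
  "proj u v w = filter (\<lambda>s. s = u \<or> s = v) w"

definition interlaced :: "'s \<Rightarrow> 's \<Rightarrow> 's list \<Rightarrow> bool" where
  "interlaced u v w \<longleftrightarrow> proj u v w \<in> {[u, v, u, v], [v, u, v, u]}"

text \<open>A word lists, in cyclic order, the corners of the polygon (\<open>None\<close>) and the endpoints of the chords
  (\<open>Some v\<close> for the chord of \<open>v\<close>). A vertex is cornered iff its chord joins different sides.\<close>

definition cornered :: "'b \<Rightarrow> 'b option list \<Rightarrow> bool" where
  "cornered x w \<longleftrightarrow> (\<exists>i j l. proj (Some x) None w =
     replicate i None @ Some x # replicate j None @ Some x # replicate l None \<and> j > 0 \<and> i + l > 0)"

text \<open>That every vertex occurs exactly twice is contained in \<open>cornered\<close>. Counting
  the corners apart from the letters lets a corner be added without touching any chord.\<close>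

definition represents :: "'b ugraph \<Rightarrow> nat \<Rightarrow> 'b option list \<Rightarrow> bool" where
  "represents F k w \<longleftrightarrow> count_list w None = k \<and> Some ` verts F = set w - {None} \<and>
     (\<forall>x\<in>verts F. cornered x w) \<and>
     (\<forall>u\<in>verts F. \<forall>v\<in>verts F. u \<noteq> v \<longrightarrow> (adj F u v \<longleftrightarrow> interlaced (Some u) (Some v) w))"

lemma proj_append [simp]: "proj u v (a @ b) = proj u v a @ proj u v b"
  by (simp add: proj_def)

lemma proj_Nil [simp]: "proj u v [] = []"
  by (simp add: proj_def)

lemma proj_Cons: "proj u v (s # w) = (if s = u \<or> s = v then s # proj u v w else proj u v w)"
  by (simp add: proj_def)

lemma proj_rev: "proj u v (rev w) = rev (proj u v w)"
  by (simp add: proj_def rev_filter)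

lemma proj_notin: "u \<notin> set w \<Longrightarrow> proj u v w = replicate (count_list w v) v"
  by (induction w) (auto simp: proj_Cons)

lemma proj_commute: "proj u v w = proj v u w"
  unfolding proj_def by (rule filter_cong) auto

lemma interlaced_commute: "interlaced u v w \<longleftrightarrow> interlaced v u w"
  unfolding interlaced_def by (auto simp: proj_commute[of u v])

lemma interlaced_rev: "interlaced u v (rev w) \<longleftrightarrow> interlaced u v w"
  unfolding interlaced_def proj_rev by (auto simp: rev_swap)

lemma interlaced_append_commute: "interlaced u v (a @ b) \<longleftrightarrow> interlaced u v (b @ a)"
  unfolding interlaced_def by (auto simp: append_eq_Cons_conv)

lemma replicate_interlace:
  assumes "u \<noteq> v"
  shows "replicate i v @ u # replicate j v @ u # replicate l v \<in> {[u, v, u, v], [v, u, v, u]}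
    \<longleftrightarrow> j = 1 \<and> i + l = 1"
proof -
  have r: "\<exists>i'. i = i' \<and> (i' = 0 \<or> i' = 1 \<or> (\<exists>k. i' = Suc (Suc k)))" for i :: nat
    by (cases i) (auto, metis not0_implies_Suc)
  show ?thesis using r[of i] r[of j] r[of l] assms
    by (auto simp: append_eq_Cons_conv Cons_eq_append_conv)
qed

lemma interlaced_iff_count:
  assumes "u \<notin> set a" "u \<notin> set b" "u \<notin> set c" "u \<noteq> v"
  shows "interlaced u v (a @ u # b @ u # c) \<longleftrightarrow>
    count_list b v = 1 \<and> count_list a v + count_list c v = 1"
  using assms replicate_interlace[of u v]
  by (simp add: interlaced_def proj_Cons proj_notin del: insert_iff)

lemma replicate_eq_split:
  assumes "u \<noteq> v" "replicate i v @ u # replicate j v @ u # replicate l v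
     = replicate i' v @ u # replicate j' v @ u # replicate l' v"
  shows "i = i' \<and> j = j' \<and> l = l'"
proof -
  have "takeWhile (\<lambda>x. x = v) (replicate i v @ u # xs) = replicate i v" for i xs
    using assms(1) by (induction i) auto
  then have "replicate i v = replicate i' v" using assms(2) by metis
  then have i: "i = i'" by simp
  have "takeWhile (\<lambda>x. x = v) (replicate i v @ u # xs) = replicate i v" for i xs
    using assms(1) by (induction i) auto
  then have "replicate j v = replicate j' v" using assms(2) i
    by (metis append_same_eq list.inject same_append_eq)
  then have j: "j = j'" by simp
  then show ?thesis using i assms(2) by (simp)
qed

lemma cornered_iff_count:
  assumes "Some x \<notin> set a" "Some x \<notin> set b" "Some x \<notin> set c"
  shows "cornered x (a @ Some x # b @ Some x # c) \<longleftrightarrow> None \<in> set b \<and> None \<in> set a \<union> set c"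
proof -
  let ?n = "\<lambda>w. count_list w (None :: 'a option)"
  have p: "proj (Some x) None (a @ Some x # b @ Some x # c) =
     replicate (?n a) None @ Some x # replicate (?n b) None @ Some x # replicate (?n c) None"
    using assms by (simp add: proj_Cons proj_notin)
  have "cornered x (a @ Some x # b @ Some x # c) \<longleftrightarrow> ?n b > 0 \<and> ?n a + ?n c > 0"
    unfolding cornered_def p using replicate_eq_split[of "Some x" None]
      by (metis option.distinct(1))
  moreover have "?n w > 0 \<longleftrightarrow> None \<in> set w" for w
    by (metis count_list_0_iff gr0I less_irrefl)
  ultimately show ?thesis by auto
qed

lemma proj_decomp:
  assumes "u \<noteq> v" "proj u v w = replicate i v @ u # replicate j v @ u # replicate l v"
  shows "\<exists>a b c. w = a @ u # b @ u # c \<and> u \<notin> set a \<and> u \<notin> set b \<and> u \<notin> set c"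
proof -
  have c: "count_list (proj u v w) u = count_list w u"
    by (induction w) (auto simp: proj_Cons)
  have c2: "count_list w u = 2"
    using assms unfolding c[symmetric] by (simp add: count_list_append count_list_0_iff)
  then have "u \<in> set w" using count_list_0_iff[of w u] by auto
  then obtain a d where w: "w = a @ u # d" "u \<notin> set a" by (meson split_list_first)
  then have "count_list d u = 1" using c2 by (simp add: count_list_append)
  then have "u \<in> set d" using count_list_0_iff[of d u] by auto
  then obtain b e where d: "d = b @ u # e" "u \<notin> set b" by (meson split_list_first)
  then have "count_list e u = 0" using \<open>count_list d u = 1\<close> by (simp add: count_list_append)
  then have "u \<notin> set e" using count_list_0_iff[of e u] by auto
  then show ?thesis using w d by blast
qed

lemma cornered_decomp:
  assumes "cornered x w"
  obtains a b c where "w = a @ Some x # b @ Some x # c"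
    "Some x \<notin> set a" "Some x \<notin> set b" "Some x \<notin> set c"
  using assms proj_decomp[of "Some x" None w] unfolding cornered_def by fastforce

lemma cornered_rev: "cornered x (rev w) \<longleftrightarrow> cornered x w"
proof -
  have "cornered x (rev w)" if w: "cornered x w" for w
  proof -
    obtain a b c where d: "w = a @ Some x # b @ Some x # c"
      "Some x \<notin> set a" "Some x \<notin> set b" "Some x \<notin> set c" using w by (rule cornered_decomp)
    have r: "rev w = rev c @ Some x # rev b @ Some x # rev a" using d(1) by simp
    have "None \<in> set b \<and> None \<in> set a \<union> set c" using w d cornered_iff_count by metis
    then show ?thesis unfolding r using d cornered_iff_count[of x "rev c" "rev b" "rev a"] by auto
  qed
  from this[of w] this[of "rev w"] show ?thesis by auto
qed

text \<open>It is enough to move one letter to the end. If it is the first occurrence of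
  \<open>x\<close>, the inner and the outer arc change places, and the condition is symmetric in
  them; otherwise the letter only travels within the outer arc.\<close>

lemma cornered_append_commute: "cornered x (p @ q) \<longleftrightarrow> cornered x (q @ p)"
proof -
  have "cornered x (ys @ [y])" if w: "cornered x (y # ys)" for y ys
  proof -
    obtain a b c where d: "y # ys = a @ Some x # b @ Some x # c"
      "Some x \<notin> set a" "Some x \<notin> set b" "Some x \<notin> set c" using w by (rule cornered_decomp)
    have n: "None \<in> set b \<and> None \<in> set a \<union> set c" using w d cornered_iff_count by metis
    show ?thesis
    proof (cases a)
      case Nil
      then have r: "ys @ [y] = b @ Some x # c @ Some x # []" using d(1) by simp
      show ?thesis unfolding r using d n Nil cornered_iff_count[of x b c "[]"] by auto
    next
      case (Cons a' as)
      then have r: "ys @ [y] = as @ Some x # b @ Some x # (c @ [a'])" using d(1) by simp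
      show ?thesis unfolding r using d n Cons cornered_iff_count[of x as b "c @ [a']"] by auto
    qed
  qed
  then have "cornered x (p @ q) \<Longrightarrow> cornered x (q @ p)" for p q
  proof (induction p arbitrary: q)
    case (Cons y p)
    then show ?case by (metis append_Cons append_assoc append_Nil)
  qed simp
  then show ?thesis by blast
qed

lemma represents_rev: "represents F k (rev w) \<longleftrightarrow> represents F k w"
  by (simp add: represents_def interlaced_rev cornered_rev)

lemma represents_append_commute: "represents F k (a @ b) \<longleftrightarrow> represents F k (b @ a)"
  by (simp add: represents_def interlaced_append_commute[of _ _ a] cornered_append_commute[of _ a]
      count_list_append Un_commute add.commute)

lemma represents_rotate:
  assumes "represents F k w" "m \<in> verts F"
  obtains w1 w2 where "represents F k (Some m # w1 @ Some m # w2)"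
proof -
  have "cornered m w" using assms by (simp add: represents_def)
  then obtain a b c where "w = a @ Some m # b @ Some m # c" by (rule cornered_decomp)
  then have "represents F k (Some m # b @ Some m # (c @ a))"
    using assms(1) represents_append_commute[of F k a "Some m # b @ Some m # c"] by simp
  then show ?thesis by (rule that)
qed

text \<open>Corners do not affect interlacement, and \<open>cornered\<close> asks for at least one
  corner in each arc, so a further corner can only help.\<close>

lemma represents_insert_corner:
  assumes "represents F k (Some m # w)"
  shows "represents F (Suc k) (Some m # None # w)"
proof -
  have i: "interlaced (Some u) (Some v) (Some m # None # w) =
      interlaced (Some u) (Some v) (Some m # w)" for u v
    by (simp add: interlaced_def proj_Cons)
  have g: "cornered x (Some m # None # w)" if c: "cornered x (Some m # w)" for x
  proof -
    obtain a b c where d: "Some m # w = a @ Some x # b @ Some x # c"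
      "Some x \<notin> set a" "Some x \<notin> set b" "Some x \<notin> set c" using c by (rule cornered_decomp)
    have n: "None \<in> set b \<and> None \<in> set a \<union> set c" using c d cornered_iff_count by metis
    show ?thesis
    proof (cases a)
      case Nil
      then have r: "Some m # None # w = [] @ Some x # (None # b) @ Some x # c" using d(1) by simp
      show ?thesis unfolding r using d n Nil by (subst cornered_iff_count) auto
    next
      case (Cons a' as)
      then have r: "Some m # None # w = (a' # None # as) @ Some x # b @ Some x # c" using d(1)
        by simp
      show ?thesis unfolding r using d n Cons by (subst cornered_iff_count) auto
    qed
  qed
  show ?thesis using assms g by (auto simp: represents_def i)
qed

section \<open>Substituting letters for the occurrences of a vertex\<close>

lemma proj_eq_Nil: "u \<notin> set w \<Longrightarrow> v \<notin> set w \<Longrightarrow> proj u v w = []"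
  by (induction w) (auto simp: proj_Cons)

lemma proj_distinct:
  assumes "distinct w" "u \<in> set w" "v \<in> set w" "u \<noteq> v"
  shows "proj u v w = [u, v] \<or> proj u v w = [v, u]"
proof -
  have "distinct (proj u v w)" "set (proj u v w) = {u, v}"
    using assms by (auto simp: proj_def)
  then have l: "length (proj u v w) = 2" using distinct_card[of "proj u v w"] assms(4) by simp
  then obtain s t where "proj u v w = [s, t]"
    by (metis (no_types, lifting) One_nat_def Suc_1 length_0_conv length_Suc_conv)
  then show ?thesis using \<open>distinct (proj u v w)\<close> \<open>set (proj u v w) = {u, v}\<close>
    by (auto simp: doubleton_eq_iff)
qed

lemma cornered_count:
  assumes "cornered x w" shows "count_list w (Some x) = 2"
proof -
  obtain a b c where "w = a @ Some x # b @ Some x # c"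
    "Some x \<notin> set a" "Some x \<notin> set b" "Some x \<notin> set c" using assms by (rule cornered_decomp)
  then show ?thesis by (simp add: count_list_append)
qed

lemma count_list_distinct: "distinct w \<Longrightarrow> x \<in> set w \<Longrightarrow> count_list w x = 1"
  by (induction w) auto

lemma represents_decomp:
  assumes "represents F k (Some m # w1 @ Some m # w2)" "m \<in> verts F"
  shows "Some m \<notin> set w1" "Some m \<notin> set w2" "None \<in> set w1" "None \<in> set w2"
proof -
  let ?w = "Some m # w1 @ Some m # w2"
  have c: "cornered m ?w" using assms by (simp add: represents_def)
  then have "count_list ?w (Some m) = 2" by (rule cornered_count)
  then have 0: "count_list w1 (Some m) = 0" "count_list w2 (Some m) = 0"
    by (simp_all add: count_list_append)
  then show 1: "Some m \<notin> set w1" "Some m \<notin> set w2" by (auto simp: count_list_0_iff)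
  from c 1 cornered_iff_count[of m "[]" w1 w2] show "None \<in> set w1" "None \<in> set w2" by auto
qed

text \<open>Blocks of letters in place of the two occurrences of \<open>m\<close> cross the same
  chords as \<open>m\<close> did. Two blocks in the same order make the new chords cross pairwise,
  blocks in opposite orders make them parallel; \<open>b\<close> chooses between true and false
  twins. Both arcs keep the corners of \<open>w1\<close> and \<open>w2\<close>.\<close>

lemma represents_twins:
  assumes rep: "represents F k (Some m # w1 @ Some m # w2)" and m: "m \<in> verts F"
    and hs: "distinct hs" "set hs \<inter> verts F = {}"
    and V: "verts F' = verts F - {m} \<union> set hs"
    and old: "\<And>u v. u \<in> verts F - {m} \<Longrightarrow> v \<in> verts F - {m} \<Longrightarrow> adj F' u v \<longleftrightarrow> adj F u v"
    and mix: "\<And>h v. h \<in> set hs \<Longrightarrow> v \<in> verts F - {m} \<Longrightarrow> (adj F' h v \<longleftrightarrow> adj F m v) \<and> (adj F' v h \<longleftrightarrow>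
        adj F m v)"
    and new: "\<And>h h'. h \<in> set hs \<Longrightarrow> h' \<in> set hs \<Longrightarrow> h \<noteq> h' \<Longrightarrow> adj F' h h' \<longleftrightarrow> b"
  shows "represents F' k (map Some hs @ w1 @ map Some (if b then hs else rev hs) @ w2)"
proof -
  let ?w = "Some m # w1 @ Some m # w2" and ?hs' = "if b then hs else rev hs"
  let ?w' = "map Some hs @ w1 @ map Some ?hs' @ w2"
  note d = represents_decomp[OF rep m]
  have setw: "set ?w - {None} = Some ` verts F" and cnt: "count_list ?w None = k"
    using rep by (auto simp: represents_def)
  have nh: "Some h \<notin> set w1" "Some h \<notin> set w2" if "h \<in> set hs" for h
    using that hs(2) setw by (auto 0 3)
  have set12: "(set w1 \<union> set w2) - {None} = Some ` (verts F - {m})"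
    using setw d by auto
  have cn: "count_list (map Some xs) None = 0" for xs :: "'a list"
    by (simp add: count_list_0_iff image_iff)
  have o: "proj (Some u) (Some v) ?w' = proj (Some u) (Some v) ?w"
    if "u \<in> verts F - {m}" "v \<in> verts F - {m}" for u v
  proof -
    have "proj (Some u) (Some v) (map Some xs) = []" if "set xs = set hs" for xs
      using that hs(2) \<open>u \<in> _\<close> \<open>v \<in> _\<close> by (intro proj_eq_Nil) auto
    from this[of hs] this[of ?hs'] that show ?thesis by (auto simp: proj_Cons)
  qed
  have oc: "proj (Some u) None ?w' = proj (Some u) None ?w" if "u \<in> verts F - {m}" for u
  proof -
    have "proj (Some u) None (map Some xs) = []" if "set xs = set hs" for xs
      using that hs(2) \<open>u \<in> _\<close> by (intro proj_eq_Nil) auto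
    from this[of hs] this[of ?hs'] that show ?thesis by (auto simp: proj_Cons)
  qed
  have split: "\<exists>h1 h2 h1' h2'. hs = h1 @ h # h2 \<and> ?hs' = h1' @ h # h2' \<and>
      h \<notin> set h1 \<union> set h2 \<union> set h1' \<union> set h2'" if "h \<in> set hs" for h
  proof -
    obtain h1 h2 where 1: "hs = h1 @ h # h2" using \<open>h \<in> set hs\<close> by (meson split_list)
    have "h \<in> set ?hs'" using that by simp
    from split_list[OF this] obtain h1' h2' where 2: "?hs' = h1' @ h # h2'" by blast
    have "distinct ?hs'" using hs by simp
    then have "h \<notin> set h1' \<union> set h2'" unfolding 2 by auto
    moreover have "h \<notin> set h1 \<union> set h2" using hs(1) unfolding 1 by auto
    ultimately show ?thesis using 1 2 by blast
  qed
  have mixed: "interlaced (Some h) (Some v) ?w' \<longleftrightarrow> adj F m v"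
    if h: "h \<in> set hs" and v: "v \<in> verts F - {m}" for h v
  proof -
    obtain h1 h2 h1' h2' where s: "hs = h1 @ h # h2" "?hs' = h1' @ h # h2'"
      and n: "h \<notin> set h1 \<union> set h2 \<union> set h1' \<union> set h2'" using split[OF h] by blast
    have m2: "map Some ?hs' = map Some h1' @ Some h # map Some h2'" by (subst s(2)) simp
    have m1: "map Some hs = map Some h1 @ Some h # map Some h2" by (subst s(1)) simp
    have w': "?w' =
        map Some h1 @ Some h # (map Some h2 @ w1 @ map Some h1') @ Some h # (map Some h2' @ w2)"
      unfolding m2 unfolding m1 by simp
    have vh: "v \<notin> set hs" "v \<notin> set ?hs'" using v hs(2) by auto
    moreover have "set h1 \<union> set h2 \<subseteq> set hs" by (subst s(1)) auto
    moreover have "set h1' \<union> set h2' \<subseteq> set ?hs'" by (subst s(2)) auto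
    ultimately have "v \<notin> set h1 \<union> set h2 \<union> set h1' \<union> set h2'" by blast
    then have c0: "count_list (map Some xs) (Some v) = 0" if "xs \<in> {h1, h2, h1', h2'}" for xs
      using that by (auto simp: count_list_0_iff)
    have "interlaced (Some h) (Some v) ?w' \<longleftrightarrow>
        count_list w1 (Some v) = 1 \<and> count_list w2 (Some v) = 1"
      unfolding w' using n nh[OF h] v h hs(2) c0
        by (subst interlaced_iff_count) (auto simp: count_list_append)
    also have "\<dots> \<longleftrightarrow> interlaced (Some m) (Some v) ?w"
      using interlaced_iff_count[of "Some m" "[]" w1 w2 "Some v"] d v by auto
    also have "\<dots> \<longleftrightarrow> adj F m v" using rep m v by (auto simp: represents_def)
    finally show ?thesis .
  qed
  have news: "interlaced (Some h) (Some h') ?w' \<longleftrightarrow> b"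
    if h: "h \<in> set hs" "h' \<in> set hs" "h \<noteq> h'" for h h'
  proof -
    have e: "proj (Some h) (Some h') w1 = []" "proj (Some h) (Some h') w2 = []"
      using nh h by (auto intro!: proj_eq_Nil)
    have "proj (Some h) (Some h') (map Some hs) = [Some h, Some h'] \<or>
       proj (Some h) (Some h') (map Some hs) = [Some h', Some h]"
      using hs h by (intro proj_distinct) (auto simp: distinct_map)
    then show ?thesis using e h(3)
      by (auto simp: interlaced_def rev_map[symmetric] proj_rev)
  qed
  have corn: "cornered x ?w'" if x: "x \<in> verts F'" for x
  proof (cases "x \<in> set hs")
    case True
    obtain h1 h2 h1' h2' where s: "hs = h1 @ x # h2" "?hs' = h1' @ x # h2'"
      and n: "x \<notin> set h1 \<union> set h2 \<union> set h1' \<union> set h2'" using split[OF True] by blast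
    have m2: "map Some ?hs' = map Some h1' @ Some x # map Some h2'" by (subst s(2)) simp
    have m1: "map Some hs = map Some h1 @ Some x # map Some h2" by (subst s(1)) simp
    have w': "?w' =
        map Some h1 @ Some x # (map Some h2 @ w1 @ map Some h1') @ Some x # (map Some h2' @ w2)"
      unfolding m2 unfolding m1 by simp
    show ?thesis unfolding w' using n nh[OF True] d by (subst cornered_iff_count) auto
  next
    case False
    then have "x \<in> verts F - {m}" using x V by auto
    then show ?thesis using oc[of x] rep by (auto simp: cornered_def represents_def)
  qed
  show ?thesis unfolding represents_def
  proof (intro conjI ballI impI)
    show "count_list ?w' None = k" using cnt cn by (simp add: count_list_append)
    have "set ?w' = (set w1 \<union> set w2) \<union> Some ` set hs" by (cases b) auto
    then have "set ?w' - {None} = ((set w1 \<union> set w2) - {None}) \<union> Some ` set hs" by auto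
    then show "Some ` verts F' = set ?w' - {None}" by (simp only: set12 V image_Un)
    show "cornered x ?w'" if "x \<in> verts F'" for x using corn that .
    fix u v assume u: "u \<in> verts F'" and v: "v \<in> verts F'" and uv: "u \<noteq> v"
    show "adj F' u v \<longleftrightarrow> interlaced (Some u) (Some v) ?w'"
    proof (cases "u \<in> set hs"; cases "v \<in> set hs")
      assume "u \<notin> set hs" "v \<notin> set hs"
      then have uv': "u \<in> verts F - {m}" "v \<in> verts F - {m}" using u v V by auto
      have "interlaced (Some u) (Some v) ?w' \<longleftrightarrow> interlaced (Some u) (Some v) ?w"
        unfolding interlaced_def o[OF uv'] ..
      then show ?thesis using old[OF uv'] rep uv' uv by (simp add: represents_def)
    next
      assume "u \<in> set hs" "v \<notin> set hs"
      then show ?thesis using mixed[of u v] mix[of u v] v V by auto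
    next
      assume "u \<notin> set hs" "v \<in> set hs"
      then show ?thesis using mixed[of v u] mix[of v u] u V interlaced_commute
        by (metis Diff_iff Un_iff)
    next
      assume "u \<in> set hs" "v \<in> set hs"
      then show ?thesis using news[of u v] new[of u v] uv by auto
    qed
  qed
qed

text \<open>The chord of \<open>c\<close> takes the place of \<open>m\<close>, and the chords of
  \<open>xs\<close> are small nested arcs around one end of \<open>c\<close> and the corner next to
  it: each crosses \<open>c\<close> and nothing else. Without a corner at that place these arcs
  would have both ends on one side. This is the substitution for a star with centre \<open>c\<close>
  glued at one of its leaves.\<close>

lemma represents_pendants:
  assumes rep: "represents F k (Some m # None # w1 @ Some m # w2)" and m: "m \<in> verts F"
    and xs: "distinct xs" "set xs \<inter> verts F = {}" "c \<notin> verts F" "c \<notin> set xs"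
    and V: "verts F' = verts F - {m} \<union> insert c (set xs)"
    and old: "\<And>u v. u \<in> verts F - {m} \<Longrightarrow> v \<in> verts F - {m} \<Longrightarrow> adj F' u v \<longleftrightarrow> adj F u v"
    and mix: "\<And>v. v \<in> verts F - {m} \<Longrightarrow> (adj F' c v \<longleftrightarrow> adj F m v) \<and> (adj F' v c \<longleftrightarrow> adj F m v)"
    and mix2: "\<And>x v. x \<in> set xs \<Longrightarrow> v \<in> verts F - {m} \<union> set xs \<Longrightarrow> \<not> adj F' x v \<and> \<not> adj F' v x"
    and new: "\<And>x. x \<in> set xs \<Longrightarrow> adj F' x c \<and> adj F' c x"
  shows "represents F' k (map Some xs @ Some c # None # map Some (rev xs) @ w1 @ Some c # w2)"
proof -
  let ?w = "Some m # None # w1 @ Some m # w2"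
  let ?w' = "map Some xs @ Some c # None # map Some (rev xs) @ w1 @ Some c # w2"
  have rep': "represents F k (Some m # (None # w1) @ Some m # w2)" using rep by simp
  note d = represents_decomp[OF rep' m]
  have setw: "set ?w - {None} = Some ` verts F" and cnt: "count_list ?w None = k"
    using rep by (auto simp: represents_def)
  have nh: "Some h \<notin> set w1" "Some h \<notin> set w2" if "h \<in> insert c (set xs)" for h
    using that xs setw by (auto 0 3)
  have set12: "(set w1 \<union> set w2) - {None} = Some ` (verts F - {m})"
    using setw d by auto
  have cn: "count_list (map Some ys) None = 0" for ys :: "'a list"
    by (simp add: count_list_0_iff image_iff)
  have o: "proj (Some u) (Some v) ?w' = proj (Some u) (Some v) ?w"
    if "u \<in> verts F - {m}" "v \<in> verts F - {m}" for u v
  proof -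
    have "proj (Some u) (Some v) (map Some ys) = []" if "set ys = set xs" for ys
      using that xs(2) \<open>u \<in> _\<close> \<open>v \<in> _\<close> by (intro proj_eq_Nil) auto
    from this[of xs] this[of "rev xs"] that xs(3) show ?thesis by (auto simp: proj_Cons)
  qed
  have oc: "proj (Some u) None ?w' = proj (Some u) None ?w" if "u \<in> verts F - {m}" for u
  proof -
    have "proj (Some u) None (map Some ys) = []" if "set ys = set xs" for ys
      using that xs(2) \<open>u \<in> _\<close> by (intro proj_eq_Nil) auto
    from this[of xs] this[of "rev xs"] that xs(3) show ?thesis by (auto simp: proj_Cons)
  qed
  have cdec: "?w' = map Some xs @ Some c # (None # map Some (rev xs) @ w1) @ Some c # w2" by simp
  have mixed: "interlaced (Some c) (Some v) ?w' \<longleftrightarrow> adj F m v" if v: "v \<in> verts F - {m}" for v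
  proof -
    have "v \<notin> set xs" "v \<noteq> c" using v xs by auto
    then have c0: "count_list (map Some ys) (Some v) = 0" if "set ys = set xs" for ys
      using that by (auto simp: count_list_0_iff)
    have "interlaced (Some c) (Some v) ?w' \<longleftrightarrow>
        count_list w1 (Some v) = 1 \<and> count_list w2 (Some v) = 1"
      unfolding cdec using nh xs \<open>v \<noteq> c\<close> c0[of xs] c0[of "rev xs"]
      by (subst interlaced_iff_count) (auto simp: count_list_append)
    also have "\<dots> \<longleftrightarrow> interlaced (Some m) (Some v) ?w"
      using interlaced_iff_count[of "Some m" "[]" "None # w1" w2 "Some v"] d v by auto
    also have "\<dots> \<longleftrightarrow> adj F m v" using rep m v by (auto simp: represents_def)
    finally show ?thesis .
  qed
  have split: "\<exists>h1 h2. xs = h1 @ x # h2 \<and> x \<notin> set h1 \<union> set h2" if "x \<in> set xs" for x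
    using that xs(1)
      by (metis UnE distinct_append distinct.simps(2) disjoint_iff list.set_intros(1) split_list)
  have xdec: "\<exists>h1 h2. ?w' =
      map Some h1 @ Some x # (map Some h2 @ Some c # None # map Some (rev h2)) @ Some x #
      (map Some (rev h1) @ w1 @ Some c # w2) \<and> x \<notin> set h1 \<union> set h2 \<and> xs = h1 @ x # h2" if x: "x \<in>
          set xs" for x
    using split[OF x] by force
  have noint: "\<not> interlaced (Some x) (Some v) ?w'"
    if x: "x \<in> set xs" and v: "v \<in> verts F - {m}" for x v
  proof -
    obtain h1 h2
      where w': "?w' =
        map Some h1 @ Some x # (map Some h2 @ Some c # None # map Some (rev h2)) @ Some x #
      (map Some (rev h1) @ w1 @ Some c # w2)" "x \<notin> set h1 \<union> set h2" "xs = h1 @ x #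
          h2" using xdec[OF x] by blast
    have vh: "v \<noteq> x" "v \<notin> set h2" "v \<noteq> c" using v xs w'(3) by auto
    have "count_list (map Some h2 @ Some c # None # map Some (rev h2)) (Some v) = 0"
      using vh by (auto simp: count_list_0_iff)
    then show ?thesis unfolding w'(1) using vh w'(2) nh[of x] x xs
      by (subst interlaced_iff_count) auto
  qed
  have xc: "interlaced (Some c) (Some x) ?w'" if x: "x \<in> set xs" for x
  proof -
    have c1: "count_list (map Some ys) (Some x) = 1" if "distinct ys" "set ys = set xs" for ys
      using that x by (intro count_list_distinct) (auto simp: distinct_map)
    have "count_list w1 (Some x) = 0" "count_list w2 (Some x) = 0" using nh[of x] x
      by (auto simp: count_list_0_iff)
    then show ?thesis
      unfolding cdec using nh xs x c1[of xs] c1[of "rev xs"]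
      by (subst interlaced_iff_count) (auto simp: count_list_append)
  qed
  have news: "\<not> interlaced (Some h) (Some h') ?w'"
    if h: "h \<in> set xs" "h' \<in> set xs" "h \<noteq> h'" for h h'
  proof -
    have e: "proj (Some h) (Some h') w1 = []" "proj (Some h) (Some h') w2 = []" "h \<noteq> c" "h' \<noteq> c"
      using nh h xs by (auto intro!: proj_eq_Nil)
    have "proj (Some h) (Some h') (map Some xs) = [Some h, Some h'] \<or>
       proj (Some h) (Some h') (map Some xs) = [Some h', Some h]"
      using xs h by (intro proj_distinct) (auto simp: distinct_map)
    then show ?thesis using e h(3)
      by (auto simp: interlaced_def rev_map[symmetric] proj_rev proj_Cons)
  qed
  have corn: "cornered x ?w'" if x: "x \<in> verts F'" for x
  proof -
    consider "x \<in> set xs" | "x = c" | "x \<in> verts F - {m}" using x V by auto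
    then show ?thesis
    proof cases
      case 1
      obtain h1 h2
        where w': "?w' =
          map Some h1 @ Some x # (map Some h2 @ Some c # None # map Some (rev h2)) @ Some x #
        (map Some (rev h1) @ w1 @ Some c # w2)" "x \<notin> set h1 \<union> set h2" "xs = h1 @ x #
            h2" using xdec[OF 1] by blast
      show ?thesis unfolding w'(1) using w'(2) nh[of x] 1 d xs by (subst cornered_iff_count) auto
    next
      case 2
      show ?thesis unfolding 2 cdec using nh[of c] d xs by (subst cornered_iff_count) auto
    next
      case 3
      then show ?thesis using oc[of x] rep by (auto simp: cornered_def represents_def)
    qed
  qed
  show ?thesis unfolding represents_def
  proof (intro conjI ballI impI)
    show "count_list ?w' None = k" using cnt cn by (simp add: count_list_append)
    have "set ?w' - {None} = ((set w1 \<union> set w2) - {None}) \<union> Some ` insert c (set xs)" by auto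
    then show "Some ` verts F' = set ?w' - {None}" by (simp only: set12 V image_Un)
    show "cornered x ?w'" if "x \<in> verts F'" for x using corn that .
    fix u v assume u: "u \<in> verts F'" and v: "v \<in> verts F'" and uv: "u \<noteq> v"
    have oldc: "adj F' u v \<longleftrightarrow> interlaced (Some u) (Some v) ?w'"
      if uv': "u \<in> verts F - {m}" "v \<in> verts F - {m}"
    proof -
      have "interlaced (Some u) (Some v) ?w' \<longleftrightarrow> interlaced (Some u) (Some v) ?w"
        unfolding interlaced_def o[OF uv'] ..
      then show ?thesis using old[OF uv'] rep uv' uv by (simp add: represents_def)
    qed
    consider "u \<in> set xs" "v \<in> set xs" | "u \<in> set xs" "v = c" | "u \<in> set xs" "v \<in> verts F - {m}"
      | "u = c" "v \<in> set xs" | "u = c" "v \<in> verts F - {m}"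
      | "u \<in> verts F - {m}" "v \<in> set xs" | "u \<in> verts F - {m}" "v =
          c" | "u \<in> verts F - {m}" "v \<in> verts F - {m}"
      using u v uv V by auto
    then show "adj F' u v \<longleftrightarrow> interlaced (Some u) (Some v) ?w'"
    proof cases
      case 1 then show ?thesis using news[of u v] mix2[of u v] uv by auto
    next
      case 2 then show ?thesis using xc[of u] new[of u] interlaced_commute[of "Some u"] by metis
    next
      case 3 then show ?thesis using noint[of u v] mix2[of u v] by auto
    next
      case 4 then show ?thesis using xc[of v] new[of v] by metis
    next
      case 5 then show ?thesis using mixed[of v] mix[of v] by metis
    next
      case 6 then show ?thesis using noint[of v u] mix2[of v u] interlaced_commute[of "Some u"]
        by (metis UnI1)
    next
      case 7 then show ?thesis using mixed[of u] mix[of u] interlaced_commute[of "Some u"] by metis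
    next
      case 8 then show ?thesis by (rule oldc)
    qed
  qed
qed

section \<open>From words to polygons\<close>

text \<open>The points \<open>(i, i^2)\<close> of the parabola are in convex position; the
  orientation of three of them is a Vandermonde determinant, so its sign can be read off the
  indices.\<close>

lemma parabola_polygon:
  assumes "k \<ge> 3"
  shows "\<exists>p. convex_polygon k p"
proof
  let ?p = "\<lambda>i. vector [real i, (real i)\<^sup>2] :: real^2"
  have v: "orient (?p i) (?p j) (?p l) = (real j - real i) * (real l - real i) * (real l - real j)"
    for i j l
    by (simp add: orient_def vector_2 power2_eq_square algebra_simps)
  have "orient (?p i) (?p (Suc i mod k)) (?p j) > 0"
    if "i < k" "j < k" "j \<noteq> i" "j \<noteq> Suc i mod k" for i j
  proof (cases "Suc i = k")
    case True
    have "0 < real i * ((real i - real j) * real j)" using that True by auto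
    also have "\<dots> = (0 - real i) * (real j - real i) * (real j - 0)" by (simp add: algebra_simps)
    finally have "0 < (0 - real i) * (real j - real i) * (real j - 0)" .
    then show ?thesis unfolding v using True by simp
  next
    case False
    then have m: "Suc i mod k = Suc i" using that by simp
    have "j < i \<or> j > Suc i" using that m by auto
    then have "0 < (real j - real i) * (real j - real (Suc i))"
      by (cases "j < i") (auto intro: mult_neg_neg mult_pos_pos)
    then show ?thesis unfolding m v by simp
  qed
  then show "convex_polygon k ?p" using assms by (simp add: convex_polygon_def)
qed

section \<open>Positions of letters in a word\<close>

definition occ :: "'s list \<Rightarrow> 's \<Rightarrow> nat set" where
  "occ w s = {n. n < length w \<and> w ! n = s}"

lemma count_list_occ: "count_list w s = card (occ w s)"
  unfolding occ_def count_list_eq_length_filter length_filter_conv_card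
    by (metis (mono_tags, lifting))

lemma occ_append: "occ (a @ b) s = occ a s \<union> (\<lambda>n. n + length a) ` occ b s"
proof -
  have "n \<in> occ (a @ b) s \<longleftrightarrow> n \<in> occ a s \<union> (\<lambda>n. n + length a) ` occ b s" for n
    by (cases "n < length a") (auto simp: occ_def nth_append image_iff intro: exI[of _
        "n - length a"])
  then show ?thesis by blast
qed

lemma occ_segment:
  "(\<lambda>n. n + length a) ` occ b s = {n \<in> occ (a @ b @ c) s. length a \<le> n \<and> n < length a + length b}"
proof (intro set_eqI iffI)
  fix n assume "n \<in> {n \<in> occ (a @ b @ c) s. length a \<le> n \<and> n < length a + length b}"
  then show "n \<in> (\<lambda>n. n + length a) ` occ b s"
    by (intro image_eqI[of _ _ "n - length a"]) (auto simp: occ_def nth_append)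
qed (auto simp: occ_def nth_append)

lemma interlaced_occ:
  assumes "occ w u = {i, j}" "i < j" "occ w v = {i', j'}" "i' < j'" "u \<noteq> v"
  shows "interlaced u v w \<longleftrightarrow> (i < i' \<and> i' < j \<and> j < j') \<or> (i' < i \<and> i < j' \<and> j' < j)"
proof -
  have "i \<in> occ w u" "j \<in> occ w u" using assms(1) by simp_all
  then have ij: "i < length w" "w ! i = u" "j < length w" "w ! j = u" by (simp_all add: occ_def)
  have "i' \<in> occ w v" "j' \<in> occ w v" using assms(3) by simp_all
  then have "i \<noteq> i'" "i \<noteq> j'" "j \<noteq> i'" "j \<noteq> j'" using ij assms(5) by (auto simp: occ_def)
  note ne = this
  define a where "a = take i w"
  define b where "b = take (j - Suc i) (drop (Suc i) w)"
  define c where "c = drop (Suc j) w"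
  have w: "w = a @ u # b @ u # c"
  proof -
    have "w = a @ u # drop (Suc i) w" unfolding a_def using id_take_nth_drop[OF ij(1)] ij by simp
    moreover have "drop (Suc i) w = b @ u # c"
      using id_take_nth_drop[of "j - Suc i" "drop (Suc i) w"] ij assms(2) by (simp add: b_def c_def)
    ultimately show ?thesis by simp
  qed
  have l: "length a = i" "length b = j - Suc i" using ij assms(2) by (auto simp: a_def b_def)
  have oa: "occ a s = {n \<in> occ w s. n < i}" for s
    using ij by (auto simp: occ_def a_def)
  have ob: "(\<lambda>n. n + Suc i) ` occ b s = {n \<in> occ w s. i < n \<and> n < j}" for s
    using occ_segment[of "a @ [u]" b s "u # c"] l assms(2) by (simp add: w[symmetric] Suc_le_eq)
  have oc: "(\<lambda>n. n + Suc j) ` occ c s = {n \<in> occ w s. j < n}" for s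
  proof -
    have w2: "(a @ u # b @ [u]) @ c @ [] = w" using w by simp
    have l2: "length (a @ u # b @ [u]) = Suc j" using l assms(2) by simp
    have "(\<lambda>n. n + Suc j) ` occ c s = {n \<in> occ w s. Suc j \<le> n \<and> n < Suc j + length c}"
      using occ_segment[of "a @ u # b @ [u]" c s "[]"] unfolding w2 l2 by simp
    also have "\<dots> = {n \<in> occ w s. j < n}" using ij by (auto simp: occ_def c_def)
    finally show ?thesis .
  qed
  have ca: "count_list a s = card {n \<in> occ w s. n < i}" for s by (simp add: count_list_occ oa)
  have cb: "count_list b s = card {n \<in> occ w s. i < n \<and> n < j}" for s
    unfolding ob[symmetric] count_list_occ by (subst card_image) (auto simp: inj_on_def)
  have cc: "count_list c s = card {n \<in> occ w s. j < n}" for s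
    unfolding oc[symmetric] count_list_occ by (subst card_image) (auto simp: inj_on_def)
  have "{n \<in> occ w u. n < i} = {}" "{n \<in> occ w u. i < n \<and> n < j} = {}" "{n \<in> occ w u. j < n} = {}"
    using assms(1,2) by auto
  then have "count_list a u = 0" "count_list b u = 0" "count_list c u = 0" unfolding ca cb cc
    by (metis card.empty)+
  then have n: "u \<notin> set a" "u \<notin> set b" "u \<notin> set c" by (auto simp: count_list_0_iff)
  have i: "interlaced u v w \<longleftrightarrow> count_list b v = 1 \<and> count_list a v + count_list c v = 1"
    unfolding w by (rule interlaced_iff_count) (use n assms(5) in auto)
  have e: "{n \<in> occ w v. P n} = (if P i' then {i'} else {}) \<union> (if P j' then {j'} else {})" for P
    using assms(3) by auto
  have ec: "card {n \<in> occ w v. P n} = (if P i' then 1 else 0) + (if P j' then 1 else 0)" for P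
    unfolding e using assms(4) by auto
  show ?thesis unfolding i ca cb cc ec using assms(2,4) ne by (auto split: if_splits)
qed

lemma cornered_occ:
  assumes "cornered x (None # w)"
  obtains i j n where "occ w (Some x) = {i, j}" "i < n" "n < j" "n \<in> occ w None"
proof -
  obtain a b c where d: "None # w = a @ Some x # b @ Some x # c"
    "Some x \<notin> set a" "Some x \<notin> set b" "Some x \<notin> set c" using assms by (rule cornered_decomp)
  then obtain a' where a': "a = None # a'" "w = a' @ Some x # b @ Some x # c" by (cases a) auto
  have "None \<in> set b" using cornered_iff_count[OF d(2-4)] assms unfolding d(1) by blast
  then obtain m where m: "m < length b" "b ! m = None" by (auto simp: in_set_conv_nth)
  have o: "occ xs (Some x) = {}" if "Some x \<notin> set xs" for xs
    using that by (auto simp: occ_def dest: nth_mem)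
  have c: "occ (Some x # xs) (Some x) = insert 0 (Suc ` occ xs (Some x))" for xs
    using occ_append[of "[Some x]" xs "Some x"] by (auto simp: occ_def image_iff)
  have "occ w (Some x) = {length a', length a' + Suc (length b)}"
    unfolding a'(2) occ_append c using o d a' by (simp add: add.commute)
  moreover have "length a' + Suc m \<in> occ w None" using m by (auto simp: occ_def a'(2) nth_append)
  ultimately show ?thesis
    using that[of "length a'" "length a' + Suc (length b)" "length a' + Suc m"] m by simp
qed

lemma represents_start_corner:
  assumes "represents F k w" "k > 0"
  obtains w' where "represents F k (None # w')"
proof -
  have "None \<in> set w" using assms by (metis count_list_0_iff less_irrefl represents_def)
  then obtain a b where "w = a @ None # b" by (meson split_list)
  then have "represents F k (None # b @ a)"
    using assms(1) represents_append_commute[of F k a "None # b"] by simp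
  then show ?thesis by (rule that)
qed

text \<open>The cyclic word is cut open at a corner, which is dropped. Chords become intervals of
  positions, adjacency becomes proper overlap, and the dropped corner serves the outer arc of every
  chord, so only the inner arc still has to show one.\<close>

lemma represents_positions:
  assumes "represents F k (None # w)"
  obtains lo hi
    where "\<And>v. v \<in> verts F \<Longrightarrow>
      lo v < hi v \<and> occ w (Some v) = {lo v, hi v} \<and> (\<exists>n\<in>occ w None. lo v < n \<and> n < hi v)"
    "\<And>u v. u \<in> verts F \<Longrightarrow> v \<in> verts F \<Longrightarrow> lo u < lo v \<Longrightarrow> adj F u v \<longleftrightarrow> lo v < hi u \<and> hi u < hi v"
proof -
  have "\<exists>i j. i < j \<and> occ w (Some v) = {i, j} \<and> (\<exists>n\<in>occ w None. i < n \<and> n < j)"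
    if "v \<in> verts F" for v
  proof -
    have "cornered v (None # w)" using assms that by (simp add: represents_def)
    then obtain i j n where "occ w (Some v) = {i, j}" "i < n" "n < j" "n \<in> occ w None"
      by (rule cornered_occ)
    then show ?thesis using less_trans by blast
  qed
  then obtain lo hi
    where lh: "\<And>v. v \<in> verts F \<Longrightarrow>
      lo v < hi v \<and> occ w (Some v) = {lo v, hi v} \<and> (\<exists>n\<in>occ w None. lo v < n \<and> n < hi v)"
    by metis
  moreover have "adj F u v \<longleftrightarrow> lo v < hi u \<and> hi u < hi v"
    if "u \<in> verts F" "v \<in> verts F" "lo u < lo v" for u v
  proof -
    have "interlaced (Some u) (Some v) (None # w) \<longleftrightarrow> interlaced (Some u) (Some v) w"
      by (simp add: interlaced_def proj_Cons)
    then have "adj F u v \<longleftrightarrow> interlaced (Some u) (Some v) w"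
      using assms that unfolding represents_def by (metis less_irrefl)
    also have "\<dots> \<longleftrightarrow> lo v < hi u \<and> hi u < hi v"
      using interlaced_occ[of w "Some u" "lo u" "hi u" "Some v" "lo v" "hi v"] lh[OF that(1)] lh[OF
          that(2)] that(3)
      by fastforce
    finally show ?thesis .
  qed
  ultimately show ?thesis by (rule that)
qed

lemma represents_adj_sym:
  assumes "represents F k w" "u \<in> verts F" "v \<in> verts F" "u \<noteq> v"
  shows "adj F u v \<longleftrightarrow> adj F v u"
  using assms interlaced_commute unfolding represents_def by metis

text \<open>Each letter is put on the side numbered by the corners before it, in the order of the
  word. Overlapping intervals then give crossing chords, and all others are separated by a
  line.\<close>

theorem represents_imp_polygon_graph:
  assumes rep: "represents F k w" and k: "k \<ge> 3"
  shows "polygon_graph k F"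
proof -
  obtain w' where w': "represents F k (None # w')" using represents_start_corner[OF rep] k by auto
  obtain lo hi
    where lh: "\<And>v. v \<in> verts F \<Longrightarrow>
      lo v < hi v \<and> occ w' (Some v) = {lo v, hi v} \<and> (\<exists>n\<in>occ w' None. lo v < n \<and> n < hi v)"
    and ad: "\<And>u v. u \<in> verts F \<Longrightarrow> v \<in> verts F \<Longrightarrow> lo u < lo v \<Longrightarrow> adj F u v \<longleftrightarrow> lo v < hi u \<and> hi u < hi v"
    using represents_positions[OF w'] by metis
  obtain p where p: "convex_polygon k p" using parabola_polygon[OF k] by blast
  define N where "N = length w'"
  define sec where "sec n = count_list (take n w') None" for n
  \<comment> \<open>The integer part selects the side, and the fraction increases with the position.
    Adding 1 in numerator and denominator keeps the fraction strictly between 0 and 1 for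
    \<open>n < N\<close>, so no chord ends at a corner.\<close>
  define th where "th n = real (sec n) + (real n + 1) / (real N + 1)" for n
  have cntw: "count_list w' None = k - 1" using w' by (auto simp: represents_def)
  have sec_mono: "sec m \<le> sec n" if "m \<le> n" for m n
  proof -
    have "take n w' = take m w' @ take (n - m) (drop m w')" using that
      by (metis le_add_diff_inverse take_add)
    then show ?thesis by (simp add: sec_def count_list_append)
  qed
  have sec_strict: "sec m < sec n" if "m \<le> l" "l < n" "l \<in> occ w' None" for m l n
  proof -
    have "sec (Suc l) = Suc (sec l)" using that(3)
      by (simp add: occ_def sec_def take_Suc_conv_app_nth count_list_append)
    then show ?thesis using sec_mono[OF that(1)] sec_mono[of "Suc l" n] that(2) by simp
  qed
  have sec_less: "sec n < k" for n
  proof -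
    have "count_list w' None = sec n + count_list (drop n w') None"
      by (metis append_take_drop_id count_list_append sec_def)
    then show ?thesis using cntw k by simp
  qed
  have fr: "0 < (real n + 1) / (real N + 1)" "(real n + 1) / (real N + 1) < 1" if "n < N" for n
    using that by auto
  have th_mono: "th m < th n" if "m < n" for m n
  proof -
    have "(real m + 1) / (real N + 1) < (real n + 1) / (real N + 1)" using that
      by (simp add: divide_strict_right_mono)
    then show ?thesis using sec_mono[of m n] that by (simp add: th_def)
  qed
  have th_b: "real (sec n) < th n" "th n < real (sec n) + 1" if "n < N" for n
    using fr[OF that] by (auto simp: th_def)
  have th_f: "\<lfloor>th n\<rfloor> = int (sec n)" if "n < N" for n using th_b[OF that] by linarith
  have th_k: "0 < th n" "th n < real k" if "n < N" for n
    using th_b[OF that] sec_less[of n] by linarith+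
  have nonint: "th n \<noteq> of_int \<lfloor>th n\<rfloor>" if "n < N" for n using th_f[OF that] th_b[OF that] by simp
  have posN: "lo v < N" "hi v < N" "sec (lo v) < sec (hi v)" if "v \<in> verts F" for v
  proof -
    have "lo v \<in> occ w' (Some v)" "hi v \<in> occ w' (Some v)" using lh[OF that] by auto
    then show "lo v < N" "hi v < N" by (auto simp: occ_def N_def)
    show "sec (lo v) < sec (hi v)" using lh[OF that] sec_strict less_imp_le by blast
  qed
  define c where "c v = closed_segment (bd k p (th (lo v))) (bd k p (th (hi v)))" for v
  have chord: "is_chord k p (c v)" if v: "v \<in> verts F" for v
  proof -
    note P = posN[OF v]
    have "bd k p (th (lo v)) \<noteq> bd k p (th (hi v))"
    proof
      assume eq: "bd k p (th (lo v)) = bd k p (th (hi v))"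
      \<comment> \<open>The ends are distinguished by an orientation: a triangle with two equal
        corners would be degenerate, while a boundary point between ends on different sides makes it
        positive.\<close>
      let ?m = "(th (lo v) + th (hi v)) / 2"
      have "th (lo v) < th (hi v)" using th_mono lh[OF v] by blast
      then have "orient (bd k p (th (lo v))) (bd k p ?m) (bd k p (th (hi v))) > 0"
        using th_k[OF P(1)] th_k[OF P(2)] th_f[OF P(1)] th_f[OF P(2)] P(3) nonint[OF P(2)]
        by (intro orient_bd_pos[OF p]) auto
      then show False unfolding eq by simp
    qed
    moreover have "bd k p (th (lo v)) \<in> side k p (sec (lo v))"
        "bd k p (th (hi v)) \<in> side k p (sec (hi v))"
      using th_b[OF P(1)] th_b[OF P(2)] by (auto intro!: bd_in_side)
    ultimately show ?thesis unfolding is_chord_def c_def using sec_less P(3) by (metis less_irrefl)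
  qed
  have one: "adj F u v \<longleftrightarrow> c u \<inter> c v \<noteq> {}"
    if u: "u \<in> verts F" and v: "v \<in> verts F" and l: "lo u < lo v" for u v
  proof -
    note U = posN[OF u] and V = posN[OF v]
    have hne: "hi u \<noteq> hi v" "hi u \<noteq> lo v" 
    proof -
      have "u \<noteq> v" using l by auto
      moreover have "hi u \<in> occ w' (Some u)" "hi v \<in> occ w' (Some v)" "lo v \<in> occ w' (Some v)"
        using lh[OF u] lh[OF v] by auto
      ultimately show "hi u \<noteq> hi v" "hi u \<noteq> lo v" by (auto simp: occ_def)
    qed
    show ?thesis
    proof (cases "lo v < hi u \<and> hi u < hi v")
      case True
      then have "c u \<inter> c v \<noteq> {}" unfolding c_def using l th_mono th_k[OF U(1)] th_k[OF V(2)]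
        by (intro crossing_chords_meet[OF p]) auto
      then show ?thesis using ad[OF u v l] True by simp
    next
      case False
      then have f: "hi u < lo v \<or> hi v < hi u" using hne by linarith
      have lv: "lo v < hi v" using lh[OF v] by simp
      have "c u \<inter> c v = {}" unfolding c_def
      proof (rule noncrossing_chords_disjoint[OF p])
        \<comment> \<open>The corner required between the ends of \<open>v\<close> is the one where
          the side of \<open>hi v\<close> begins.\<close>
        show "th (lo v) \<le> of_int (int (sec (hi v)))" using th_b(2)[OF V(1)] V(3) by simp
        show "of_int (int (sec (hi v))) \<le> th (hi v)" using th_b(1)[OF V(2)] by simp
        show "th (lo u) < th (lo v) \<or> th (hi v) < th (lo u)" "th (lo u) < th (lo v) \<or>
            th (hi u) < th (lo v)"
          using th_mono[OF l] by auto
        show "th (hi u) < th (lo v) \<or> th (hi v) < th (hi u)" using f th_mono by blast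
      qed (use th_k U V th_mono[OF lv] less_imp_le in auto)
      then show ?thesis using ad[OF u v l] False by simp
    qed
  qed
  have "adj F u v \<longleftrightarrow> c u \<inter> c v \<noteq> {}" if u: "u \<in> verts F" and v: "v \<in> verts F" and uv: "u \<noteq> v" for u v
  proof -
    have "lo u \<in> occ w' (Some u)" "lo v \<in> occ w' (Some v)" using lh[OF u] lh[OF v] by auto
    then have "lo u \<noteq> lo v" using uv by (auto simp: occ_def)
    then consider "lo u < lo v" | "lo v < lo u" by linarith
    then show ?thesis
    proof cases
      case 1 then show ?thesis using one[OF u v] by simp
    next
      case 2 then show ?thesis using one[OF v u] represents_adj_sym[OF rep u v uv]
        by (simp add: Int_commute)
    qed
  qed
  then have "\<exists>p c. convex_polygon k p \<and> (\<forall>v\<in>verts F. is_chord k p (c v)) \<and>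
      (\<forall>u\<in>verts F. \<forall>v\<in>verts F. u \<noteq> v \<longrightarrow> (adj F u v \<longleftrightarrow> c u \<inter> c v \<noteq> {}))"
    using p chord by blast
  then show ?thesis using k unfolding polygon_graph_def by simp
qed

lemma rank_bij:
  fixes f :: "'b \<Rightarrow> int"
  assumes "finite V" "inj_on f V"
  shows "bij_betw (\<lambda>v. card {u \<in> V. f u < f v}) V {..<card V}"
    and "u \<in> V \<Longrightarrow> v \<in> V \<Longrightarrow> card {x \<in> V. f x < f u} < card {x \<in> V. f x < f v} \<longleftrightarrow> f u < f v"
proof -
  let ?r = "\<lambda>v. card {u \<in> V. f u < f v}"
  have mono: "?r u < ?r v" if "u \<in> V" "v \<in> V" "f u < f v" for u v
    by (rule psubset_card_mono) (use that assms(1) in auto)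
  show iff: "?r u < ?r v \<longleftrightarrow> f u < f v" if "u \<in> V" "v \<in> V" for u v
  proof -
    consider "f u < f v" | "f v < f u" | "f u = f v" by linarith
    then show ?thesis using mono[OF that] mono[OF that(2,1)] by cases auto
  qed
  have inj: "inj_on ?r V"
  proof (rule inj_onI, rule ccontr)
    fix u v assume uv: "u \<in> V" "v \<in> V" "?r u = ?r v" "u \<noteq> v"
    then have "f u \<noteq> f v" using assms(2) by (auto dest: inj_onD)
    then show False using mono[OF uv(1,2)] mono[OF uv(2,1)] uv(3) by linarith
  qed
  have "?r v < card V" if "v \<in> V" for v
    by (rule psubset_card_mono) (use that assms(1) in auto)
  then have "?r ` V \<subseteq> {..<card V}" by auto
  moreover have "card (?r ` V) = card V" using inj by (rule card_image)
  ultimately have "?r ` V = {..<card V}" by (simp add: card_subset_eq)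
  then show "bij_betw ?r V {..<card V}" using inj by (simp add: bij_betw_def)
qed

text \<open>After the cut one corner is left; it lies between the two occurrences of every vertex,
  so the chords join two lines. For \<open>lo u < lo v\<close> they cross iff
  \<open>hi u < hi v\<close>, whereas a permutation graph asks for inversions; hence the second line
  is read backwards, by ranking \<open>- int (hi v)\<close>.\<close>

theorem represents_imp_permutation_graph:
  assumes rep: "represents F 2 w"
  shows "permutation_graph F"
proof -
  obtain w' where w': "represents F 2 (None # w')" using represents_start_corner[OF rep] by auto
  obtain lo hi
    where lh: "\<And>v. v \<in> verts F \<Longrightarrow>
      lo v < hi v \<and> occ w' (Some v) = {lo v, hi v} \<and> (\<exists>n\<in>occ w' None. lo v < n \<and> n < hi v)"
    and ad: "\<And>u v. u \<in> verts F \<Longrightarrow> v \<in> verts F \<Longrightarrow> lo u < lo v \<Longrightarrow> adj F u v \<longleftrightarrow> lo v < hi u \<and> hi u < hi v"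
    using represents_positions[OF w'] by metis
  let ?V = "verts F" and ?n = "card (verts F)"
  have "count_list w' None = 1" using w' by (simp add: represents_def)
  then obtain q where q: "occ w' None = {q}" unfolding count_list_occ
    by (auto simp: card_1_singleton_iff)
  then have lq: "lo v < q" "q < hi v" if "v \<in> ?V" for v using lh[OF that] by auto
  have "Some ` ?V \<subseteq> set w" using rep by (auto simp: represents_def)
  then have fin: "finite ?V" by (metis finite_imageD finite_set finite_subset inj_Some)
  have mem: "lo v \<in> occ w' (Some v)" "hi v \<in> occ w' (Some v)" if "v \<in> ?V" for v using lh[OF that]
    by auto
  have inj: "inj_on (\<lambda>v. int (lo v)) ?V" "inj_on (\<lambda>v. - int (hi v)) ?V"
  proof -
    have "u = v" if "x \<in> occ w' (Some u)" "x \<in> occ w' (Some v)" for u v x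
      using that by (simp add: occ_def)
    then show "inj_on (\<lambda>v. int (lo v)) ?V" "inj_on (\<lambda>v. - int (hi v)) ?V"
      using mem by (simp_all add: inj_on_def) metis+
  qed
  define \<sigma> where "\<sigma> v = card {u \<in> ?V. int (lo u) < int (lo v)}" for v
  define \<tau> where "\<tau> v = card {u \<in> ?V. - int (hi u) < - int (hi v)}" for v
  have bs: "bij_betw \<sigma> ?V {..<?n}" unfolding \<sigma>_def using rank_bij(1)[OF fin inj(1)] .
  have bt: "bij_betw \<tau> ?V {..<?n}" unfolding \<tau>_def using rank_bij(1)[OF fin inj(2)] .
  define \<pi> where "\<pi> x = (if x < ?n then \<tau> (the_inv_into ?V \<sigma> x) else x)" for x
  have ps: "\<pi> (\<sigma> v) = \<tau> v" if "v \<in> ?V" for v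
    using that bs by (auto simp: \<pi>_def bij_betw_def the_inv_into_f_f)
  have "bij_betw (\<tau> \<circ> the_inv_into ?V \<sigma>) {..<?n} {..<?n}"
    using bij_betw_trans[OF bij_betw_the_inv_into[OF bs] bt] .
  then have "bij_betw \<pi> {..<?n} {..<?n}"
    by (rule bij_betw_cong[THEN iffD1, rotated]) (simp add: \<pi>_def)
  then have "\<pi> permutes {..<?n}" by (rule bij_imp_permutes) (simp add: \<pi>_def)
  moreover have "adj F u v \<longleftrightarrow> \<pi> (\<sigma> v) < \<pi> (\<sigma> u)"
    if u: "u \<in> ?V" and v: "v \<in> ?V" and l: "\<sigma> u < \<sigma> v" for u v
  proof -
    have "lo u < lo v" using l rank_bij(2)[OF fin inj(1) u v] by (simp add: \<sigma>_def)
    then have "adj F u v \<longleftrightarrow> hi u < hi v" using ad[OF u v] lq(1)[OF v] lq(2)[OF u] by auto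
    also have "\<dots> \<longleftrightarrow> \<tau> v < \<tau> u" using rank_bij(2)[OF fin inj(2) v u] by (simp add: \<tau>_def)
    finally show ?thesis using ps u v by simp
  qed
  ultimately show ?thesis using bs unfolding permutation_graph_def by blast
qed

section \<open>Asteroidal sets of polygon graphs\<close>

text \<open>Among three members the middle one in the order \<open>\<sigma>\<close> separates the
  other two: a vertex not adjacent to it lies on the same side of it on both lines, and a path that
  avoids its neighbourhood cannot change sides.\<close>

lemma asteroidal_set_permutation_graph:
  assumes "simple_graph G" "permutation_graph G" "asteroidal_set G A"
  shows "card A \<le> 2"
proof (rule ccontr)
  assume "\<not> card A \<le> 2"
  have A: "A \<subseteq> verts G" using assms(3) by (simp add: asteroidal_set_def)
  obtain \<sigma> \<pi> where s: "bij_betw \<sigma> (verts G) {..<card (verts G)}"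
    and p: "\<pi> permutes {..<card (verts G)}"
    and ad: "\<And>u v. u \<in> verts G \<Longrightarrow> v \<in> verts G \<Longrightarrow> \<sigma> u < \<sigma> v \<Longrightarrow> (adj G u v \<longleftrightarrow> \<pi> (\<sigma> v) < \<pi> (\<sigma> u))"
    using assms(2) unfolding permutation_graph_def by blast
  have inj: "\<sigma> u = \<sigma> v \<longleftrightarrow> u = v" if "u \<in> verts G" "v \<in> verts G" for u v
    using s that by (auto simp: bij_betw_def inj_on_def)
  have pinj: "\<pi> x = \<pi> y \<longleftrightarrow> x = y" for x y using permutes_inj[OF p] by (auto simp: inj_def)
  obtain B where B: "B \<subseteq> A" "card B = 3" "finite B"
    using \<open>\<not> card A \<le> 2\<close>
      by (metis obtain_subset_with_card_n not_less_eq_eq numeral_2_eq_2 numeral_3_eq_3)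
  then obtain a b c where abc: "B = {a, b, c}" "a \<noteq> b" "b \<noteq> c" "a \<noteq> c" by (metis card_3_iff)
  have *: False if xyz: "x \<in> A" "y \<in> A" "z \<in> A" "\<sigma> x < \<sigma> y" "\<sigma> y < \<sigma> z" for x y z
  proof -
    let ?H = "induced G (verts G - closed_nbhd G y)"
    have y: "y \<in> verts G" using A that by auto
    have "joined ?H x z" using assms(3) xyz unfolding asteroidal_set_def by fastforce
    moreover have "\<sigma> x < \<sigma> y" by fact
    moreover have "\<sigma> v < \<sigma> y" if h: "adj ?H u v" "\<sigma> u < \<sigma> y" for u v
    proof (rule ccontr)
      have uv: "u \<in> verts G" "v \<in> verts G" "\<not> adj G u y" "\<not> adj G y v" "v \<noteq> y" "adj G u v"
        using h by (auto simp: closed_nbhd_def adj_commute)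
      assume "\<not> \<sigma> v < \<sigma> y"
      then have l: "\<sigma> y < \<sigma> v" using inj[OF y uv(2)] uv(5) by auto
      \<comment> \<open>On both lines \<open>u\<close> is before \<open>y\<close> and
        \<open>y\<close> before \<open>v\<close>, so \<open>u\<close> and \<open>v\<close> cannot
        cross.\<close>
      show False using ad[OF uv(1) y h(2)] ad[OF y uv(2) l] ad[OF uv(1,2)] uv h(2) l
          pinj[of "\<sigma> u" "\<sigma> y"] pinj[of "\<sigma> v" "\<sigma> y"] by linarith
    qed
    ultimately have "\<sigma> z < \<sigma> y" by (rule joined_invariant)
    then show False using xyz(5) by simp
  qed
  have "a \<in> A" "b \<in> A" "c \<in> A" using abc B by auto
  moreover have "\<sigma> a \<noteq> \<sigma> b" "\<sigma> b \<noteq> \<sigma> c" "\<sigma> a \<noteq> \<sigma> c" using inj abc calculation A by auto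
  ultimately show False using * by (metis linorder_neqE_nat)
qed

text \<open>The corner \<open>r\<close> is the trace of the ends being on distinct sides. An end
  that is itself a corner belongs to two sides, and then it may serve as \<open>r\<close>.\<close>

lemma chord_params:
  assumes p: "convex_polygon k p" and c: "is_chord k p C"
  shows "\<exists>s t r. 0 \<le> s \<and> s < t \<and> t < real k \<and> C = closed_segment (bd k p s) (bd k p t) \<and>
      s \<le> of_int r \<and> of_int r \<le> t"
proof -
  obtain i j x y
    where ij: "i < k" "j < k" "i \<noteq> j" "x \<in> side k p i" "y \<in> side k p j" "x \<noteq> y" "C =
      closed_segment x y"
    using c unfolding is_chord_def by blast
  obtain s where s: "0 \<le> s" "s < real k" "bd k p s = x" "s \<noteq> of_int \<lfloor>s\<rfloor> \<Longrightarrow> nat \<lfloor>s\<rfloor> = i"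
    using side_param[OF ij(1,4)] by metis
  obtain t where t: "0 \<le> t" "t < real k" "bd k p t = y" "t \<noteq> of_int \<lfloor>t\<rfloor> \<Longrightarrow> nat \<lfloor>t\<rfloor> = j"
    using side_param[OF ij(2,5)] by metis
  have "s \<noteq> t" using s t ij by auto
  have "\<exists>r. min s t \<le> of_int r \<and> of_int r \<le> max s t"
  proof (cases "\<lfloor>s\<rfloor> = \<lfloor>t\<rfloor>")
    case True
    \<comment> \<open>Equal integer parts although the sides are different: one end must be a
      corner.\<close>
    then consider "s = of_int \<lfloor>s\<rfloor>" | "t = of_int \<lfloor>t\<rfloor>" using s(4) t(4) ij by auto
    then show ?thesis
      by cases (metis max.cobounded1 min.cobounded1, metis max.cobounded2 min.cobounded2)
  next
    case False
    show ?thesis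
    proof (cases "s < t")
      case True
      then have "s \<le> of_int \<lfloor>t\<rfloor>" using False by linarith
      then show ?thesis using True by (intro exI[of _ "\<lfloor>t\<rfloor>"]) auto
    next
      case f: False
      then have "t \<le> of_int \<lfloor>s\<rfloor>" using False by linarith
      then show ?thesis using f by (intro exI[of _ "\<lfloor>s\<rfloor>"]) auto
    qed
  qed
  then obtain r where r: "min s t \<le> of_int r" "of_int r \<le> max s t" by blast
  show ?thesis
  proof (cases "s < t")
    case True
    then have "0 \<le> s \<and> s < t \<and> t < real k \<and> C = closed_segment (bd k p s) (bd k p t) \<and>
        s \<le> of_int r \<and> of_int r \<le> t"
      using s t r ij(7) by simp
    then show ?thesis by blast
  next
    case False
    then have "0 \<le> t \<and> t < s \<and> s < real k \<and> C = closed_segment (bd k p t) (bd k p s) \<and>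
        t \<le> of_int r \<and> of_int r \<le> s"
      using s t r ij(7) \<open>s \<noteq> t\<close> by (simp add: closed_segment_commute)
    then show ?thesis by blast
  qed
qed

lemma asteroidal_set_polygon_graph:
  assumes "simple_graph G" "polygon_graph k G" "k \<ge> 2" "asteroidal_set G A"
  shows "card A \<le> k"
proof (cases "k = 2")
  case True
  then show ?thesis using asteroidal_set_permutation_graph assms by (auto simp: polygon_graph_def)
next
  case False
  then have "\<exists>p c. convex_polygon k p \<and> (\<forall>v\<in>verts G. is_chord k p (c v)) \<and>
      (\<forall>u\<in>verts G. \<forall>v\<in>verts G. u \<noteq> v \<longrightarrow> (adj G u v \<longleftrightarrow> c u \<inter> c v \<noteq> {}))"
    using assms(2) unfolding polygon_graph_def by simp
  then obtain p c where p: "convex_polygon k p" and ch': "\<forall>v\<in>verts G. is_chord k p (c v)"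
    and ad': "\<forall>u\<in>verts G. \<forall>v\<in>verts G. u \<noteq> v \<longrightarrow> (adj G u v \<longleftrightarrow> c u \<inter> c v \<noteq> {})"
    by (elim exE conjE)
  have ch: "is_chord k p (c v)" if "v \<in> verts G" for v using ch' that by blast
  have ad: "adj G u v \<longleftrightarrow> c u \<inter> c v \<noteq> {}" if "u \<in> verts G" "v \<in> verts G" "u \<noteq> v" for u v
    using ad' that by simp
  have A: "A \<subseteq> verts G" using assms(4) by (simp add: asteroidal_set_def)
  have "\<forall>v\<in>verts G. \<exists>s t r. 0 \<le> s \<and> s < t \<and> t < real k \<and>
      c v = closed_segment (bd k p s) (bd k p t) \<and> s \<le> of_int r \<and> of_int r \<le> t"
    using chord_params[OF p] ch by blast
  then obtain s t r where str: "\<forall>v\<in>verts G. 0 \<le> s v \<and> s v < t v \<and> t v < real k \<and>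
      c v = closed_segment (bd k p (s v)) (bd k p (t v)) \<and> s v \<le> of_int (r v) \<and> of_int (r v) \<le> t v"
    unfolding bchoice_iff by (elim exE)
  then have st: "\<And>v. v \<in> verts G \<Longrightarrow> 0 \<le> s v" "\<And>v. v \<in> verts G \<Longrightarrow> s v < t v" "\<And>v. v \<in> verts G \<Longrightarrow>
      t v < real k"
      "\<And>v. v \<in> verts G \<Longrightarrow> c v = closed_segment (bd k p (s v)) (bd k p (t v))"
    and r: "\<And>v. v \<in> verts G \<Longrightarrow> s v \<le> of_int (r v)" "\<And>v. v \<in> verts G \<Longrightarrow> of_int (r v) \<le> t v"
    by simp_all
  define inside where "inside a v \<longleftrightarrow> s a < s v \<and> t v < t a" for a v
  define outside where "outside a v \<longleftrightarrow> (s v < s a \<or> t a < s v) \<and> (t v < s a \<or> t a < t v)" for a v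
  have io: "inside a v \<or> outside a v"
    if a: "a \<in> verts G" and v: "v \<in> verts G" and e: "c a \<inter> c v = {}" for a v
  proof (rule ccontr)
    assume n: "\<not> (inside a v \<or> outside a v)"
    have ne: "bd k p (s a) \<in> c a" "bd k p (t a) \<in> c a" "bd k p (s v) \<in> c v" "bd k p (t v) \<in> c v"
      using st(4) a v by auto
    have "s a \<noteq> s v" "s a \<noteq> t v" "t a \<noteq> s v" "t a \<noteq> t v" using ne e by (metis IntI empty_iff)+
    then have "(s v < s a \<and> s a < t v \<and> t v < t a) \<or> (s a < s v \<and> s v < t a \<and> t a < t v)"
      using n st(2)[OF a] st(2)[OF v] unfolding inside_def outside_def by linarith
    then show False
    proof
      assume "s v < s a \<and> s a < t v \<and> t v < t a"
      then have "c v \<inter> c a \<noteq> {}" unfolding st(4)[OF a] st(4)[OF v]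
        using st(1)[OF v] st(3)[OF a] by (intro crossing_chords_meet[OF p]) auto
      then show False using e by blast
    next
      assume "s a < s v \<and> s v < t a \<and> t a < t v"
      then have "c a \<inter> c v \<noteq> {}" unfolding st(4)[OF a] st(4)[OF v]
        using st(1)[OF a] st(3)[OF v] by (intro crossing_chords_meet[OF p]) auto
      then show False using e by blast
    qed
  qed
  have sep: "c v \<inter> c u = {}" if a: "a \<in> verts G" and u: "u \<in> verts G" and v: "v \<in> verts G"
    and i: "inside a u" and o: "outside a v" for a u v
  proof (cases "s v < s u \<or> t v < s u")
    case True
    show ?thesis unfolding st(4)[OF u] st(4)[OF v]
      by (rule noncrossing_chords_disjoint[OF p, where r = "r u"])
        (use st[OF u] st[OF v] r[OF u] True i o st(2)[OF a] in \<open>auto simp: inside_def outside_def\<close>)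
  next
    case False
    \<comment> \<open>Now the chord of \<open>v\<close> lies entirely after that of
      \<open>u\<close>. The roles are exchanged, because \<open>noncrossing_chords_disjoint\<close>
      wants an end before the arc it separates.\<close>
    then have l: "t u < s v" using i o st[OF a] st[OF u] st[OF v] unfolding inside_def outside_def
      by linarith
    have "c u \<inter> c v = {}" unfolding st(4)[OF u] st(4)[OF v]
      by (rule noncrossing_chords_disjoint[OF p, where r = "r v"])
        (use st[OF u] st[OF v] r[OF v] l in auto)
    then show ?thesis by blast
  qed
  \<comment> \<open>A path that avoids the neighbourhood of \<open>a\<close> cannot pass from one
    side of its chord to the other, so one member of \<open>A\<close> decides the side for all
    others.\<close>
  have inv: "inside a v"
    if a: "a \<in> A" and u: "u \<in> A - {a}" and v: "v \<in> A - {a}" and i: "inside a u" for a u v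
  proof -
    let ?H = "induced G (verts G - closed_nbhd G a)"
    have aG: "a \<in> verts G" using A a by auto
    have "joined ?H u v" using assms(4) a u v unfolding asteroidal_set_def by blast
    moreover have "inside a u" by fact
    moreover have "inside a y" if h: "adj ?H x y" "inside a x" for x y
    proof (rule ccontr)
      have xy: "x \<in> verts G" "y \<in> verts G" "\<not> adj G a y" "y \<noteq> a" "adj G x y" "x \<noteq> y"
        using h simple_graph_adjD[OF assms(1)] by (auto simp: closed_nbhd_def)
      assume "\<not> inside a y"
      then have "outside a y" using io[OF aG xy(2)] ad[OF aG xy(2)] xy by auto
      then have "c y \<inter> c x = {}" using sep[OF aG xy(1,2) h(2)] by simp
      then show False using ad[OF xy(1,2,6)] xy(5) by blast
    qed
    ultimately show "inside a v" by (rule joined_invariant)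
  qed
  have indep: "c a \<inter> c b = {}" if "a \<in> A" "b \<in> A" "a \<noteq> b" for a b
  proof -
    have "joined (induced G (verts G - closed_nbhd G a)) b b"
      using assms(4) that unfolding asteroidal_set_def by blast
    then have "\<not> adj G a b" by (auto simp: joined_def closed_nbhd_def)
    then show ?thesis using ad that A by blast
  qed
  \<comment> \<open>A member is big if the others lie in its parameter interval. The arc free of
    them is then the one through parameter 0, so it is labelled by corner 0; any other member lies
    strictly inside, so its corner is positive. At most one member is big, and the intervals of the
    remaining ones are pairwise disjoint.\<close>
  define big where "big a \<longleftrightarrow> (\<exists>b\<in>A - {a}. inside a b)" for a
  define f where "f a = (if big a then 0 else r a)" for a
  have bigs: "inside a b" if "big a" "a \<in> A" "b \<in> A" "a \<noteq> b" for a b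
    using that inv[of a _ b] unfolding big_def by blast
  have "f a \<noteq> f b" if ab: "a \<in> A" "b \<in> A" "a \<noteq> b" for a b
  proof -
    have G: "a \<in> verts G" "b \<in> verts G" using A ab by auto
    have 1: "f x \<noteq> f y" if "big x" "x \<in> A" "y \<in> A" "x \<noteq> y" for x y
    proof -
      have xy: "inside x y" using bigs that by blast
      have G: "x \<in> verts G" "y \<in> verts G" using A that by auto
      have "\<not> big y" using bigs[of y x] that xy st(2)[OF G(1)] unfolding inside_def by force
      moreover have "r y > 0" using xy r(1)[OF G(2)] st(1)[OF G(1)] unfolding inside_def by linarith
      ultimately show ?thesis using that by (simp add: f_def)
    qed
    show ?thesis
    proof (cases "big a \<or> big b")
      case True then show ?thesis using 1[of a b] 1[of b a] ab by auto
    next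
      case False
      then have ni: "\<not> inside a b" "\<not> inside b a" using ab unfolding big_def by blast+
      then have "outside a b" using io[OF G] indep[OF ab] by blast
      then have "t b < s a \<or> t a < s b" using ni st(2)[OF G(1)] st(2)[OF G(2)]
        unfolding inside_def outside_def by linarith
      then have "r a \<noteq> r b" using r[OF G(1)] r[OF G(2)] by auto
      then show ?thesis using False by (simp add: f_def)
    qed
  qed
  then have "inj_on f A" by (auto simp: inj_on_def)
  moreover have "f ` A \<subseteq> {0..<int k}"
  proof -
    have "0 \<le> r a" "r a < int k" if "a \<in> verts G" for a
    proof -
      have "0 \<le> real_of_int (r a)" "real_of_int (r a) < real k" using st[OF that] r[OF that]
        by linarith+
      then show "0 \<le> r a" "r a < int k" by linarith+
    qed
    then show ?thesis using A assms(3) by (auto simp: f_def)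
  qed
  ultimately have "card A \<le> card {0..<int k}" by (intro card_inj_on_le[of f]) auto
  then show ?thesis by simp
qed

section \<open>Decomposition trees\<close>

text \<open>Undoes a simple split decomposition with marker \<open>m\<close>.\<close>

definition glue :: "'b ugraph \<Rightarrow> 'b ugraph \<Rightarrow> 'b \<Rightarrow> 'b ugraph" where
  "glue F H m = \<lparr>verts = (verts F \<union> verts H) - {m},
     edges = {e \<in> edges F \<union> edges H. m \<notin> e} \<union> {{x, y} | x y. adj F m x \<and> adj H m y}\<rparr>"

lemma verts_glue [simp]: "verts (glue F H m) = (verts F \<union> verts H) - {m}"
  by (simp add: glue_def)

lemma glue_commute: "glue F H m = glue H F m"
proof -
  have "{{x, y} | x y. adj F m x \<and> adj H m y} = {{x, y} | x y. adj H m x \<and> adj F m y}"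
    by (auto simp: insert_commute)
  then show ?thesis by (simp add: glue_def Un_commute)
qed

lemma adj_glue:
  assumes "simple_graph F" "simple_graph H"
  shows "adj (glue F H m) u v \<longleftrightarrow> u \<noteq> m \<and> v \<noteq> m \<and>
    (adj F u v \<or> adj H u v \<or> adj F m u \<and> adj H m v \<or> adj F m v \<and> adj H m u)"
proof -
  have 1: "(\<exists>x y. {u, v} = {x, y} \<and> adj F m x \<and> adj H m y) \<longleftrightarrow>
      adj F m u \<and> adj H m v \<or> adj F m v \<and> adj H m u"
    by (auto simp: doubleton_eq_iff)
  have "adj (glue F H m) u v \<longleftrightarrow> (adj F u v \<or> adj H u v) \<and> m \<notin> {u, v} \<or>
      (\<exists>x y. {u, v} = {x, y} \<and> adj F m x \<and> adj H m y)"
  proof -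
    have "edges (glue F H m) = {e \<in> edges F \<union> edges H. m \<notin> e} \<union> {{x, y} | x y. adj F m x \<and>
        adj H m y}"
      by (simp add: glue_def)
    then show ?thesis unfolding adj_def[of "glue F H m"] adj_def[of F u] adj_def[of H u] by simp
  qed
  then have "adj (glue F H m) u v \<longleftrightarrow> (adj F u v \<or> adj H u v) \<and> u \<noteq> m \<and> v \<noteq> m \<or>
      adj F m u \<and> adj H m v \<or> adj F m v \<and> adj H m u"
    unfolding 1 by auto
  moreover have "\<not> adj F m m" "\<not> adj H m m"
    using simple_graph_adjD(3)[OF assms(1), of m m] simple_graph_adjD(3)[OF assms(2), of m m]
      by auto
  ultimately show ?thesis by auto
qed

lemma simple_graph_glue:
  assumes "simple_graph F" "simple_graph H" "verts F \<inter> verts H \<subseteq> {m}"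
  shows "simple_graph (glue F H m)"
proof -
  have "e \<subseteq> verts (glue F H m) \<and> card e = 2" if e: "e \<in> edges (glue F H m)" for e
  proof -
    consider "e \<in> edges F \<union> edges H" "m \<notin> e" | x y where "e = {x, y}" "adj F m x" "adj H m y"
      using e by (auto simp: glue_def)
    then show ?thesis
    proof cases
      case 1 then show ?thesis using assms by (auto simp: simple_graph_def)
    next
      case 2
      then show ?thesis
        using assms simple_graph_adjD[OF assms(1) 2(2)] simple_graph_adjD[OF assms(2) 2(3)]
        by (auto simp: card_insert_if)
    qed
  qed
  then show ?thesis using assms(1,2) by (auto simp: simple_graph_def)
qed

text \<open>A neighbour \<open>h\<close> of the marker in the other piece has in the glued graph
  exactly the neighbours in \<open>F\<close> that the marker had, so it can stand for the
  marker.\<close>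

lemma embedding_glue:
  assumes "simple_graph F" "simple_graph H" "m \<in> verts F" "verts F \<inter> verts H = {m}" "adj H m h"
  shows "embedding (\<lambda>x. if x = m then h else x) F (glue F H m)"
proof -
  have h: "h \<in> verts H" "h \<noteq> m" "h \<notin> verts F" using simple_graph_adjD[OF assms(2,5)] assms(4)
    by auto
  have nF: "\<not> adj F x y" if "x \<notin> verts F \<or> y \<notin> verts F \<or> x = y" for x y
    using simple_graph_adjD[OF assms(1)] that by blast
  have nH: "\<not> adj H x y" if "x \<notin> verts H \<or> y \<notin> verts H \<or> x = y" for x y
    using simple_graph_adjD[OF assms(2)] that by blast
  have m: "v \<notin> verts H" if "v \<in> verts F" "v \<noteq> m" for v using that assms(4) by auto
  have "adj F u v \<longleftrightarrow> adj (glue F H m) (if u = m then h else u) (if v = m then h else v)"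
    if uv: "u \<in> verts F" "v \<in> verts F" for u v
    using uv h m[OF uv(1)] m[OF uv(2)] assms(5) nF nH adj_commute[of H h m] adj_commute[of F u v]
    by (cases "u = m"; cases "v = m") (simp_all add: adj_glue[OF assms(1,2)])
  moreover have "inj_on (\<lambda>x. if x = m then h else x) (verts F)" using h by (auto simp: inj_on_def)
  ultimately show ?thesis using h by (auto simp: embedding_def)
qed

lemma connected_has_nbr:
  assumes "connected_graph G" "m \<in> verts G" "card (verts G) \<ge> 2"
  obtains h where "adj G m h"
proof -
  have "verts G \<noteq> {m}" using assms(3) by auto
  then obtain v where v: "v \<in> verts G" "v \<noteq> m" using assms(2) by blast
  then have "(m, v) \<in> (adj_rel G)\<^sup>*" using assms by (auto simp: connected_graph_def joined_def)
  then obtain h where "(m, h) \<in> adj_rel G" using v by (metis converse_rtranclE)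
  then show ?thesis using that by (auto simp: adj_rel_def)
qed

text \<open>Both pieces are embedded, and an edge joins the two substitutes of the marker. The bound
  is two vertices and not the three of \<open>node\<close>, because a vertex may have been deleted
  from a piece before gluing.\<close>

lemma connected_glue:
  assumes F: "simple_graph F" "connected_graph F" "card (verts F) \<ge> 2"
    and H: "simple_graph H" "connected_graph H" "card (verts H) \<ge> 2"
    and m: "verts F \<inter> verts H = {m}"
  shows "connected_graph (glue F H m)"
proof -
  let ?G = "glue F H m"
  have mm: "m \<in> verts F" "m \<in> verts H" using m by auto
  obtain h where h: "adj H m h" using connected_has_nbr[OF H(2) mm(2) H(3)] .
  obtain f where f: "adj F m f" using connected_has_nbr[OF F(2) mm(1) F(3)] .
  note hH = simple_graph_adjD[OF H(1) h] and fF = simple_graph_adjD[OF F(1) f]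
  have sG: "simple_graph ?G" using F H m by (intro simple_graph_glue) auto
  have eF: "embedding (\<lambda>x. if x = m then h else x) F ?G"
    using embedding_glue[OF F(1) H(1) mm(1) m h] .
  have eH: "embedding (\<lambda>x. if x = m then f else x) H ?G"
    using embedding_glue[OF H(1) F(1) mm(2) _ f] m glue_commute[of H F] by (simp add: Int_commute)
  have jF: "joined ?G v h" if "v \<in> verts F" "v \<noteq> m" for v
    using joined_embedding[OF eF F(1) sG, of v m] that mm F(2) by (auto simp: connected_graph_def)
  have jH: "joined ?G v f" if "v \<in> verts H" "v \<noteq> m" for v
    using joined_embedding[OF eH H(1) sG, of v m] that mm H(2) by (auto simp: connected_graph_def)
  have "adj ?G f h" using f h fF hH by (simp add: adj_glue[OF F(1) H(1)])
  then have "joined ?G f h" by (rule joined_adj[OF sG])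
  then have "joined ?G v h" if "v \<in> verts ?G" for v
    using that jF[of v] joined_trans[OF jH[of v]] by (cases "v \<in> verts F") auto
  then show ?thesis using hH by (intro connected_graphI[of h]) auto
qed

text \<open>For pieces that form a path \<open>F\<close>, \<open>A\<close>, \<open>B\<close>.
  Together with \<open>glue_swap\<close>, for two pieces attached to the same one, it makes the
  order of gluing along a tree immaterial.\<close>

lemma glue_assoc:
  assumes s: "simple_graph F" "simple_graph A" "simple_graph B"
    and i: "verts F \<inter> verts A = {m}" "verts A \<inter> verts B = {n}" "verts F \<inter> verts B = {}"
  shows "glue F (glue A B n) m = glue (glue F A m) B n"
proof (rule graph_eqI)
  have mn: "m \<noteq> n" "m \<in> verts F" "m \<in> verts A" "n \<in> verts A" "n \<in> verts B" "m \<notin> verts B"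
      "n \<notin> verts F"
    using i by auto
  have 1: "simple_graph (glue A B n)" "simple_graph (glue F A m)" using s i
    by (auto intro!: simple_graph_glue)
  show "simple_graph (glue F (glue A B n) m)" "simple_graph (glue (glue F A m) B n)"
    by (intro simple_graph_glue s 1; use i in auto)+
  show "verts (glue F (glue A B n) m) = verts (glue (glue F A m) B n)" using mn by auto
  have n: "\<not> adj B m x" "\<not> adj B x m" "\<not> adj F n x" "\<not> adj F x n" for x
    using simple_graph_adjD[OF s(3)] simple_graph_adjD[OF s(1)] mn by blast+
  show "adj (glue F (glue A B n) m) u v = adj (glue (glue F A m) B n) u v" for u v
    using n mn(1) adj_commute[of A n m]
    unfolding adj_glue[OF s(1) 1(1)] adj_glue[OF s(2,3)] adj_glue[OF 1(2) s(3)] adj_glue[OF s(1,2)]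
      by auto
qed

lemma glue_swap:
  assumes s: "simple_graph F" "simple_graph A" "simple_graph B"
    and i: "verts F \<inter> verts A = {m}" "verts F \<inter> verts B = {n}" "verts A \<inter> verts B = {}"
  shows "glue (glue F A m) B n = glue (glue F B n) A m"
  using glue_assoc[of A F B m n] s i glue_commute by (metis Int_commute)

section \<open>Nodes and trees of nodes\<close>

text \<open>Both sides of a split have at least two vertices, so each part has at least three
  together with its marker.\<close>

definition node :: "'b ugraph \<Rightarrow> bool" where
  "node F \<longleftrightarrow> simple_graph F \<and> connected_graph F \<and> card (verts F) \<ge> 3"

lemma nodeD: "node F \<Longrightarrow> simple_graph F" "node F \<Longrightarrow> connected_graph F" "node F \<Longrightarrow> card (verts F) \<ge> 3"
  "node F \<Longrightarrow> finite (verts F)"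
  by (auto simp: node_def simple_graph_def)

lemma card_verts_glue:
  assumes "finite (verts F)" "finite (verts H)" "verts F \<inter> verts H = {m}"
  shows "card (verts (glue F H m)) + 2 = card (verts F) + card (verts H)"
proof -
  have m: "m \<in> verts F \<union> verts H" using assms(3) by auto
  then have "card (verts F \<union> verts H) > 0" using assms by (auto simp: card_gt_0_iff)
  moreover have "card (verts F \<union> verts H) + card (verts F \<inter> verts H) =
      card (verts F) + card (verts H)"
    using card_Un_Int[OF assms(1,2)] by simp
  ultimately show ?thesis using m assms by (simp add: card_Diff_singleton)
qed

lemma node_glue:
  assumes "node F" "node H" "verts F \<inter> verts H = {m}"
  shows "node (glue F H m)"
proof -
  note F = nodeD[OF assms(1)] and H = nodeD[OF assms(2)]
  have "simple_graph (glue F H m)" using F H assms(3) by (intro simple_graph_glue) auto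
  moreover have "connected_graph (glue F H m)" using F H assms(3) by (intro connected_glue) auto
  moreover have "card (verts (glue F H m)) \<ge> 3"
    using card_verts_glue[OF F(4) H(4) assms(3)] F(3) H(3) by linarith
  ultimately show ?thesis by (simp add: node_def)
qed

text \<open>\<open>decomp_tree F D\<close> says that \<open>F\<close> is recomposed from the nodes \<open>D\<close>. A marker belongs to two nodes of \<open>D\<close>
  and not to \<open>F\<close>; every vertex of \<open>F\<close>, be it \<open>Orig\<close> or \<open>Marker\<close>, belongs to exactly one node.\<close>

inductive decomp_tree :: "'a dvertex ugraph \<Rightarrow> 'a decomposition \<Rightarrow> bool" where
  single: "node F \<Longrightarrow> decomp_tree F {F}"
| glue: "\<lbrakk>decomp_tree F D; node H; m \<in> range Marker; m \<in> verts F; verts H \<inter> \<Union>(verts ` D) = {m}\<rbrakk> \<Longrightarrow>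
    decomp_tree (glue F H m) (insert H D)"

text \<open>The cardinality bound holds because a node with at least three vertices adds at least
  one vertex when glued: the marker is lost from both pieces. It bounds the size of all
  decompositions, so that a largest one exists.\<close>

lemma decomp_tree_props:
  assumes "decomp_tree F D"
  shows "node F \<and> finite D \<and> verts F \<subseteq> \<Union>(verts ` D) \<and> (\<forall>K\<in>D. node K) \<and> D \<noteq> {} \<and>
      card D + 2 \<le> card (verts F)"
  using assms
proof induction
  case (single F)
  then show ?case using nodeD(3)[OF single] by auto
next
  case (glue F D H m)
  then have i: "verts F \<inter> verts H = {m}" and n: "node F" by auto
  have "card (verts F) + card (verts H) = card (verts (glue F H m)) + 2"
    using card_verts_glue[OF nodeD(4)[OF n] nodeD(4)[OF glue(2)] i] by simp
  moreover have "card (insert H D) \<le> Suc (card D)" by (simp add: card_insert_if glue.IH)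
  ultimately have "card (insert H D) + 2 \<le> card (verts (glue F H m))"
    using glue.IH nodeD(3)[OF glue(2)] by linarith
  then show ?case using node_glue[OF n glue(2) i] glue by auto
qed

lemmas decomp_treeD = decomp_tree_props[THEN conjunct1] decomp_tree_props[THEN conjunct2, THEN
    conjunct1]
  decomp_tree_props[THEN conjunct2, THEN conjunct2, THEN conjunct1]
  decomp_tree_props[THEN conjunct2, THEN conjunct2, THEN conjunct2, THEN conjunct1]

text \<open>Trees are sets of nodes, so a newly attached node must be shown not to be there already;
  otherwise it would be contained in its marker.\<close>

lemma attached_notin:
  assumes "node H" "verts H \<inter> \<Union>(verts ` D) = {m}"
  shows "H \<notin> D"
proof
  assume "H \<in> D"
  then have "verts H \<subseteq> {m}" using assms(2) by auto
  then have "card (verts H) \<le> 1" using card_mono[of "{m}" "verts H"] by simp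
  then show False using nodeD(3)[OF assms(1)] by simp
qed

lemma decomp_tree_real_unique:
  assumes "decomp_tree F D" "K \<in> D" "K' \<in> D" "K \<noteq> K'" "x \<in> verts K" "x \<in> verts K'"
  shows "x \<notin> verts F"
  using assms
proof (induction arbitrary: K K')
  case (glue F D H m)
  have mem: "x = m" if "J \<in> D" "x \<in> verts J" "x \<in> verts H" for J using that glue(5) by auto
  show ?case using glue mem by (cases "K = H"; cases "K' = H") auto
qed auto

lemma decomp_tree_share:
  assumes "decomp_tree F D" "K \<in> D" "K' \<in> D" "K \<noteq> K'" "x \<in> verts K" "x \<in> verts K'" "y \<in> verts K"
      "y \<in> verts K'"
  shows "x = y"
  using assms
proof (induction arbitrary: K K')
  case (glue F D H m)
  have mem: "z = m" if "J \<in> D" "z \<in> verts J" "z \<in> verts H" for J z using that glue(5) by auto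
  show ?case using glue mem by (cases "K = H"; cases "K' = H") (simp_all, metis+)
qed auto

lemma decomp_tree_two:
  assumes "decomp_tree F D" "K \<in> D" "K' \<in> D" "K'' \<in> D" "K \<noteq> K'" "K \<noteq> K''" "K' \<noteq> K''"
    "x \<in> verts K" "x \<in> verts K'" "x \<in> verts K''"
  shows False
  using assms
proof (induction arbitrary: K K' K'')
  case (glue F D H m)
  have mem: "x = m" if "J \<in> D" "x \<in> verts J" "x \<in> verts H" for J using that glue(5) by auto
  have *: False if "J \<in> D" "J' \<in> D" "J \<noteq> J'" "x \<in> verts J" "x \<in> verts J'" "x \<in> verts H" for J J'
    using decomp_tree_real_unique[OF glue(1) that(1-5)] mem[OF that(1,4,6)] glue(4) by simp
  show ?case
  proof (cases "K = H \<or> K' = H \<or> K'' = H")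
    case True
    then show ?thesis using * glue.prems by (metis insertE)
  next
    case False
    then show ?thesis using glue.IH glue.prems by (metis insertE)
  qed
qed auto

lemma decomp_tree_single:
  assumes "decomp_tree F D" "card D = 1"
  shows "D = {F}"
  using assms
proof cases
  case (glue F' D' H m)
  then have "H \<notin> D'" using attached_notin[OF glue(4,7)] by simp
  then have "card D = Suc (card D')" using glue decomp_treeD(2)[OF glue(3)] by simp
  moreover have "D' \<noteq> {}" using decomp_tree_props[OF glue(3)] by simp
  ultimately show ?thesis using assms(2) decomp_treeD(2)[OF glue(3)] by simp
qed auto

lemma decomp_tree_has_nbr:
  assumes "decomp_tree F D" "K \<in> D" "card D \<ge> 2"
  shows "node_nbrs D K \<noteq> {}"
  using assms
proof (induction arbitrary: K)
  case (glue F D H m)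
  have HD: "H \<notin> D" using attached_notin[OF glue(2,5)] .
  obtain J where J: "J \<in> D" "m \<in> verts J" using glue(5) by auto
  have mH: "m \<in> verts H" using glue(5) by auto
  show ?case
  proof (cases "K = H")
    case True
    then have "J \<in> node_nbrs (insert H D) K" using J mH HD by (auto simp: node_nbrs_def)
    then show ?thesis by auto
  next
    case False
    then have KD: "K \<in> D" using glue by auto
    show ?thesis
    proof (cases "card D \<ge> 2")
      case True
      then have "node_nbrs D K \<noteq> {}" using glue KD by auto
      then show ?thesis by (auto simp: node_nbrs_def)
    next
      case f: False
      have "card D \<noteq> 0" using KD decomp_treeD(2)[OF glue(1)] by auto
      then have "card D = 1" using f by simp
      then have "J = K" using KD J by (auto simp: card_1_singleton_iff)
      then have "H \<in> node_nbrs (insert H D) K" using J mH False by (auto simp: node_nbrs_def)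
      then show ?thesis by auto
    qed
  qed
qed auto

lemma node_nbrs_insert:
  assumes "K \<noteq> H"
  shows "node_nbrs (insert H D) K =
      (if verts K \<inter> verts H \<noteq> {} then insert H (node_nbrs D K) else node_nbrs D K)"
  using assms by (auto simp: node_nbrs_def)

section \<open>Detaching, merging and splitting nodes of a tree\<close>

text \<open>\<open>decomp_tree\<close> records one order of attachment, but every leaf can be taken
  as the last one. If another node \<open>K\<close> came last, \<open>H\<close> is a leaf of the
  tree before \<open>K\<close> and does not touch \<open>K\<close>, so \<open>glue_swap\<close>
  exchanges the two; if only these two nodes exist, gluing is symmetric.\<close>

lemma decomp_tree_leaf:
  assumes "decomp_tree F D" "leaf_node D H"
  shows "\<exists>F' m. decomp_tree F' (D - {H}) \<and> F = glue F' H m \<and> m \<in> range Marker \<and> m \<in> verts F' \<and>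
    verts H \<inter> \<Union>(verts ` (D - {H})) = {m} \<and> node H"
  using assms
proof (induction)
  case (single F)
  have "node_nbrs {F} F = {}" by (auto simp: node_nbrs_def)
  then show ?case using single.prems by (auto simp: leaf_node_def)
next
  case (glue F D K m)
  have KD: "K \<notin> D" using attached_notin[OF glue(2,5)] .
  note P = decomp_tree_props[OF glue(1)]
  show ?case
  proof (cases "H = K")
    case True
    then show ?thesis using glue KD by auto
  next
    case False
    then have HD: "H \<in> D" using glue.prems by (auto simp: leaf_node_def)
    have nH: "node H" using P HD by auto
    have nb: "card (node_nbrs (insert K D) H) = 1" using glue.prems by (simp add: leaf_node_def)
    show ?thesis
    proof (cases "card D = 1")
      case True
      then have "D = {F}" using decomp_tree_single[OF glue(1)] by simp
      then have D: "D = {H}" "F = H" using HD by auto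
      have "insert K D - {H} = {K}" using D False by auto
      moreover have "verts H \<inter> verts K = {m}" "m \<in> verts K" using glue(5) D by auto
      ultimately show ?thesis using D glue(2,3) nH glue_commute[of H K m]
        by (intro exI[of _ K] exI[of _ m]) (auto intro: decomp_tree.single)
    next
      case f: False
      have "card D \<noteq> 0" using HD P by auto
      then have "card D \<ge> 2" using f by simp
      then have ne: "node_nbrs D H \<noteq> {}" using decomp_tree_has_nbr[OF glue(1) HD] by simp
      have fin: "finite (node_nbrs D H)" using P by (simp add: node_nbrs_def)
      have KnH: "K \<notin> node_nbrs D H" using KD by (simp add: node_nbrs_def)
      \<comment> \<open>A common marker would give the leaf \<open>H\<close> a second neighbour
        besides the one it has in \<open>D\<close>.\<close>
      have disj: "verts H \<inter> verts K = {}"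
      proof (rule ccontr)
        assume "verts H \<inter> verts K \<noteq> {}"
        then have "node_nbrs (insert K D) H = insert K (node_nbrs D H)"
          using node_nbrs_insert[OF False] by auto
        then have "card (node_nbrs D H) = 0" using nb fin KnH by simp
        then show False using ne fin by simp
      qed
      then have "leaf_node D H" using nb node_nbrs_insert[OF False, of D] HD
        by (simp add: leaf_node_def)
      then obtain F2 m2
        where I: "decomp_tree F2 (D - {H})" "F = glue F2 H m2" "m2 \<in> range Marker" "m2 \<in> verts F2"
        "verts H \<inter> \<Union>(verts ` (D - {H})) = {m2}" using glue.IH by blast
      note P2 = decomp_tree_props[OF I(1)]
      have mK: "m \<in> verts K" using glue(5) by auto
      have mH: "m \<notin> verts H" using disj mK by auto
      have mF2: "m \<in> verts F2" "m \<noteq> m2" using glue(4) mH unfolding I(2) by auto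
      have KF2: "verts K \<inter> \<Union>(verts ` (D - {H})) = {m}" using glue(5) mF2 P2 mK by blast
      have d1: "decomp_tree (glue F2 K m) (insert K (D - {H}))"
        using I(1) glue(2,3) mF2(1) KF2 by (rule decomp_tree.glue)
      have e: "insert K D - {H} = insert K (D - {H})" using False by auto
      have sub: "verts F2 \<subseteq> \<Union>(verts ` (D - {H}))" using P2 by simp
      have m2H: "m2 \<in> verts H" using I(5) by blast
      have i: "verts F2 \<inter> verts H = {m2}" "verts F2 \<inter> verts K = {m}"
        using I(4,5) sub m2H KF2 mK mF2 by blast+
      have "glue F K m = glue (glue F2 K m) H m2"
        unfolding I(2) using i disj
        by (intro glue_swap nodeD(1) decomp_treeD(1)[OF I(1)] glue(2) nH) auto
      moreover have "verts H \<inter> \<Union>(verts ` (insert K (D - {H}))) = {m2}" using I(5) disj by auto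
      moreover have "m2 \<in> verts (glue F2 K m)" using I(4) mF2 by auto
      ultimately show ?thesis using d1 I(3) nH unfolding e by blast
    qed
  qed
qed

text \<open>Gluing onto the whole graph equals gluing onto the node that owns the marker. This is
  the case of \<open>decomp_tree_merge\<close> in which one of the two nodes was attached
  last.\<close>

lemma decomp_tree_attach:
  assumes "decomp_tree F D" "A \<in> D" "m \<in> verts A" "m \<in> verts F" "node K" "verts K \<inter> \<Union>(verts ` D) =
      {m}"
  shows "decomp_tree (glue F K m) (insert (glue A K m) (D - {A}))"
  using assms
proof induction
  case (single F)
  then show ?case using node_glue[of F K m] by (auto intro!: decomp_tree.single)
next
  case (glue F D J j)
  note P = decomp_tree_props[OF glue(1)]
  have JD: "J \<notin> D" using attached_notin[OF glue(2,5)] .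
  have nF: "node F" "node J" "node K" using P glue by auto
  have ij: "verts F \<inter> verts J = {j}" "j \<in> verts J" using glue P by blast+
  have mK: "m \<in> verts K" using glue by auto
  have mj: "m \<noteq> j" using glue by auto
  show ?case
  proof (cases "A = J")
    case True
    have mF: "m \<notin> verts F" using glue.prems(2) True ij(1) mj by auto
    then have mD: "m \<notin> \<Union>(verts ` D)" using glue.prems(2) True glue(5) mj by auto
    have KD: "verts K \<inter> \<Union>(verts ` D) = {}" using glue.prems(5) mD by auto
    have KF: "verts F \<inter> verts K = {}" using KD P by blast
    have JK: "verts J \<inter> verts K = {m}" using glue.prems(2,5) True by auto
    have "decomp_tree (glue F (glue J K m) j) (insert (glue J K m) D)"
    proof (rule decomp_tree.glue[OF glue(1)])
      show "node (glue J K m)" by (rule node_glue[OF nF(2,3) JK])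
      show "verts (glue J K m) \<inter> \<Union>(verts ` D) = {j}"
        unfolding verts_glue using glue(5) KD mD by blast
    qed (use glue in auto)
    moreover have "glue F (glue J K m) j = glue (glue F J j) K m"
      using nodeD(1) nF ij JK KF by (intro glue_assoc) auto
    ultimately show ?thesis using True JD by simp
  next
    case False
    then have AD: "A \<in> D" using glue by auto
    have mJ: "m \<notin> verts J" using glue(5) glue.prems AD mj by auto
    then have mF: "m \<in> verts F" using glue by auto
    have KD: "verts K \<inter> \<Union>(verts ` D) = {m}" using glue.prems AD mK by auto
    have IH: "decomp_tree (glue F K m) (insert (glue A K m) (D - {A}))"
      using glue.IH AD glue.prems(2) mF glue.prems(4) KD by blast
    have KF: "verts F \<inter> verts K = {m}" using KD mF mK P by blast
    have KJ: "verts J \<inter> verts K = {}" using glue.prems mJ by auto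
    have ne: "J \<noteq> A" "insert J D - {A} = insert J (D - {A})" using False by auto
    have "decomp_tree (glue (glue F K m) J j) (insert J (insert (glue A K m) (D - {A})))"
    proof (rule decomp_tree.glue[OF IH])
      show "j \<in> verts (glue F K m)" using glue(4) mj by auto
      have "verts J \<inter> \<Union>(verts ` insert (glue A K m) (D - {A})) \<subseteq> {j}" using glue(5) KJ AD by auto
      moreover have "j \<in> \<Union>(verts ` D)" using glue(5) by auto
      then have "j \<in> \<Union>(verts ` insert (glue A K m) (D - {A}))" using mj AD by auto
      ultimately show "verts J \<inter> \<Union>(verts ` insert (glue A K m) (D - {A})) = {j}" using ij by auto
    qed (use glue in auto)
    moreover have "glue (glue F K m) J j = glue (glue F J j) K m"
      using nodeD(1) nF ij KF KJ by (intro glue_swap) auto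
    ultimately show ?thesis unfolding ne by (simp add: insert_commute)
  qed
qed

text \<open>The contraction of an edge of the tree. It produces the coarser decomposition against
  which the minimality of the standard decomposition is applied.\<close>

lemma decomp_tree_merge:
  assumes "decomp_tree F D" "A \<in> D" "B \<in> D" "A \<noteq> B" "m \<in> verts A" "m \<in> verts B"
  shows "decomp_tree F (insert (glue A B m) (D - {A, B}))"
  using assms
proof (induction arbitrary: A B)
  case (glue F D K k)
  note P = decomp_tree_props[OF glue(1)]
  have KD: "K \<notin> D" using attached_notin[OF glue(2,5)] .
  have one: "decomp_tree (glue F K k) (insert (glue A K m) (insert K D - {A, K}))"
    if A: "A \<in> D" "m \<in> verts A" "m \<in> verts K" for A
  proof -
    have mk: "m = k" using A glue(5) by auto
    have "decomp_tree (glue F K k) (insert (glue A K k) (D - {A}))"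
      using glue A unfolding mk by (intro decomp_tree_attach) auto
    moreover have "insert K D - {A, K} = D - {A}" using KD by auto
    ultimately show ?thesis unfolding mk by simp
  qed
  show ?case
  proof (cases "A = K \<or> B = K")
    case True
    then show ?thesis
    proof
      assume "B = K"
      then show ?thesis using one[of A] glue.prems by auto
    next
      assume a: "A = K"
      then have "insert K D - {A, B} = insert K D - {B, K}" by auto
      then show ?thesis using one[of B] glue.prems a glue_commute[of A B] by auto
    qed
  next
    case False
    then have AB: "A \<in> D" "B \<in> D" using glue.prems by auto
    have IH: "decomp_tree F (insert (glue A B m) (D - {A, B}))"
      using glue.IH[OF AB glue.prems(3-5)] .
    have sub: "\<Union>(verts ` insert (glue A B m) (D - {A, B})) \<subseteq> \<Union>(verts ` D)" using AB by auto
    have "decomp_tree (glue F K k) (insert K (insert (glue A B m) (D - {A, B})))"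
    proof (rule decomp_tree.glue[OF IH])
      have "k \<in> \<Union>(verts ` insert (glue A B m) (D - {A, B}))" using decomp_treeD(3)[OF IH] glue(4)
        by blast
      then show "verts K \<inter> \<Union>(verts ` insert (glue A B m) (D - {A, B})) = {k}" using sub glue(5)
        by blast
    qed (use glue in auto)
    moreover have "insert K D - {A, B} = insert K (D - {A, B})" using False by auto
    ultimately show ?thesis by (simp add: insert_commute)
  qed
qed auto

lemma split_attachment:
  assumes "(Y \<union> X - {n}) \<inter> U = {m}" "m \<in> Y" "m \<notin> X" "n \<notin> U"
  shows "Y \<inter> U = {m}" "X \<inter> U = {}"
proof -
  have *: "x = m" if "x \<in> Y \<union> X" "x \<in> U" for x
  proof -
    have "x \<in> (Y \<union> X - {n}) \<inter> U" using that assms(4) by blast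
    then show ?thesis unfolding assms(1) by blast
  qed
  have "m \<in> (Y \<union> X - {n}) \<inter> U" unfolding assms(1) by blast
  then show "Y \<inter> U = {m}" using * assms(2) by blast
  show "X \<inter> U = {}" using * assms(3) by blast
qed

lemma decomp_tree_split:
  assumes "decomp_tree F D" "H \<in> D" "H = glue H1 H2 n" "node H1" "node H2" "verts H1 \<inter> verts H2 =
      {n}"
    "n \<in> range Marker" "n \<notin> \<Union>(verts ` D)"
  shows "decomp_tree F (insert H2 (insert H1 (D - {H})))"
  using assms
proof induction
  case (single F)
  then have "H = F" by simp
  have "decomp_tree (glue H1 H2 n) (insert H2 {H1})"
    using single by (intro decomp_tree.glue decomp_tree.single) auto
  then show ?case using single by simp
next
  case (glue F D K m)
  note P = decomp_tree_props[OF glue(1)]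
  have KD: "K \<notin> D" using attached_notin[OF glue(2,5)] .
  show ?case
  proof (cases "H = K")
    case False
    then have HD: "H \<in> D" using glue by auto
    have IH: "decomp_tree F (insert H2 (insert H1 (D - {H})))" using glue HD by auto
    have nK: "n \<notin> verts K" using glue.prems by auto
    have U: "\<Union>(verts ` insert H2 (insert H1 (D - {H}))) = insert n (\<Union>(verts ` D))"
      using HD glue.prems(2,5) by auto
    have "decomp_tree (glue F K m) (insert K (insert H2 (insert H1 (D - {H}))))"
      by (rule decomp_tree.glue[OF IH]) (use glue U nK in auto)
    moreover have "insert K D - {H} = insert K (D - {H})" using False by auto
    ultimately show ?thesis by (simp add: insert_commute)
  next
    case True
    have D: "insert K D - {H} = D" using KD True by auto
    have K: "K = glue H1 H2 n" using True glue by simp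
    have nD: "n \<notin> \<Union>(verts ` D)" using glue.prems by auto
    have mn: "m \<noteq> n" using glue(5) nD by auto
    \<comment> \<open>The marker \<open>m\<close> of the divided node goes to one part only. That
      part is attached to the tree first, and the other part is attached to it by the new
      marker.\<close>
    have gen: "decomp_tree (glue F K m) (insert A (insert B D))"
      if AB: "K = glue B A n" "node A" "node B" "verts B \<inter> verts A = {n}" "m \<in> verts B" for A B
    proof -
      have mA: "m \<notin> verts A" using AB(4,5) mn by auto
      have vK: "verts K = verts B \<union> verts A - {n}" unfolding AB(1) by simp
      have BD: "verts B \<inter> \<Union>(verts ` D) = {m}"
        by (rule split_attachment(1)[OF glue(5)[unfolded vK] AB(5) mA nD])
      have AD: "verts A \<inter> \<Union>(verts ` D) = {}"
        by (rule split_attachment(2)[OF glue(5)[unfolded vK] AB(5) mA nD])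
      have 1: "decomp_tree (glue F B m) (insert B D)"
        by (rule decomp_tree.glue[OF glue(1) AB(3) glue(3,4) BD])
      have 2: "decomp_tree (glue (glue F B m) A n) (insert A (insert B D))"
        by (rule decomp_tree.glue[OF 1]) (use AB AD mn glue in auto)
      have F: "verts F \<inter> verts B = {m}" "verts F \<inter> verts A = {}" using BD AD AB(5) P glue(4)
        by blast+
      have "glue F (glue B A n) m = glue (glue F B m) A n"
        using nodeD(1) P AB F by (intro glue_assoc) auto
      then show ?thesis using 2 AB(1) by simp
    qed
    have "m \<in> verts K" using glue(5) by auto
    then consider "m \<in> verts H1" | "m \<in> verts H2" using K by auto
    then show ?thesis
    proof cases
      case 1 then show ?thesis using gen[of H1 H2] K glue.prems D by auto
    next
      case 2 then show ?thesis using gen[of H2 H1] K glue.prems D glue_commute[of H1 H2]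
        by (auto simp: insert_commute Int_commute)
    qed
  qed
qed

section \<open>Splits of distance hereditary graphs\<close>

lemma graph_dist_le: "(u, v) \<in> adj_rel G ^^ n \<Longrightarrow> graph_dist G u v \<le> n"
  unfolding graph_dist_def by (rule Least_le)

lemma graph_dist_walk:
  assumes "joined G u v"
  shows "(u, v) \<in> adj_rel G ^^ graph_dist G u v"
proof -
  obtain n where "(u, v) \<in> adj_rel G ^^ n" using assms by (auto simp: joined_def rtrancl_power)
  then show ?thesis unfolding graph_dist_def by (rule LeastI)
qed

lemma relpow_adj_rel_induced: "(u, v) \<in> adj_rel (induced G W) ^^ n \<Longrightarrow> (u, v) \<in> adj_rel G ^^ n"
proof (induction n arbitrary: v)
  case (Suc n)
  then obtain y where "(u, y) \<in> adj_rel G ^^ n" "adj G y v" by (auto simp: adj_rel_def)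
  then show ?case by (auto simp: adj_rel_def)
qed simp

lemma graph_dist_adj: "joined G u v \<Longrightarrow> adj G v w \<Longrightarrow> graph_dist G u w \<le> Suc (graph_dist G u v)"
  using graph_dist_walk[of G u v] by (intro graph_dist_le) (auto simp: adj_rel_def)

lemma graph_dist_eq_0: "joined G u v \<Longrightarrow> graph_dist G u v = 0 \<longleftrightarrow> u = v"
  using graph_dist_walk[of G u v] graph_dist_le[of u v 0 G] by (cases "graph_dist G u v") auto

lemma graph_dist_ge_2:
  assumes "joined G u v" "u \<noteq> v" "\<not> adj G u v"
  shows "graph_dist G u v \<ge> 2"
proof (rule ccontr)
  assume "\<not> graph_dist G u v \<ge> 2"
  then have "graph_dist G u v = 0 \<or> graph_dist G u v = Suc 0" by linarith
  then show False using graph_dist_walk[OF assms(1)] assms by (auto simp: adj_rel_def)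
qed

lemma graph_dist_le_2: "adj G u x \<Longrightarrow> adj G x v \<Longrightarrow> graph_dist G u v \<le> 2"
proof -
  assume "adj G u x" "adj G x v"
  then have "(u, v) \<in> adj_rel G ^^ Suc (Suc 0)" by (auto simp: adj_rel_def)
  then show ?thesis using graph_dist_le[of u v "Suc (Suc 0)" G] by simp
qed

lemma connected_induced_insert:
  assumes "simple_graph G" "connected_graph (induced G W)" "w \<in> W" "adj G w z"
  shows "connected_graph (induced G (insert z W))"
proof -
  let ?H = "induced G (insert z W)"
  have s: "simple_graph (induced G (insert z W))" "simple_graph (induced G W)" using assms(1)
    by (auto intro: simple_graph_induced)
  have wz: "w \<in> verts G" "z \<in> verts G" using simple_graph_adjD[OF assms(1,4)] by auto
  have j: "joined ?H v w" if v: "v \<in> W" "v \<in> verts G" for v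
  proof -
    have "joined (induced G W) v w" using assms(2,3) v wz by (auto simp: connected_graph_def)
    then show ?thesis
    proof (rule joined_map[where f = "\<lambda>x. x"])
      show "joined ?H x y" if "adj (induced G W) x y" for x y
        using that by (intro joined_adj[OF s(1)]) auto
    qed auto
  qed
  have "joined ?H z w" using assms(3,4) by (intro joined_sym[OF joined_adj[OF s(1)]]) auto
  then have "joined ?H v w" if "v \<in> verts ?H" for v using that j by auto
  then show ?thesis using wz assms(3) by (intro connected_graphI[of w]) auto
qed

lemma connected_induced_singleton: "v \<in> verts G \<Longrightarrow> connected_graph (induced G {v})"
  by (auto simp: connected_graph_def intro: joined_refl)

text \<open>All metric arguments below reduce to this: a vertex with a single neighbour in a connected
  set is one step farther than that neighbour.\<close>

lemma distance_hereditary_pendant: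
  assumes "simple_graph G" "distance_hereditary G" "W \<subseteq> verts G" "connected_graph (induced G W)"
    and "r \<in> W" "x \<in> W" "y \<notin> W" "adj G x y" "\<And>w. w \<in> W \<Longrightarrow> adj G w y \<Longrightarrow> w = x"
  shows "Suc (graph_dist G r x) \<le> graph_dist G r y"
proof -
  let ?H = "induced G (insert y W)"
  have y: "y \<in> verts G" using simple_graph_adjD[OF assms(1,8)] by simp
  have c: "connected_graph ?H" using connected_induced_insert[OF assms(1,4,6,8)] .
  then have e: "graph_dist ?H r y = graph_dist G r y"
    using assms(2,3,5) y unfolding distance_hereditary_def by auto
  have "joined ?H r y" using c assms(3,5) y by (auto simp: connected_graph_def)
  then have w: "(r, y) \<in> adj_rel ?H ^^ graph_dist G r y" using graph_dist_walk e by metis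
  then obtain m where m: "graph_dist G r y = Suc m" using assms(5,7)
    by (cases "graph_dist G r y") auto
  then obtain z where z: "(r, z) \<in> adj_rel ?H ^^ m" "adj ?H z y" using w by (auto simp: adj_rel_def)
  have "z \<noteq> y" using z(2) simple_graph_adjD(3)[OF simple_graph_induced[OF assms(1)]] by blast
  then have "z = x" using z(2) assms(9) by auto
  then have "graph_dist G r x \<le> m" using z(1) relpow_adj_rel_induced graph_dist_le by metis
  then show ?thesis using m by simp
qed

text \<open>\<open>R\<close> is a module: its members have the same neighbours outside. The crossing
  edges therefore form a complete bipartite graph between \<open>R\<close> and those neighbours, or
  there are none.\<close>

lemma is_split_module:
  assumes "R \<subseteq> verts G" "card R \<ge> 2" "card (verts G - R) \<ge> 2"
    and "\<And>x y w. x \<in> R \<Longrightarrow> y \<in> R \<Longrightarrow> w \<in> verts G - R \<Longrightarrow> adj G x w \<Longrightarrow> adj G y w"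
  shows "is_split G R (verts G - R)"
proof -
  have n: "x \<in> nbhd G (verts G - R) \<longleftrightarrow> x \<in> R \<and> (\<exists>w\<in>verts G - R. adj G x w)"
    "x \<in> nbhd G R \<longleftrightarrow> x \<in> verts G - R \<and> (\<exists>w\<in>R. adj G w x)" for x
    using assms(1) by (auto simp: nbhd_def adj_commute)
  have "x \<in> R \<and> y \<in> verts G - R \<and> adj G x y \<longleftrightarrow> x \<in> nbhd G (verts G - R) \<and> y \<in> nbhd G R" for x y
    unfolding n using assms(4) by blast
  then show ?thesis using assms(1-3) unfolding is_split_def by auto
qed

lemma is_split_pendant:
  assumes "simple_graph G" "adj G x v" "\<And>w. adj G w v \<Longrightarrow> w = x" "card (verts G) \<ge> 4"
  shows "is_split G {v, x} (verts G - {v, x})"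
proof -
  have xv: "x \<in> verts G" "v \<in> verts G" "x \<noteq> v" using simple_graph_adjD[OF assms(1,2)] by auto
  have c: "card (verts G - {v, x}) \<ge> 2" using assms(4) xv by (subst card_Diff_subset) auto
  let ?V = "verts G - {v, x}"
  have nv: "\<not> adj G v w" if "w \<noteq> x" for w using assms(3)[of w] that adj_commute[of G v w] by blast
  have n: "a \<in> nbhd G ?V \<longleftrightarrow> a = x \<and> (\<exists>w\<in>?V. adj G x w)" for a
    using xv nv by (auto simp: nbhd_def)
  have n2: "b \<in> nbhd G {v, x} \<longleftrightarrow> b \<in> ?V \<and> adj G x b" for b
    using assms(3)[of b] by (auto simp: nbhd_def adj_commute[of G b])
  have "a \<in> {v, x} \<and> b \<in> ?V \<and> adj G a b \<longleftrightarrow> a \<in> nbhd G ?V \<and> b \<in> nbhd G {v, x}" for a b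
    unfolding n n2 using nv by auto
  then show ?thesis using c xv unfolding is_split_def by auto
qed

text \<open>Levels are distances from \<open>r\<close>, which has a non-neighbour, so the last level
  \<open>M\<close> is at least 2. If the last level has an edge, a component of it is a module.
  Otherwise take \<open>v\<close> in it with fewest neighbours: either \<open>v\<close> is pendant,
  or its neighbourhood is a module. In each case \<open>r\<close> and one further vertex stay on the
  other side, which makes it large enough.\<close>

theorem distance_hereditary_has_split:
  assumes s: "simple_graph G" and c: "connected_graph G" and dh: "distance_hereditary G"
    and nc: "\<not> clique_graph G" and card: "card (verts G) \<ge> 4"
  shows "\<exists>V1 V2. is_split G V1 V2"
proof -
  obtain r r' where r: "r \<in> verts G" "r' \<in> verts G" "r \<noteq> r'" "\<not> adj G r r'"
    using nc by (auto simp: clique_graph_def)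
  define d where "d = graph_dist G r"
  have fin: "finite (verts G)" using s by (simp add: simple_graph_def)
  have j: "joined G u v" if "u \<in> verts G" "v \<in> verts G" for u v using c that
    by (simp add: connected_graph_def)
  note aD = simple_graph_adjD[OF s]
  have d1: "d v \<le> Suc (d u)" if "adj G u v" for u v
    using graph_dist_adj[of G r u v] j[OF r(1)] aD[OF that] that by (simp add: d_def)
  have d1': "d u \<le> Suc (d v)" if "adj G u v" for u v using d1 that adj_commute by metis
  have d0: "d v = 0 \<longleftrightarrow> v = r" if "v \<in> verts G" for v
    using graph_dist_eq_0[OF j[OF r(1) that]] by (auto simp: d_def)
  have par: "\<exists>u. adj G u v \<and> Suc (d u) = d v" if v: "v \<in> verts G" "d v > 0" for v
  proof -
    obtain n where n: "d v = Suc n" using v(2) by (cases "d v") auto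
    have "(r, v) \<in> adj_rel G ^^ Suc n" using graph_dist_walk[OF j[OF r(1) v(1)]] n
      by (simp add: d_def)
    then obtain u where u: "(r, u) \<in> adj_rel G ^^ n" "adj G u v" by (auto simp: adj_rel_def)
    have "d u \<le> n" using graph_dist_le[OF u(1)] by (simp add: d_def)
    then have "Suc (d u) = d v" using d1[OF u(2)] n by simp
    then show ?thesis using u by blast
  qed
  have desc: "connected_graph (induced G W)"
    if W: "W \<subseteq> verts G" "r \<in> W" "\<And>v. v \<in> W \<Longrightarrow> v \<noteq> r \<Longrightarrow> \<exists>u\<in>W. adj G u v \<and> d u < d v" for W
  proof -
    have sW: "simple_graph (induced G W)" using s by (rule simple_graph_induced)
    have "joined (induced G W) v r" if "v \<in> W" for v
      using that
    proof (induction "d v" arbitrary: v rule: less_induct)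
      case less
      show ?case
      proof (cases "v = r")
        case True
        then show ?thesis using r W by (auto intro: joined_refl)
      next
        case False
        then obtain u where u: "u \<in> W" "adj G u v" "d u < d v" using W(3) less by blast
        have "joined (induced G W) v u"
          using u less.prems by (intro joined_sym[OF joined_adj[OF sW]]) auto
        then show ?thesis using less.hyps[OF u(3,1)] by (rule joined_trans)
      qed
    qed
    then show ?thesis using r W by (intro connected_graphI[of r]) auto
  qed
  have pend: "Suc (d x) \<le> d y"
    if "W \<subseteq> verts G" "connected_graph (induced G W)" "r \<in> W" "x \<in> W" "y \<notin> W" "adj G x y"
      "\<And>w. w \<in> W \<Longrightarrow> adj G w y \<Longrightarrow> w = x" for W x y
    unfolding d_def using distance_hereditary_pendant[OF s dh that] .
  have lower: "\<exists>u\<in>{v \<in> verts G. d v < n}. adj G u v \<and> d u < d v"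
    if v: "v \<in> verts G" "v \<noteq> r" "d v \<le> n" for v n
  proof -
    have "d v > 0" using d0[OF v(1)] v(2) by simp
    then obtain u where "adj G u v" "Suc (d u) = d v" using par[OF v(1)] by blast
    then show ?thesis using v aD by (intro bexI[of _ u]) auto
  qed
  \<comment> \<open>Adjacent vertices of one level have the same neighbours in the level below.
    Otherwise \<open>y\<close> hangs by \<open>x\<close> alone from the ball below \<open>z\<close>
    extended by \<open>z\<close> and \<open>x\<close>, and would be farther from \<open>r\<close>
    than \<open>x\<close>.\<close>
  have fact1: "adj G z y" if "adj G x y" "d x = d y" "adj G z x" "Suc (d z) = d x" for x y z
  proof (rule ccontr)
    assume n: "\<not> adj G z y"
    let ?B = "{v \<in> verts G. d v < d z}"
    have xyz: "x \<in> verts G" "y \<in> verts G" "z \<in> verts G" using aD that by auto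
    have rB: "r \<in> ?B \<union> {z, x}" using d0[OF r(1)] d0[OF xyz(3)] r(1) by auto
    have "connected_graph (induced G (?B \<union> {z, x}))"
    proof (rule desc)
      show "\<exists>u\<in>?B \<union> {z, x}. adj G u v \<and> d u < d v" if v: "v \<in> ?B \<union> {z, x}" "v \<noteq> r" for v
      proof (cases "v = x")
        case True then show ?thesis using \<open>adj G z x\<close> \<open>Suc (d z) = d x\<close> by (intro bexI[of _ z]) auto
      next
        case False
        then have "d v \<le> d z" "v \<in> verts G" using v xyz by auto
        then show ?thesis using lower[of v "d z"] v by blast
      qed
    qed (use xyz rB in auto)
    then have "Suc (d x) \<le> d y"
    proof (rule pend[rotated])
      show "w = x" if w: "w \<in> ?B \<union> {z, x}" "adj G w y" for w
        using w n d1[OF w(2)] \<open>d x = d y\<close> \<open>Suc (d z) = d x\<close> by auto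
      show "y \<notin> ?B \<union> {z, x}" using that aD[OF that(1)] by auto
    qed (use xyz rB that in auto)
    then show False using that by simp
  qed
  \<comment> \<open>The same for two vertices of one level with a common neighbour \<open>v\<close>
    in the level above: otherwise \<open>y\<close> hangs by \<open>v\<close> alone, two levels too
    high.\<close>
  have fact2: "adj G z y"
    if vx: "adj G v x" and vy: "adj G v y" and dx: "d x = d y" "d v = Suc (d x)"
    and zx: "adj G z x" "Suc (d z) = d x" for v x y z
  proof (rule ccontr)
    assume n: "\<not> adj G z y"
    then have "\<not> adj G x y" "x \<noteq> y" using fact1[of x y z] that by auto
    let ?B = "{v \<in> verts G. d v < d z}"
    let ?W = "?B \<union> {z, x, v}"
    have xyz: "x \<in> verts G" "y \<in> verts G" "z \<in> verts G" "v \<in> verts G" using aD that by auto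
    have rB: "r \<in> ?W" using d0[OF r(1)] d0[OF xyz(3)] r(1) by auto
    have "connected_graph (induced G ?W)"
    proof (rule desc)
      show "\<exists>u\<in>?W. adj G u w \<and> d u < d w" if w: "w \<in> ?W" "w \<noteq> r" for w
      proof -
        consider "w = x" | "w = v" | "d w \<le> d z" "w \<in> verts G" using w xyz by auto
        then show ?thesis
        proof cases
          case 1 then show ?thesis using zx by (intro bexI[of _ z]) auto
        next
          case 2 then show ?thesis using vx dx by (intro bexI[of _ x]) (auto simp: adj_commute)
        next
          case 3 then show ?thesis using lower[of w "d z"] w by blast
        qed
      qed
    qed (use xyz rB in auto)
    then have "Suc (d v) \<le> d y"
    proof (rule pend[rotated])
      show "w = v" if w: "w \<in> ?W" "adj G w y" for w
        using w n d1[OF w(2)] dx zx \<open>\<not> adj G x y\<close> by auto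
      show "y \<notin> ?W" using that aD[OF vy] \<open>x \<noteq> y\<close> by auto
    qed (use xyz rB vy in auto)
    then show False using dx by simp
  qed
  define M where "M = Max (d ` verts G)"
  have dM: "d v \<le> M" if "v \<in> verts G" for v using fin that by (simp add: M_def)
  have "d r' \<ge> 2" using graph_dist_ge_2[OF j[OF r(1,2)] r(3,4)] by (simp add: d_def)
  then have M2: "M \<ge> 2" using dM[OF r(2)] by simp
  have "M \<in> d ` verts G" unfolding M_def using fin r(1) by (intro Max_in) auto
  define L where "L = {v \<in> verts G. d v = M}"
  have Lne: "L \<noteq> {}" using \<open>M \<in> d ` verts G\<close> by (auto simp: L_def)
  have rL: "r \<notin> L" using M2 d0[OF r(1)] by (auto simp: L_def)
  show ?thesis
  proof (cases "\<exists>x\<in>L. \<exists>y\<in>L. adj G x y")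
    case True
    then obtain x y where xy: "x \<in> L" "y \<in> L" "adj G x y" by blast
    define R where "R = {w \<in> L. joined (induced G L) x w}"
    have LV: "L \<subseteq> verts G" by (auto simp: L_def)
    have sL: "simple_graph (induced G L)" using s by (rule simple_graph_induced)
    have RV: "R \<subseteq> verts G" using LV by (auto simp: R_def)
    have "x \<in> R" using xy LV by (auto simp: R_def intro!: joined_refl)
    moreover have "y \<in> R" using xy LV by (auto simp: R_def intro!: joined_adj[OF sL])
    moreover have "x \<noteq> y" using aD[OF xy(3)] by simp
    ultimately have cR: "card R \<ge> 2" using card_mono[of R "{x, y}"] finite_subset[OF RV fin] by auto
    obtain u where u: "adj G u x" "Suc (d u) = d x" using par[of x] xy M2 by (auto simp: L_def)
    have "u \<notin> R" using u xy by (auto simp: R_def L_def)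
    moreover have "r \<notin> R" using rL by (auto simp: R_def)
    moreover have "u \<noteq> r" using u xy M2 d0[OF r(1)] by (auto simp: L_def)
    ultimately have "card {u, r} \<le> card (verts G - R)" using r(1) aD(1)[OF u(1)] fin
      by (intro card_mono) auto
    then have cR': "card (verts G - R) \<ge> 2" using \<open>u \<noteq> r\<close> by simp
    \<comment> \<open>\<open>fact1\<close> carries the neighbours in the previous level along every
      edge of the component.\<close>
    have same: "\<forall>w. Suc (d w) = M \<longrightarrow> (adj G a w \<longleftrightarrow> adj G x w)" if a: "a \<in> R" for a
    proof -
      have "joined (induced G L) x a" using a by (simp add: R_def)
      then have "a \<in> L \<and> (\<forall>w. Suc (d w) = M \<longrightarrow> (adj G a w \<longleftrightarrow> adj G x w))"
      proof (rule joined_invariant)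
        fix b e assume h: "adj (induced G L) b e" "b \<in> L \<and> (\<forall>w. Suc (d w) = M \<longrightarrow> (adj G b w \<longleftrightarrow>
            adj G x w))"
        then have be: "adj G b e" "adj G e b" "b \<in> L" "e \<in> L" by (auto simp: adj_commute)
        have "adj G b w \<longleftrightarrow> adj G e w" if w: "Suc (d w) = M" for w
        proof -
          have "d b = M" "d e = M" using be by (simp_all add: L_def)
          then have "adj G w b \<Longrightarrow> adj G w e" "adj G w e \<Longrightarrow> adj G w b"
            using fact1[OF be(1)] fact1[OF be(2)] w by simp_all
          then show ?thesis using adj_commute[of G w b] adj_commute[of G w e] by blast
        qed
        then show "e \<in> L \<and> (\<forall>w. Suc (d w) = M \<longrightarrow> (adj G e w \<longleftrightarrow> adj G x w))" using h(2) be by auto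
      qed (use xy in auto)
      then show ?thesis by blast
    qed
    have "is_split G R (verts G - R)"
    proof (rule is_split_module[OF RV cR cR'])
      fix a b w assume h: "a \<in> R" "b \<in> R" "w \<in> verts G - R" "adj G a w"
      have "w \<notin> L"
      proof
        assume wL: "w \<in> L"
        have "joined (induced G L) a w" using h wL by (intro joined_adj[OF sL]) (auto simp: R_def)
        then have "w \<in> R" using h(1) wL joined_trans by (auto simp: R_def)
        then show False using h by simp
      qed
      then have "Suc (d w) = M" using h d1'[OF h(4)] dM[of w] by (auto simp: R_def L_def)
      then show "adj G b w" using same[OF h(1)] same[OF h(2)] h(4) by blast
    qed
    then show ?thesis by blast
  next
    case False
    then have ind: "\<not> adj G u v" if "u \<in> L" "v \<in> L" for u v using that by blast
    define N where "N v = {u. adj G u v}" for v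
    have NV: "N v \<subseteq> verts G" for v using aD by (auto simp: N_def)
    have finN: "finite (N v)" for v using finite_subset[OF NV fin] .
    obtain v where v: "v \<in> L" "\<And>w. w \<in> L \<Longrightarrow> card (N v) \<le> card (N w)"
      using ex_has_least_nat[of "\<lambda>v. v \<in> L" _ "\<lambda>v. card (N v)"] Lne by blast
    have vV: "v \<in> verts G" "d v = M" using v by (auto simp: L_def)
    have Nlev: "Suc (d u) = M" if "u \<in> N w" "w \<in> L" for u w
    proof -
      have a: "adj G u w" using that by (simp add: N_def)
      then have "u \<notin> L" using ind that by blast
      then show ?thesis using d1[OF a] dM[of u] aD[OF a] that by (auto simp: L_def)
    qed
    obtain x0 where x0: "adj G x0 v" using par[OF vV(1)] vV M2 by auto
    show ?thesis
    proof (cases "N v = {x0}")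
      case True
      then have "is_split G {v, x0} (verts G - {v, x0})"
        using x0 by (intro is_split_pendant[OF s _ _ card]) (auto simp: N_def)
      then show ?thesis by blast
    next
      case Nf: False
      let ?S = "N v"
      have "x0 \<in> ?S" using x0 by (simp add: N_def)
      then obtain x1 where "x1 \<in> ?S" "x1 \<noteq> x0" using Nf by blast
      then have cS: "card ?S \<ge> 2" using card_mono[OF finN, of "{x0, x1}" v] \<open>x0 \<in> ?S\<close> by auto
      have "r \<notin> ?S" using Nlev[OF _ v(1), of r] d0[OF r(1)] M2 by auto
      moreover have "v \<notin> ?S" using aD(3) by (auto simp: N_def)
      moreover have "v \<noteq> r" using rL v by auto
      ultimately have "card {v, r} \<le> card (verts G - ?S)" using r(1) vV fin
        by (intro card_mono) auto
      then have cS': "card (verts G - ?S) \<ge> 2" using \<open>v \<noteq> r\<close> by simp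
      \<comment> \<open>On the path \<open>v\<close>, \<open>y\<close>, \<open>q\<close> the vertex
        \<open>w\<close> hangs by \<open>q\<close> alone, so its distance from \<open>v\<close>
        would be at least 3; but \<open>x\<close> is adjacent to both.\<close>
      have far: False
        if ab: "adj G v y" "adj G y q" "adj G q w" "\<not> adj G v q" "v \<noteq> q" "\<not> adj G v w" "v \<noteq> w"
          "\<not> adj G y w" "y \<noteq> w"
         "adj G v x" "adj G x w" for x y q w
      proof -
        have V: "y \<in> verts G" "q \<in> verts G" "w \<in> verts G" using aD ab by auto
        have qw: "q \<noteq> w" using aD(3)[OF ab(3)] .
        have 0: "connected_graph (induced G {y, v})"
          by (rule connected_induced_insert[OF s connected_induced_singleton[OF vV(1)] singletonI
              ab(1)])
        have 1: "connected_graph (induced G (insert q {y, v}))"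
          by (rule connected_induced_insert[OF s 0 _ ab(2)]) simp
        have "Suc (graph_dist G v q) \<le> graph_dist G v w"
          by (rule distance_hereditary_pendant[OF s dh _ 1]) (use ab V vV qw in auto)
        moreover have "graph_dist G v q \<ge> 2" using graph_dist_ge_2[OF j[OF vV(1) V(2)]] ab by simp
        moreover have "graph_dist G v w \<le> 2" by (rule graph_dist_le_2[OF ab(10,11)])
        ultimately show False by simp
      qed
      have "is_split G ?S (verts G - ?S)"
      proof (rule is_split_module[OF NV cS cS'], rule ccontr)
        fix x y w assume h: "x \<in> ?S" "y \<in> ?S" "w \<in> verts G - ?S" "adj G x w" "\<not> adj G y w"
        have xv: "adj G x v" "adj G y v" "adj G v x" "adj G v y" using h
          by (auto simp: N_def adj_commute)
        have lx: "Suc (d x) = M" "Suc (d y) = M" using Nlev h v by auto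
        have xV: "x \<in> verts G" "y \<in> verts G" using aD xv by auto
        have "d x > 0" using lx M2 by simp
        then obtain q where q: "adj G q x" "Suc (d q) = d x" using par[OF xV(1)] by blast
        have qy: "adj G q y" using fact2[OF xv(3,4) _ _ q] lx vV by simp
        have yq: "adj G y q" using qy adj_commute by metis
        have vq: "\<not> adj G v q" "v \<noteq> q" using d1'[of v q] q lx vV by auto
        have "v \<noteq> w" using h(5) xv(2) by auto
        have vw: "\<not> adj G v w" using h by (auto simp: N_def adj_commute)
        have "y \<noteq> w" using h by auto
        \<comment> \<open>The neighbours of \<open>v\<close> all lie in level \<open>M - 1\<close>,
          so a neighbour \<open>w\<close> of one of them is in this level, the one above or the one
          below.\<close>
        consider "d w = M" | "d w = d x" | "Suc (d w) = d x"
          using d1[OF h(4)] d1'[OF h(4)] lx dM[of w] h(3) by force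
        then show False
        proof cases
          case 3
          have "adj G w x" using h(4) adj_commute by metis
          then have "adj G w y" using fact2[OF xv(3,4) _ _ _ 3] lx vV by simp
          then show False using h(5) adj_commute by metis
        next
          case 2
          have "adj G q w" using fact1[OF h(4) _ q] 2 by simp
          then show False using far[OF xv(4) yq _ vq vw \<open>v \<noteq> w\<close> h(5) \<open>y \<noteq> w\<close> xv(3) h(4)] by simp
        next
          case 1
          then have wL: "w \<in> L" using h(3) by (simp add: L_def)
          \<comment> \<open>The minimal choice of \<open>v\<close> enters here: \<open>y\<close> is
            a neighbour of \<open>v\<close> and not of \<open>w\<close>, so \<open>w\<close> must
            have a neighbour \<open>z\<close> that \<open>v\<close> lacks.\<close>
          have "\<not> N w \<subseteq> N v"
          proof
            assume "N w \<subseteq> N v"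
            moreover have "y \<in> N v" "y \<notin> N w" using h by (auto simp: N_def)
            ultimately have "N w \<subset> N v" by blast
            then show False using psubset_card_mono[OF finN] v(2)[OF wL] by (metis leD)
          qed
          then obtain z where z: "adj G z w" "\<not> adj G z v" by (auto simp: N_def)
          have wz: "adj G w z" "\<not> adj G v z" "adj G w x" using z h(4) adj_commute by metis+
          have lz: "Suc (d z) = M" using Nlev[OF _ wL] z by (simp add: N_def)
          have qz: "adj G q z" using fact2[OF wz(3,1) _ _ q] lz lx 1 by simp
          have vz: "v \<noteq> z" using lz vV by auto
          have wq: "\<not> adj G q w" using d1[of q w] q lx 1 by auto
          have zV: "z \<in> verts G" "q \<in> verts G" "w \<in> verts G" using aD z q by auto
          show False
          proof (cases "adj G y z")
            case True
            then show False
              using far[OF xv(4) True z(1) wz(2) vz vw \<open>v \<noteq> w\<close> h(5) \<open>y \<noteq> w\<close> xv(3) h(4)] by simp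
          next
            case yz: False
            \<comment> \<open>The vertices \<open>v\<close>, \<open>y\<close>, \<open>q\<close>,
              \<open>z\<close> form a path in which \<open>w\<close> is adjacent to \<open>z\<close>
              only, so \<open>w\<close> would be farther from \<open>v\<close> than
              \<open>z\<close>, that is, at distance at least 3.\<close>
            have c0: "connected_graph (induced G {y, v})"
              by (rule connected_induced_insert[OF s connected_induced_singleton[OF vV(1)]
                  singletonI xv(4)])
            have c1: "connected_graph (induced G (insert q {y, v}))"
              by (rule connected_induced_insert[OF s c0 _ yq]) simp
            have 1: "connected_graph (induced G (insert z (insert q {y, v})))"
              by (rule connected_induced_insert[OF s c1 _ qz]) simp
            have "q \<noteq> w" using q lx \<open>d w = M\<close> by auto
            have "Suc (graph_dist G v z) \<le> graph_dist G v w"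
              by (rule distance_hereditary_pendant[OF s dh _ 1])
                (use xV zV vV z h(5) vw wq \<open>v \<noteq> w\<close> \<open>y \<noteq> w\<close> \<open>q \<noteq> w\<close> aD(3)[OF z(1)] in auto)
            moreover have "graph_dist G v z \<ge> 2" using graph_dist_ge_2[OF j[OF vV(1) zV(1)] vz] wz
              by simp
            moreover have "graph_dist G v w \<le> 2" by (rule graph_dist_le_2[OF xv(3) h(4)])
            ultimately show False by simp
          qed
        qed
      qed
      then show ?thesis by blast
    qed
  qed
qed

lemma graph_dist_embedding:
  assumes e: "embedding f F G" and W: "W \<subseteq> verts F" and u: "u \<in> W" and v: "v \<in> W"
  shows "graph_dist (induced G (f ` W)) (f u) (f v) = graph_dist (induced F W) u v"
proof -
  let ?R = "adj_rel (induced F W)" and ?R' = "adj_rel (induced G (f ` W))"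
  have step: "(x, y) \<in> ?R \<longleftrightarrow> (f x, f y) \<in> ?R'" if "x \<in> W" "y \<in> W" for x y
    using e W that by (auto simp: adj_rel_def embedding_def)
  have fw: "(u, y) \<in> ?R ^^ n \<Longrightarrow> y \<in> W \<and> (f u, f y) \<in> ?R' ^^ n" for n y
  proof (induction n arbitrary: y)
    case (Suc n)
    then obtain z where z: "(u, z) \<in> ?R ^^ n" "(z, y) \<in> ?R" by auto
    then have "y \<in> W" by (auto simp: adj_rel_def)
    then show ?case using Suc.IH[OF z(1)] step[of z y] z(2) by auto
  qed (use u in auto)
  have bw: "(f u, y') \<in> ?R' ^^ n \<Longrightarrow> \<exists>y\<in>W. y' = f y \<and> (u, y) \<in> ?R ^^ n" for n y'
  proof (induction n arbitrary: y')
    case (Suc n)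
    then obtain z' where z': "(f u, z') \<in> ?R' ^^ n" "(z', y') \<in> ?R'" by auto
    then obtain z where z: "z \<in> W" "z' = f z" "(u, z) \<in> ?R ^^ n" using Suc.IH by blast
    have "y' \<in> f ` W" using z'(2) by (auto simp: adj_rel_def)
    then obtain y where "y \<in> W" "y' = f y" by blast
    then show ?case using z z'(2) step[of z y] by auto
  qed (use u in auto)
  have "(u, v) \<in> ?R ^^ n \<longleftrightarrow> (f u, f v) \<in> ?R' ^^ n" for n
  proof
    assume "(f u, f v) \<in> ?R' ^^ n"
    then obtain y where "y \<in> W" "f v = f y" "(u, y) \<in> ?R ^^ n" using bw by blast
    moreover have "v = y" using e W v calculation by (auto simp: embedding_def dest: inj_onD)
    ultimately show "(u, v) \<in> ?R ^^ n" by simp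
  qed (use fw in blast)
  then show ?thesis by (simp add: graph_dist_def)
qed

text \<open>The image of a connected induced subgraph of \<open>F\<close> is one of
  \<open>G\<close>. As \<open>F\<close> itself is connected, distances in \<open>F\<close> are also
  those of \<open>G\<close>, so both sides of the defining equation agree with distances in
  \<open>G\<close>.\<close>

lemma distance_hereditary_embedding:
  assumes e: "embedding f F G" and F: "simple_graph F" "connected_graph F"
    and G: "simple_graph G" "distance_hereditary G"
  shows "distance_hereditary F"
proof -
  have *: "graph_dist (induced F W) u v = graph_dist G (f u) (f v)"
    if W: "W \<subseteq> verts F" "connected_graph (induced F W)" and uv: "u \<in> W" "v \<in> W" for W u v
  proof -
    have fW: "f ` W \<subseteq> verts G" using e W by (auto simp: embedding_def)
    have s: "simple_graph (induced G (f ` W))" using G(1) by (rule simple_graph_induced)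
    have "joined (induced G (f ` W)) (f x) (f u)" if "x \<in> W" for x
    proof (rule joined_map[where f = f and u = x and v = u])
      show "joined (induced F W) x u" using W that uv by (auto simp: connected_graph_def)
      show "joined (induced G (f ` W)) (f a) (f b)" if "adj (induced F W) a b" for a b
        using that e W by (intro joined_adj[OF s]) (auto simp: embedding_def)
    qed (use fW in auto)
    then have "connected_graph (induced G (f ` W))" using uv fW
      by (intro connected_graphI[of "f u"]) auto
    then have "graph_dist (induced G (f ` W)) (f u) (f v) = graph_dist G (f u) (f v)"
      using G(2) fW uv unfolding distance_hereditary_def by blast
    then show ?thesis using graph_dist_embedding[OF e W(1) uv] by simp
  qed
  have "induced F (verts F) = F" using F(1)
    by (intro graph_eqI simple_graph_induced) (auto dest: simple_graph_adjD)
  then have "graph_dist F u v = graph_dist G (f u) (f v)" if "u \<in> verts F" "v \<in> verts F" for u v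
    using *[of "verts F"] F(2) that by simp
  then show ?thesis unfolding distance_hereditary_def using * by (simp add: subset_iff)
qed

section \<open>Split decompositions\<close>

lemma adj_add_vertex: "adj (add_vertex K m N) u v \<longleftrightarrow> adj K u v \<or> u = m \<and> v \<in> N \<or> v = m \<and> u \<in> N"
  by (auto simp: adj_def add_vertex_def doubleton_eq_iff)

lemma verts_add_vertex [simp]: "verts (add_vertex K m N) = insert m (verts K)"
  by (simp add: add_vertex_def)

lemma simple_graph_add_vertex:
  assumes "simple_graph K" "m \<notin> verts K" "N \<subseteq> verts K"
  shows "simple_graph (add_vertex K m N)"
proof -
  have "e \<subseteq> insert m (verts K) \<and> card e = 2" if e: "e \<in> edges (add_vertex K m N)" for e
  proof -
    consider "e \<in> edges K" | x where "e = {m, x}" "x \<in> N" using e by (auto simp: add_vertex_def)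
    then show ?thesis using assms by cases (auto simp: simple_graph_def card_insert_if)
  qed
  then show ?thesis using assms(1) by (auto simp: simple_graph_def)
qed

lemma is_split_commute: "is_split G V1 V2 \<longleftrightarrow> is_split G V2 V1"
proof -
  have "is_split G V2 V1" if s: "is_split G V1 V2" for V1 V2
  proof -
    have "{{x, y} | x y. x \<in> V2 \<and> y \<in> V1 \<and> adj G x y} = {{x, y} | x y. x \<in> V1 \<and> y \<in> V2 \<and> adj G x y}"
      by (auto simp: adj_commute) (metis adj_commute insert_commute)+
    moreover have "{{x, y} | x y. x \<in> nbhd G V1 \<and> y \<in> nbhd G V2} = {{x, y} | x y. x \<in> nbhd G V2 \<and>
        y \<in> nbhd G V1}"
      by (metis (no_types, opaque_lifting) insert_commute)
    ultimately show ?thesis using s by (simp add: is_split_def Un_commute Int_commute)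
  qed
  then show ?thesis by blast
qed

lemma is_split_adj:
  assumes "is_split G V1 V2" "x \<in> V1" "y \<in> V2"
  shows "adj G x y \<longleftrightarrow> x \<in> nbhd G V2 \<and> y \<in> nbhd G V1"
proof
  have V: "V1 \<union> V2 = verts G" "V1 \<inter> V2 = {}" using assms(1) by (auto simp: is_split_def)
  show "adj G x y \<Longrightarrow> x \<in> nbhd G V2 \<and> y \<in> nbhd G V1"
    using assms(2,3) V adj_commute[of G y x] by (auto simp: nbhd_def)
  assume "x \<in> nbhd G V2 \<and> y \<in> nbhd G V1"
  then have "{x, y} \<in> {{x, y} | x y. x \<in> nbhd G V2 \<and> y \<in> nbhd G V1}" by blast
  then have "{x, y} \<in> {{x, y} | x y. x \<in> V1 \<and> y \<in> V2 \<and> adj G x y}" using assms(1)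
    by (simp add: is_split_def)
  then obtain a b where "{x, y} = {a, b}" "adj G a b" by blast
  then show "adj G x y" using adj_commute[of G a b] by (auto simp: doubleton_eq_iff)
qed

abbreviation split_part :: "'b ugraph \<Rightarrow> 'b set \<Rightarrow> 'b set \<Rightarrow> 'b \<Rightarrow> 'b ugraph" where
  "split_part H V1 V2 n \<equiv> add_vertex (induced H V1) n (nbhd H V2)"

text \<open>The part is connected because it is the image of \<open>H\<close> under the contraction
  of \<open>V2\<close> to the marker.\<close>

lemma node_split_part:
  assumes H: "node H" and sp: "is_split H V1 V2" and n: "n \<notin> verts H"
  shows "node (split_part H V1 V2 n)" "verts (split_part H V1 V2 n) = insert n V1"
proof -
  let ?P = "split_part H V1 V2 n"
  have V: "V1 \<union> V2 = verts H" "V1 \<inter> V2 = {}" "card V1 > 1" "card V2 > 1" using sp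
    by (auto simp: is_split_def)
  show v: "verts ?P = insert n V1" using V by auto
  have s: "simple_graph ?P" using nodeD(1)[OF H] V n
    by (intro simple_graph_add_vertex simple_graph_induced) (auto simp: nbhd_def)
  have "finite V1" by (rule card_ge_0_finite) (use V(3) in simp)
  moreover have "n \<notin> V1" using n V by auto
  ultimately have c: "card (verts ?P) \<ge> 3" unfolding v using V(3) by simp
  obtain z where z: "z \<in> V2" using V(4) by fastforce
  let ?f = "\<lambda>x. if x \<in> V2 then n else x"
  have j: "joined ?P (?f x) n" if "x \<in> verts H" for x
  proof -
    have "joined ?P (?f x) (?f z)"
    proof (rule joined_map[where G = H and f = ?f and u = x and v = z])
      show "joined H x z" using that z V nodeD(2)[OF H] by (auto simp: connected_graph_def)
      show "?f y \<in> verts ?P" if "y \<in> verts H" for y using that V by auto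
      show "joined ?P (?f a) (?f b)" if ab: "adj H a b" for a b
      proof -
        have abH: "a \<in> verts H" "b \<in> verts H" using simple_graph_adjD[OF nodeD(1)[OF H] ab] by auto
        have "adj H b a" using ab adj_commute by metis
        then have "?f a = ?f b \<or> adj ?P (?f a) (?f b)"
          using ab abH V by (auto simp: adj_add_vertex nbhd_def)
        then show ?thesis
        proof
          assume eq: "?f a = ?f b"
          have m: "?f a \<in> verts ?P" using abH V by auto
          show ?thesis using joined_refl[OF m] unfolding eq .
        qed (rule joined_adj[OF s])
      qed
    qed
    then show ?thesis using z by simp
  qed
  have "connected_graph ?P"
  proof (rule connected_graphI)
    show "n \<in> verts ?P" by simp
    show "joined ?P x n" if "x \<in> verts ?P" for x
    proof (cases "x = n")
      case True then show ?thesis by (auto intro: joined_refl)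
    next
      case False
      then have "x \<in> V1" using that v by auto
      then have "x \<notin> V2" "x \<in> verts H" using V by auto
      then show ?thesis using j[of x] by simp
    qed
  qed
  then show "node ?P" using s c by (simp add: node_def)
qed

text \<open>Nothing is lost because the crossing edges of a split are all pairs from the two
  frontiers, and these frontiers become the neighbourhoods of the two copies of the marker.\<close>

lemma glue_split_parts:
  assumes H: "node H" and sp: "is_split H V1 V2" and n: "n \<notin> verts H"
  shows "glue (split_part H V1 V2 n) (split_part H V2 V1 n) n = H"
proof (rule graph_eqI)
  let ?P = "split_part H V1 V2 n" and ?Q = "split_part H V2 V1 n"
  note P = node_split_part[OF H sp n]
    and Q = node_split_part[OF H _ n, of V2 V1, folded is_split_commute[of H V1 V2], OF sp]
  have V: "V1 \<union> V2 = verts H" "V1 \<inter> V2 = {}" using sp by (auto simp: is_split_def)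
  show "simple_graph (glue ?P ?Q n)"
    using simple_graph_glue[OF nodeD(1)[OF P(1)] nodeD(1)[OF Q(1)]] V unfolding P(2) Q(2) by blast
  show "simple_graph H" using H by (rule nodeD)
  show "verts (glue ?P ?Q n) = verts H" unfolding verts_glue P(2) Q(2) using V n by auto
  fix u v
  have nn: "n \<notin> V1" "n \<notin> V2" using n V by auto
  have nb: "nbhd H V2 \<subseteq> V1" "nbhd H V1 \<subseteq> V2" using V by (auto simp: nbhd_def)
  have aH: "adj H x y \<Longrightarrow> x \<in> V1 \<union> V2 \<and> y \<in> V1 \<union> V2" for x y
    using simple_graph_adjD[OF nodeD(1)[OF H]] V by blast
  have cr: "adj H x y \<longleftrightarrow> x \<in> nbhd H V2 \<and> y \<in> nbhd H V1" if "x \<in> V1" "y \<in> V2" for x y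
    using is_split_adj[OF sp that] .
  have cr': "adj H y x \<longleftrightarrow> x \<in> nbhd H V2 \<and> y \<in> nbhd H V1" if "x \<in> V1" "y \<in> V2" for x y
    using is_split_adj[OF sp that] adj_commute by metis
  have an: "\<not> adj H n x" "\<not> adj H x n" for x using aH nn by blast+
  have g: "adj (glue ?P ?Q n) u v \<longleftrightarrow> u \<noteq> n \<and> v \<noteq> n \<and>
     (adj H u v \<and> (u \<in> V1 \<and> v \<in> V1 \<or> u \<in> V2 \<and> v \<in> V2) \<or> u \<in> nbhd H V2 \<and> v \<in> nbhd H V1 \<or> v \<in> nbhd H
         V2 \<and> u \<in> nbhd H V1)"
    unfolding adj_glue[OF nodeD(1)[OF P(1)] nodeD(1)[OF Q(1)]] adj_add_vertex adj_induced
    by (simp add: an) blast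
  show "adj (glue ?P ?Q n) u v \<longleftrightarrow> adj H u v"
  proof (cases "u \<in> V1 \<union> V2 \<and> v \<in> V1 \<union> V2")
    case False
    then show ?thesis unfolding g using aH nb by blast
  next
    case True
    have un: "u \<noteq> n" "v \<noteq> n" using True nn by auto
    consider "u \<in> V1" "v \<in> V1" | "u \<in> V2" "v \<in> V2" | "u \<in> V1" "v \<in> V2" | "u \<in> V2" "v \<in> V1"
      using True by blast
    then show ?thesis
    proof cases
      case 1
      then have "v \<notin> nbhd H V1" "u \<notin> nbhd H V1" using nb V by blast+
      then show ?thesis unfolding g using 1 un by simp
    next
      case 2
      then have "v \<notin> nbhd H V2" "u \<notin> nbhd H V2" using nb V by blast+
      then show ?thesis unfolding g using 2 un by simp
    next
      case 3
      then have "u \<notin> V2" "v \<notin> V1" using V by blast+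
      moreover have "v \<notin> nbhd H V2" using nb calculation by blast
      ultimately show ?thesis unfolding g using 3 un cr by simp
    next
      case 4
      then have "u \<notin> V1" "v \<notin> V2" using V by blast+
      moreover have "u \<notin> nbhd H V2" using nb calculation by blast
      ultimately show ?thesis unfolding g using 4 un cr' by simp
    qed
  qed
qed

lemma simple_decomp_props:
  assumes "decomp_tree F D" "simple_decomp D D'"
  shows "decomp_tree F D'" "card D' = Suc (card D)" "\<Union>(verts ` D) \<subseteq> \<Union>(verts ` D')"
proof -
  obtain H V1 V2 n where h: "H \<in> D" "is_split H V1 V2" "Marker n \<notin> (\<Union>K\<in>D. verts K)"
    "D' = (D - {H}) \<union> {split_part H V1 V2 (Marker n), split_part H V2 V1 (Marker n)}"
    using assms(2) by cases auto
  let ?P = "split_part H V1 V2 (Marker n)" and ?Q = "split_part H V2 V1 (Marker n)"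
  have nH: "node H" using decomp_treeD(4)[OF assms(1)] h(1) by blast
  have n: "Marker n \<notin> verts H" using h by blast
  have sp': "is_split H V2 V1" using h(2) is_split_commute by blast
  note P = node_split_part[OF nH h(2) n] and Q = node_split_part[OF nH sp' n]
  have V: "V1 \<union> V2 = verts H" "V1 \<inter> V2 = {}" "card V1 > 1" using h(2) by (auto simp: is_split_def)
  have D': "D' = insert ?Q (insert ?P (D - {H}))" unfolding h(4) by auto
  show "decomp_tree F D'" unfolding D'
  proof (rule decomp_tree_split[OF assms(1) h(1) glue_split_parts[OF nH h(2) n, symmetric] P(1)
      Q(1)])
    show "verts ?P \<inter> verts ?Q = {Marker n}" unfolding P(2) Q(2) using V by auto
  qed (use h in auto)
  \<comment> \<open>The fresh marker keeps both parts out of \<open>D\<close>, and their vertex sets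
    differ; hence the set of nodes really grows by one.\<close>
  have "?P \<notin> D" "?Q \<notin> D" using h(3) by force+
  moreover have "?P \<noteq> ?Q"
  proof
    assume "?P = ?Q"
    then have "insert (Marker n) V1 = insert (Marker n) V2" using P(2) Q(2) by metis
    then have "V1 = V2" using n V by (metis Un_iff insert_ident)
    then show False using V by auto
  qed
  ultimately show "card D' = Suc (card D)"
    unfolding D'
      using decomp_treeD(2)[OF assms(1)] card_Suc_Diff1[OF decomp_treeD(2)[OF assms(1)] h(1)]
      by simp
  show "\<Union>(verts ` D) \<subseteq> \<Union>(verts ` D')"
  proof -
    have "verts H \<subseteq> verts ?P \<union> verts ?Q" unfolding P(2) Q(2) using V by blast
    then show ?thesis unfolding D' by auto
  qed
qed

lemma simple_decomp_rtranclp: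
  assumes "simple_decomp\<^sup>*\<^sup>* D D'" "decomp_tree F D"
  shows "decomp_tree F D' \<and> card D \<le> card D'"
  using assms(1)
proof induction
  case base
  then show ?case using assms(2) by simp
next
  case (step y z)
  then show ?case using simple_decomp_props[of F y z] by auto
qed

lemma simple_decomp_tranclp_card:
  assumes "simple_decomp\<^sup>+\<^sup>+ D D'" "decomp_tree F D"
  shows "card D < card D'"
proof -
  obtain E where "simple_decomp D E" "simple_decomp\<^sup>*\<^sup>* E D'" using assms(1) by (meson tranclpD)
  then show ?thesis using simple_decomp_props[OF assms(2)] simple_decomp_rtranclp[of E D' F]
    by fastforce
qed

text \<open>A neighbour of the marker in \<open>B\<close> is needed to recover the marker's edges in
  \<open>A\<close>: through it every neighbour of the marker becomes a frontier vertex.\<close>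

lemma split_part_glue:
  assumes A: "node A" and B: "node B" and i: "verts A \<inter> verts B = {m}"
  shows "split_part (glue A B m) (verts A - {m}) (verts B - {m}) m = A"
proof (rule graph_eqI)
  let ?G = "glue A B m" and ?N = "nbhd (glue A B m) (verts B - {m})"
  note sA = nodeD(1)[OF A] and sB = nodeD(1)[OF B]
  have m: "m \<in> verts A" "m \<in> verts B" using i by auto
  obtain h where h: "adj B m h" using connected_has_nbr[OF nodeD(2)[OF B] m(2)] nodeD(3)[OF B]
    by auto
  have nA: "\<not> adj A x y" if "x \<notin> verts A \<or> y \<notin> verts A \<or> x = y" for x y
    using simple_graph_adjD[OF sA] that by blast
  have nB: "\<not> adj B x y" if "x \<notin> verts B \<or> y \<notin> verts B \<or> x = y" for x y
    using simple_graph_adjD[OF sB] that by blast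
  have hB: "h \<in> verts B" "h \<noteq> m" using h nB by blast+
  have N: "x \<in> ?N \<longleftrightarrow> adj A m x" for x
  proof
    assume "x \<in> ?N"
    then obtain w where w: "x \<in> verts A" "x \<noteq> m" "x \<notin> verts B" "w \<in> verts B" "w \<noteq> m" "adj ?G x w"
      by (auto simp: nbhd_def)
    have "w \<notin> verts A" using w i by auto
    then show "adj A m x" using w nA nB by (auto simp: adj_glue[OF sA sB])
  next
    assume a: "adj A m x"
    then have x: "x \<in> verts A" "x \<noteq> m" using nA by blast+
    then have "x \<notin> verts B" using i by auto
    moreover have "adj ?G x h" using a h x hB by (simp add: adj_glue[OF sA sB])
    ultimately show "x \<in> ?N" using x hB by (auto simp: nbhd_def)
  qed
  have NA: "?N \<subseteq> verts A - {m}" using N nA by blast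
  show "simple_graph (split_part ?G (verts A - {m}) (verts B - {m}) m)"
    using simple_graph_glue[OF sA sB] i NA
      by (intro simple_graph_add_vertex simple_graph_induced) auto
  show "simple_graph A" by fact
  show "verts (split_part ?G (verts A - {m}) (verts B - {m}) m) = verts A" using m by auto
  fix u v
  have mm: "\<not> adj A m m" using nA by blast
  have cm: "adj A u m = adj A m u" by (rule adj_commute)
  have nAB: "x \<notin> verts B" if "x \<in> verts A - {m}" for x using that i by auto
  have inn: "adj ?G u v \<longleftrightarrow> adj A u v" if "u \<in> verts A - {m}" "v \<in> verts A - {m}"
    using that nAB[OF that(1)] nAB[OF that(2)] nB by (auto simp: adj_glue[OF sA sB])
  show "adj (split_part ?G (verts A - {m}) (verts B - {m}) m) u v \<longleftrightarrow> adj A u v"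
  proof (cases "u \<in> verts A - {m} \<and> v \<in> verts A - {m}")
    case True
    then show ?thesis using inn by (auto simp: adj_add_vertex)
  next
    case False
    then show ?thesis using nA[of u v] cm mm N by (auto simp: adj_add_vertex)
  qed
qed

lemma is_split_glue:
  assumes A: "node A" and B: "node B" and i: "verts A \<inter> verts B = {m}"
  shows "is_split (glue A B m) (verts A - {m}) (verts B - {m})"
proof -
  let ?G = "glue A B m"
  note sA = nodeD(1)[OF A] and sB = nodeD(1)[OF B]
  have m: "m \<in> verts A" "m \<in> verts B" using i by auto
  have nA: "\<not> adj A x y" if "x \<notin> verts A \<or> y \<notin> verts A" for x y using simple_graph_adjD[OF sA] that
    by blast
  have nB: "\<not> adj B x y" if "x \<notin> verts B \<or> y \<notin> verts B" for x y using simple_graph_adjD[OF sB] that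
    by blast
  have c: "card (verts A - {m}) > 1" "card (verts B - {m}) > 1"
    using nodeD(3,4)[OF A] nodeD(3,4)[OF B] m by (auto simp: card_Diff_singleton)
  have a: "adj ?G x y \<longleftrightarrow> adj A m x \<and> adj B m y" if "x \<in> verts A - {m}" "y \<in> verts B - {m}" for x y
  proof -
    have "x \<notin> verts B" "y \<notin> verts A" using that i by auto
    then show ?thesis using that nA nB by (auto simp: adj_glue[OF sA sB])
  qed
  obtain h where h: "adj B m h" using connected_has_nbr[OF nodeD(2)[OF B] m(2)] nodeD(3)[OF B]
    by auto
  obtain f where f: "adj A m f" using connected_has_nbr[OF nodeD(2)[OF A] m(1)] nodeD(3)[OF A]
    by auto
  have hf: "h \<in> verts B - {m}" "f \<in> verts A - {m}"
    using h f simple_graph_adjD[OF sA] simple_graph_adjD[OF sB] by blast+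
  have "x \<in> nbhd ?G (verts B - {m}) \<longleftrightarrow> x \<in> verts A - {m} \<and> adj A m x" for x
    using a[of x] h hf(1) i by (auto simp: nbhd_def)
  moreover have "y \<in> nbhd ?G (verts A - {m}) \<longleftrightarrow> y \<in> verts B - {m} \<and> adj B m y" for y
    using a[of _ y] f hf(2) i by (auto simp: nbhd_def adj_commute[of ?G y])
  ultimately have "x \<in> verts A - {m} \<and> y \<in> verts B - {m} \<and> adj ?G x y \<longleftrightarrow>
      x \<in> nbhd ?G (verts B - {m}) \<and> y \<in> nbhd ?G (verts A - {m})" for x y
    using a by blast
  then show ?thesis using c i unfolding is_split_def by auto
qed

lemma simple_decomp_glue:
  assumes "node A" "node B" "verts A \<inter> verts B = {m}" "m \<in> range Marker" "m \<notin> \<Union>(verts ` D)"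
    "glue A B m \<notin> D"
  shows "simple_decomp (insert (glue A B m) D) (insert B (insert A D))"
proof -
  obtain n where n: "m = Marker n" using assms(4) by auto
  have "simple_decomp (insert (glue A B m) D) ((insert (glue A B m) D - {glue A B m}) \<union>
     {split_part (glue A B m) (verts A - {m}) (verts B - {m}) (Marker n), split_part (glue A B m)
         (verts B - {m}) (verts A - {m}) (Marker n)})"
    using is_split_glue[OF assms(1-3)] assms(5) n by (intro simple_decomp.intros) auto
  moreover have "split_part (glue A B m) (verts B - {m}) (verts A - {m}) m = B"
    using split_part_glue[OF assms(2,1), of m] assms(3) glue_commute[of A B]
      by (simp add: Int_commute)
  ultimately show ?thesis
    using split_part_glue[OF assms(1-3)] assms(6) unfolding n[symmetric]
      by (simp add: insert_commute)
qed

text \<open>A bystander \<open>K\<close> can be carried through a sequence of decompositions. Its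
  only vertex that may occur in the result is \<open>m\<close>, which is present from the start and
  so is never chosen as a fresh marker.\<close>

lemma simple_decomp_rtranclp_insert:
  assumes "simple_decomp\<^sup>*\<^sup>* {F} D" "node F" "node K" "m \<in> verts F" "verts K \<inter> \<Union>(verts ` D) \<subseteq> {m}"
  shows "simple_decomp\<^sup>*\<^sup>* {K, F} (insert K D) \<and> m \<in> \<Union>(verts ` D)"
  using assms(1,5)
proof induction
  case base
  then show ?case using assms(4) by simp
next
  case (step y z)
  have dy: "decomp_tree F y"
    using simple_decomp_rtranclp[OF step(1) decomp_tree.single[OF assms(2)]] by simp
  have sub: "\<Union>(verts ` y) \<subseteq> \<Union>(verts ` z)" using simple_decomp_props(3)[OF dy step(2)] .
  have Ky: "verts K \<inter> \<Union>(verts ` y) \<subseteq> {m}" using step.prems sub by blast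
  have IH: "simple_decomp\<^sup>*\<^sup>* {K, F} (insert K y)" "m \<in> \<Union>(verts ` y)" using step.IH[OF Ky] by auto
  obtain H V1 V2 n where h: "H \<in> y" "is_split H V1 V2" "Marker n \<notin> (\<Union>K\<in>y. verts K)"
    "z = (y - {H}) \<union> {split_part H V1 V2 (Marker n), split_part H V2 V1 (Marker n)}"
    using step(2) by cases auto
  have "Marker n \<in> \<Union>(verts ` z)" unfolding h(4) by auto
  moreover have "Marker n \<noteq> m" using IH(2) h(3) by auto
  ultimately have nK: "Marker n \<notin> verts K" using step.prems by auto
  have "verts K \<inter> \<Union>(verts ` y) = verts K" if "K \<in> y" using that by auto
  then have KH: "K \<noteq> H" using Ky h(1) card_mono[of "{m}" "verts K"] nodeD(3)[OF assms(3)] by auto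
  have "simple_decomp (insert K y) ((insert K y - {H}) \<union>
      {split_part H V1 V2 (Marker n), split_part H V2 V1 (Marker n)})"
    using h nK by (intro simple_decomp.intros) auto
  moreover have "(insert K y - {H}) \<union>
      {split_part H V1 V2 (Marker n), split_part H V2 V1 (Marker n)} = insert K z"
    unfolding h(4) using KH by auto
  ultimately have "simple_decomp (insert K y) (insert K z)" by simp
  then show ?case using IH sub by auto
qed

text \<open>The last attached leaf is split off first. This certifies trees obtained by merging as
  split decompositions of the original graph.\<close>

lemma decomp_tree_imp_simple_decomp:
  assumes "decomp_tree F D"
  shows "simple_decomp\<^sup>*\<^sup>* {F} D"
  using assms
proof induction
  case (glue F D H m)
  have nF: "node F" using decomp_treeD(1)[OF glue(1)] .
  have i: "verts F \<inter> verts H = {m}" using glue(4,5) decomp_treeD(3)[OF glue(1)] by blast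
  have "simple_decomp {glue F H m} {H, F}"
    using simple_decomp_glue[OF nF glue(2) i glue(3), of "{}"] by simp
  moreover have "simple_decomp\<^sup>*\<^sup>* {H, F} (insert H D)"
    using simple_decomp_rtranclp_insert[OF glue.IH nF glue(2,4)] glue(5) by simp
  ultimately show ?case by (rule converse_rtranclp_into_rtranclp)
qed simp

text \<open>Replacing markers by neighbours repeatedly shows every node to be an induced subgraph,
  so nodes inherit distance heredity.\<close>

lemma decomp_tree_node_embedding:
  assumes "decomp_tree F D" "K \<in> D"
  shows "\<exists>f. embedding f K F"
  using assms
proof induction
  case (single F)
  then show ?case using embedding_id by auto
next
  case (glue F D H m)
  note P = decomp_tree_props[OF glue(1)]
  have nF: "node F" using P by simp
  have i: "verts F \<inter> verts H = {m}" using glue(4,5) P by blast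
  have m: "m \<in> verts H" "m \<in> verts F" using i by auto
  have c: "card (verts F) \<ge> 2" "card (verts H) \<ge> 2" using nodeD(3)[OF nF] nodeD(3)[OF glue(2)]
    by auto
  note s = nodeD(1)[OF nF] nodeD(1)[OF glue(2)]
  show ?case
  proof (cases "K = H")
    case True
    obtain f where f: "adj F m f" using connected_has_nbr[OF nodeD(2)[OF nF] m(2) c(1)] .
    have "embedding (\<lambda>x. if x = m then f else x) H (glue H F m)"
      using i by (intro embedding_glue[OF s(2,1) m(1) _ f]) auto
    then show ?thesis using True glue_commute[of H F m] by auto
  next
    case False
    obtain h where h: "adj H m h" using connected_has_nbr[OF nodeD(2)[OF glue(2)] m(1) c(2)] .
    obtain g where "embedding g K F" using glue False by auto
    then show ?thesis using embedding_comp embedding_glue[OF s m(2) i h] by blast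
  qed
qed

section \<open>Words for decomposition trees\<close>

definition star_at :: "'b ugraph \<Rightarrow> 'b \<Rightarrow> bool" where
  "star_at H c \<longleftrightarrow> c \<in> verts H \<and>
     (\<forall>u v. adj H u v \<longleftrightarrow> u = c \<and> v \<in> verts H - {c} \<or> v = c \<and> u \<in> verts H - {c})"

lemma star_graph_iff:
  assumes "simple_graph H"
  shows "star_graph H \<longleftrightarrow> (\<exists>c. star_at H c)"
proof
  assume "star_graph H"
  then obtain c where c: "c \<in> verts H" "edges H = {{c, v} | v. v \<in> verts H - {c}}"
    by (auto simp: star_graph_def)
  then have "star_at H c" unfolding star_at_def adj_def c(2) by (auto simp: doubleton_eq_iff)
  then show "\<exists>c. star_at H c" by blast
next
  assume "\<exists>c. star_at H c"
  then obtain c where c: "star_at H c" by blast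
  have "e \<in> edges H \<longleftrightarrow> e \<in> {{c, v} | v. v \<in> verts H - {c}}" for e
  proof
    assume e: "e \<in> edges H"
    then obtain u v where uv: "e = {u, v}" using assms by (auto simp: simple_graph_def card_2_iff)
    then have "adj H u v" using e by (simp add: adj_def)
    then show "e \<in> {{c, v} | v. v \<in> verts H - {c}}" using c uv
      by (auto simp: star_at_def insert_commute)
  next
    assume "e \<in> {{c, v} | v. v \<in> verts H - {c}}"
    then obtain v where "e = {c, v}" "v \<in> verts H - {c}" by blast
    then show "e \<in> edges H" using c by (auto simp: star_at_def adj_def)
  qed
  then have "edges H = {{c, v} | v. v \<in> verts H - {c}}" by blast
  then show "star_graph H" using c unfolding star_graph_def star_at_def by blast
qed

definition clique_or_star :: "'b ugraph \<Rightarrow> bool" where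
  "clique_or_star H \<longleftrightarrow> clique_graph H \<or> (\<exists>c. star_at H c)"

lemma clique_graph_universal:
  assumes "clique_graph H" "m \<in> verts H" shows "universal H m"
proof -
  have "adj H m v" if "v \<in> verts H - {m}" for v
  proof -
    have "m \<noteq> v" "v \<in> verts H" using that by auto
    then show ?thesis using assms by (simp add: clique_graph_def)
  qed
  then show ?thesis using assms(2) by (simp add: universal_def)
qed

lemma node_outside:
  assumes "node H"
  obtains x where "x \<in> verts H" "x \<noteq> a" "x \<noteq> b"
proof -
  have "\<not> verts H \<subseteq> {a, b}"
  proof
    assume "verts H \<subseteq> {a, b}"
    then have "card (verts H) \<le> card {a, b}" by (intro card_mono) auto
    also have "\<dots> \<le> 2" by (simp add: card_insert_if)
    finally show False using nodeD(3)[OF assms] by simp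
  qed
  then show ?thesis using that by blast
qed

text \<open>From four vertices on, a non-clique has a split and so is not prime. A connected
  non-clique on three vertices is a path, which is a star.\<close>

lemma distance_hereditary_node:
  assumes H: "node H" and dh: "distance_hereditary H"
    and p: "prime_graph H \<or> clique_graph H \<or> star_graph H"
  shows "clique_or_star H"
proof (rule ccontr)
  assume n: "\<not> clique_or_star H"
  note s = nodeD(1)[OF H]
  have nc: "\<not> clique_graph H" using n by (simp add: clique_or_star_def)
  have "prime_graph H" using n p star_graph_iff[OF s] by (auto simp: clique_or_star_def)
  then have "\<not> card (verts H) \<ge> 4"
    using distance_hereditary_has_split[OF s nodeD(2)[OF H] dh nc] by (auto simp: prime_graph_def)
  then have c3: "card (verts H) = 3" using nodeD(3)[OF H] by simp
  obtain a b where ab: "a \<in> verts H" "b \<in> verts H" "a \<noteq> b" "\<not> adj H a b" using nc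
    by (auto simp: clique_graph_def)
  obtain c where c: "c \<in> verts H" "c \<noteq> a" "c \<noteq> b" using node_outside[OF H] by metis
  have "{a, b, c} = verts H" using ab c c3 nodeD(4)[OF H] by (intro card_subset_eq) auto
  note V = this[symmetric]
  have nb: "adj H x c" if x: "x = a \<or> x = b" for x
  proof -
    obtain h where h: "adj H x h" using connected_has_nbr[OF nodeD(2)[OF H], of x] x ab c3 by auto
    then have "h \<in> {a, b, c}" "h \<noteq> x" using simple_graph_adjD[OF s h] V by auto
    then show ?thesis using h x ab(4) adj_commute[of H a b] by auto
  qed
  have "adj H u v \<longleftrightarrow> u = c \<and> v \<in> verts H - {c} \<or> v = c \<and> u \<in> verts H - {c}" for u v
  proof
    assume uv: "adj H u v"
    then have "u \<in> {a, b, c}" "v \<in> {a, b, c}" "u \<noteq> v" using simple_graph_adjD[OF s uv] V by auto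
    then show "u = c \<and> v \<in> verts H - {c} \<or> v = c \<and> u \<in> verts H - {c}"
      using uv ab(4) adj_commute[of H a b] V by auto
  next
    assume "u = c \<and> v \<in> verts H - {c} \<or> v = c \<and> u \<in> verts H - {c}"
    then show "adj H u v" using nb V adj_commute[of H c] by auto
  qed
  then show False using n c by (auto simp: clique_or_star_def star_at_def)
qed

lemma adj_glue_cases:
  assumes F: "simple_graph F" and H: "simple_graph H" and i: "verts F \<inter> verts H = {m}"
  shows adj_glue_left: "u \<in> verts F - {m} \<Longrightarrow> v \<in> verts F - {m} \<Longrightarrow> adj (glue F H m) u v \<longleftrightarrow> adj F u v"
    and adj_glue_right: "h \<in> verts H - {m} \<Longrightarrow> h' \<in> verts H - {m} \<Longrightarrow> adj (glue F H m) h h' \<longleftrightarrow>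
        adj H h h'"
    and adj_glue_cross: "h \<in> verts H - {m} \<Longrightarrow> v \<in> verts F - {m} \<Longrightarrow> adj (glue F H m) h v \<longleftrightarrow>
        adj H m h \<and> adj F m v"
proof -
  have nF: "\<not> adj F x y" if "x \<notin> verts F \<or> y \<notin> verts F" for x y using simple_graph_adjD[OF F] that
    by blast
  have nH: "\<not> adj H x y" if "x \<notin> verts H \<or> y \<notin> verts H" for x y using simple_graph_adjD[OF H] that
    by blast
  have iF: "x \<notin> verts H" if "x \<in> verts F - {m}" for x using that i by auto
  have iH: "x \<notin> verts F" if "x \<in> verts H - {m}" for x using that i by auto
  show "u \<in> verts F - {m} \<Longrightarrow> v \<in> verts F - {m} \<Longrightarrow> adj (glue F H m) u v \<longleftrightarrow> adj F u v"
    using iF nH by (auto simp: adj_glue[OF F H])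
  show "h \<in> verts H - {m} \<Longrightarrow> h' \<in> verts H - {m} \<Longrightarrow> adj (glue F H m) h h' \<longleftrightarrow> adj H h h'"
    using iH nF by (auto simp: adj_glue[OF F H])
  show "h \<in> verts H - {m} \<Longrightarrow> v \<in> verts F - {m} \<Longrightarrow> adj (glue F H m) h v \<longleftrightarrow> adj H m h \<and> adj F m v"
    using iF[of v] iH[of h] nF nH by (auto simp: adj_glue[OF F H])
qed

section \<open>Gluing cliques and stars into a word\<close>

text \<open>A universal marker is any vertex of a clique or the centre of a star. Without it the
  rest is complete or edgeless, so its vertices become true or false twins after gluing.\<close>

lemma clique_or_star_universal:
  assumes H: "node H" and c: "clique_or_star H" and u: "universal H m"
  shows "\<exists>b. \<forall>h\<in>verts H - {m}. \<forall>h'\<in>verts H - {m}. h \<noteq> h' \<longrightarrow> (adj H h h' \<longleftrightarrow> b)"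
proof (cases "clique_graph H")
  case True
  then show ?thesis by (intro exI[of _ True]) (auto simp: clique_graph_def)
next
  case False
  then obtain c where c: "star_at H c" using c by (auto simp: clique_or_star_def)
  obtain x where "x \<in> verts H" "x \<noteq> m" "x \<noteq> c" using node_outside[OF H] by metis
  then have "adj H m x" using u by (auto simp: universal_def)
  then have "m = c" using c \<open>x \<noteq> c\<close> by (auto simp: star_at_def)
  then show ?thesis using c by (intro exI[of _ False]) (auto simp: star_at_def)
qed

text \<open>The form of the new word matters: the last letter of \<open>hs\<close> is followed by
  whatever followed \<open>m\<close>, in particular by a corner.\<close>

lemma represents_glue_universal:
  assumes rep: "represents F k (Some m # w1 @ Some m # w2)" and F: "simple_graph F" and H: "node H"
    and cs: "clique_or_star H" and i: "verts F \<inter> verts H = {m}" and u: "universal H m"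
    and hs: "distinct hs" "set hs = verts H - {m}"
  shows "\<exists>w3. represents (glue F H m) k (map Some hs @ w1 @ w3)"
proof -
  obtain b where "\<forall>h\<in>verts H - {m}. \<forall>h'\<in>verts H - {m}. h \<noteq> h' \<longrightarrow> (adj H h h' \<longleftrightarrow> b)"
    using clique_or_star_universal[OF H cs u] by (elim exE)
  then have b: "adj H h h' \<longleftrightarrow> b" if "h \<in> verts H - {m}" "h' \<in> verts H - {m}" "h \<noteq> h'" for h h'
    using that by simp
  note s = F nodeD(1)[OF H] i
  have m: "m \<in> verts F" using i by auto
  have "represents (glue F H m) k (map Some hs @ w1 @ map Some (if b then hs else rev hs) @ w2)"
  proof (rule represents_twins[OF rep m hs(1)])
    show "set hs \<inter> verts F = {}" using hs i by auto
    show "verts (glue F H m) = verts F - {m} \<union> set hs" using hs by auto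
    show "adj (glue F H m) u v \<longleftrightarrow> adj F u v" if "u \<in> verts F - {m}" "v \<in> verts F - {m}" for u v
      using adj_glue_left[OF s that] .
    show "(adj (glue F H m) h v \<longleftrightarrow> adj F m v) \<and> (adj (glue F H m) v h \<longleftrightarrow> adj F m v)"
      if h: "h \<in> set hs" "v \<in> verts F - {m}" for h v
    proof -
      have "adj H m h" using u h hs by (auto simp: universal_def)
      then have "adj (glue F H m) h v \<longleftrightarrow> adj F m v" using adj_glue_cross[OF s, of h v] h hs by simp
      then show ?thesis using adj_commute[of "glue F H m" v h] by simp
    qed
    show "adj (glue F H m) h h' \<longleftrightarrow> b" if "h \<in> set hs" "h' \<in> set hs" "h \<noteq> h'" for h h'
      using adj_glue_right[OF s, of h h'] b[of h h'] that hs by simp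
  qed
  then show ?thesis by blast
qed

lemma represents_glue_twins:
  assumes "represents F k w" "simple_graph F" "node H" "clique_or_star H" "verts F \<inter> verts H =
      {m}" "universal H m"
  shows "\<exists>w'. represents (glue F H m) k w'"
proof -
  have "m \<in> verts F" using assms(5) by auto
  then obtain w1 w2 where "represents F k (Some m # w1 @ Some m # w2)"
    using represents_rotate[OF assms(1)] by blast
  moreover obtain hs where "distinct hs" "set hs = verts H - {m}"
    using finite_distinct_list[of "verts H - {m}"] nodeD(4)[OF assms(3)] by auto
  ultimately show ?thesis using represents_glue_universal[OF _ assms(2-6)] by blast
qed

text \<open>A corner next to the marker is handed on to a prescribed vertex \<open>x\<close> of the
  glued node. For twins, \<open>x\<close> is listed last in the block before the corner; for a star
  glued at a leaf, the corner lies between the centre and the first of the small arcs, so either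
  kind of vertex can touch it.\<close>

lemma represents_glue_corner:
  assumes rep: "represents F k (Some m # None # w)" and F: "simple_graph F" and H: "node H"
    and cs: "clique_or_star H" and i: "verts F \<inter> verts H = {m}" and x: "x \<in> verts H - {m}"
  shows "\<exists>w'. represents (glue F H m) k (Some x # None # w')"
proof -
  note s = F nodeD(1)[OF H] i
  have m: "m \<in> verts F" "m \<in> verts H" using i by auto
  have "cornered m (Some m # None # w)" using rep m by (simp add: represents_def)
  then have c2: "count_list (Some m # None # w) (Some m) = 2" by (rule cornered_count)
  then have "Some m \<in> set w" using count_list_0_iff[of w "Some m"] by auto
  then obtain w1 w2 where w: "w = w1 @ Some m # w2" by (meson split_list)
  show ?thesis
  proof (cases "universal H m")
    case True
    obtain ys where ys: "distinct ys" "set ys = verts H - {m} - {x}"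
      using finite_distinct_list[of "verts H - {m} - {x}"] nodeD(4)[OF H] by auto
    then have hs: "distinct (ys @ [x])" "set (ys @ [x]) = verts H - {m}" using x by auto
    have "represents F k (Some m # (None # w1) @ Some m # w2)" using rep w by simp
    then obtain w3 where "represents (glue F H m) k (map Some (ys @ [x]) @ (None # w1) @ w3)"
      using represents_glue_universal[OF _ F H cs i True hs] by blast
    then have "represents (glue F H m) k (map Some ys @ (Some x # None # w1 @ w3))" by simp
    then have "represents (glue F H m) k ((Some x # None # w1 @ w3) @ map Some ys)"
      using represents_append_commute by blast
    then show ?thesis by auto
  next
    case False
    have nc: "\<not> clique_graph H" using clique_graph_universal[OF _ m(2)] False by blast
    then obtain c where c: "star_at H c" using cs by (auto simp: clique_or_star_def)
    have cm: "c \<noteq> m" using c False by (auto simp: star_at_def universal_def)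
    have cH: "c \<in> verts H" using c by (simp add: star_at_def)
    have gen: "represents (glue F H m) k (map Some xs @ Some c # None # map Some (rev xs) @ w1 @ Some c # w2)"
      if xs: "distinct xs" "set xs = verts H - {m, c}" for xs
    proof (rule represents_pendants)
      show "represents F k (Some m # None # w1 @ Some m # w2)" using rep w by simp
      show "set xs \<inter> verts F = {}" "c \<notin> verts F" "c \<notin> set xs" "distinct xs" "m \<in> verts F"
        using xs i cH cm by auto
      show "verts (glue F H m) = verts F - {m} \<union> insert c (set xs)" using xs cH cm by auto
      show "adj (glue F H m) u v \<longleftrightarrow> adj F u v" if "u \<in> verts F - {m}" "v \<in> verts F - {m}" for u v
        using adj_glue_left[OF s that] .
      show "(adj (glue F H m) c v \<longleftrightarrow> adj F m v) \<and> (adj (glue F H m) v c \<longleftrightarrow> adj F m v)"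
        if v: "v \<in> verts F - {m}" for v
      proof -
        have "adj H m c" using c cm m by (auto simp: star_at_def)
        then have "adj (glue F H m) c v \<longleftrightarrow> adj F m v" using adj_glue_cross[OF s, of c v] v cH cm
          by simp
        then show ?thesis using adj_commute[of "glue F H m" v c] by simp
      qed
      show "\<not> adj (glue F H m) y v \<and> \<not> adj (glue F H m) v y"
        if y: "y \<in> set xs" and v: "v \<in> verts F - {m} \<union> set xs" for y v
      proof -
        have "\<not> adj (glue F H m) y v"
        proof (cases "v \<in> set xs")
          case True
          then show ?thesis using adj_glue_right[OF s, of y v] y xs c by (auto simp: star_at_def)
        next
          case False
          then show ?thesis using adj_glue_cross[OF s, of y v] y v xs c cm
            by (auto simp: star_at_def)
        qed
        then show ?thesis using adj_commute[of "glue F H m" v y] by simp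
      qed
      show "adj (glue F H m) y c \<and> adj (glue F H m) c y" if y: "y \<in> set xs" for y
        using adj_glue_right[OF s, of y c] adj_glue_right[OF s, of c y] y xs c cm cH
          by (auto simp: star_at_def)
    qed
    show ?thesis
    proof (cases "x = c")
      case True
      obtain xs where "distinct xs" "set xs = verts H - {m, c}"
        using finite_distinct_list[of "verts H - {m, c}"] nodeD(4)[OF H] by auto
      then have "represents (glue F H m) k (map Some xs @ (Some c # None # map Some (rev xs) @ w1 @ Some c # w2))"
        by (rule gen)
      then show ?thesis unfolding True represents_append_commute[of _ _ "map Some xs"] by auto
    next
      case False
      obtain ys where ys: "distinct ys" "set ys = verts H - {m, c} - {x}"
        using finite_distinct_list[of "verts H - {m, c} - {x}"] nodeD(4)[OF H] by auto
      let ?xs = "ys @ [x]"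
      \<comment> \<open>Being last in \<open>?xs\<close>, \<open>x\<close> is first in the reversed
        block, directly after the corner; reading the word backwards puts it before the
        corner.\<close>
      have "represents (glue F H m) k (map Some ?xs @ Some c # None # map Some (rev ?xs) @ w1 @ Some c # w2)"
        by (rule gen) (use ys x False in auto)
      then have "represents (glue F H m) k (rev (map Some ?xs @ Some c # None # map Some (rev ?xs) @ w1 @ Some c # w2))"
        unfolding represents_rev .
      then have "represents (glue F H m) k ((rev w2 @ Some c # rev w1 @ map Some ys) @ (Some x # None # Some c # map Some (rev ?xs)))"
        by (simp add: rev_map)
      then show ?thesis
        unfolding represents_append_commute[of _ _ "rev w2 @ Some c # rev w1 @ map Some ys"] by auto
    qed
  qed
qed

lemma represents_edge:
  assumes "s \<noteq> t"
  shows "represents \<lparr>verts = {s, t}, edges =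
      {{s, t}}\<rparr> 2 [Some t, Some s, None, Some t, Some s, None]"
proof -
  let ?w = "[Some t, Some s, None, Some t, Some s, None]"
  have "cornered t ?w" using assms cornered_iff_count[of t "[]" "[Some s, None]" "[Some s, None]"]
    by simp
  moreover have "cornered s ?w"
    using assms cornered_iff_count[of s "[Some t]" "[None, Some t]" "[None]"] by simp
  ultimately show ?thesis using assms
    by (auto simp: represents_def interlaced_def proj_Cons adj_def insert_commute)
qed

text \<open>The word of a single edge between \<open>s\<close> and an auxiliary vertex
  \<open>t\<close>, with \<open>t\<close> replaced by twins. A name for \<open>t\<close> outside the
  node exists since there are infinitely many markers.\<close>

lemma represents_twin_vertices:
  assumes hs: "distinct hs" "s \<notin> set hs"
    and K: "simple_graph (K :: 'b dvertex ugraph)" "verts K = insert s (set hs)"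
    and s: "\<And>h. h \<in> set hs \<Longrightarrow> adj K s h"
    and b: "\<And>h h'. h \<in> set hs \<Longrightarrow> h' \<in> set hs \<Longrightarrow> h \<noteq> h' \<Longrightarrow> adj K h h' \<longleftrightarrow> b"
  shows "represents K 2 (map Some hs @ [Some s, None] @ map Some (if b then hs else rev hs) @ [Some s, None])"
proof -
  have "infinite (UNIV :: 'b dvertex set)"
  proof -
    have "inj (Marker :: nat \<Rightarrow> 'b dvertex)" by (auto simp: inj_def)
    then show ?thesis using finite_imageD[of Marker UNIV] finite_subset[OF subset_UNIV] by blast
  qed
  then obtain t where t: "t \<notin> insert s (set hs)" using ex_new_if_finite[of "insert s (set hs)"]
    by auto
  let ?E = "\<lparr>verts = {s, t}, edges = {{s, t}}\<rparr>"
  have e: "represents ?E 2 (Some t # [Some s, None] @ Some t # [Some s, None])"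
    using represents_edge[of s t] t by auto
  have st: "adj ?E t s" "\<not> adj ?E s s" using t by (auto simp: adj_def insert_commute)
  have ks: "\<not> adj K s s" using simple_graph_adjD(3)[OF K(1)] by blast
  show ?thesis
  proof (rule represents_twins[OF e _ hs(1)])
    show "(adj K h v \<longleftrightarrow> adj ?E t v) \<and> (adj K v h \<longleftrightarrow> adj ?E t v)"
      if h: "h \<in> set hs" "v \<in> verts ?E - {t}" for h v
    proof -
      have "v = s" using h t by auto
      then show ?thesis using s[OF h(1)] st adj_commute[of K h s] by simp
    qed
  qed (use t hs K b st ks in auto)
qed

text \<open>The base case, with two corners. In a star with another centre \<open>c\<close>, the
  other vertices including \<open>m\<close> are twins with respect to \<open>c\<close>;
  \<open>m\<close> is first in the block, so that after reversing and rotating the word it precedes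
  a corner.\<close>

lemma represents_node:
  assumes K: "node K" and cs: "clique_or_star (K :: 'b dvertex ugraph)" and m: "m \<in> verts K"
  shows "\<exists>w. represents K 2 (Some m # None # w)"
proof (cases "universal K m")
  case True
  obtain b where "\<forall>h\<in>verts K - {m}. \<forall>h'\<in>verts K - {m}. h \<noteq> h' \<longrightarrow> (adj K h h' \<longleftrightarrow> b)"
    using clique_or_star_universal[OF K cs True] by (elim exE)
  then have b: "adj K h h' \<longleftrightarrow> b" if "h \<in> verts K - {m}" "h' \<in> verts K - {m}" "h \<noteq> h'" for h h'
    using that by simp
  obtain hs where hs: "distinct hs" "set hs = verts K - {m}"
    using finite_distinct_list[of "verts K - {m}"] nodeD(4)[OF K] by auto
  have "represents K 2 (map Some hs @ [Some m, None] @ map Some (if b then hs else rev hs) @ [Some m, None])"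
    by (rule represents_twin_vertices) (use hs nodeD(1)[OF K] b m True in \<open>auto simp:
        universal_def\<close>)
  then have "represents K 2 (([Some m, None] @ map Some (if b then hs else rev hs) @ [Some m, None]) @ map Some hs)"
    using represents_append_commute by blast
  then show ?thesis by auto
next
  case False
  have nc: "\<not> clique_graph K" using clique_graph_universal[OF _ m] False by blast
  then obtain c where c: "star_at K c" using cs by (auto simp: clique_or_star_def)
  have cm: "c \<noteq> m" "c \<in> verts K" using c False by (auto simp: star_at_def universal_def)
  obtain ys where ys: "distinct ys" "set ys = verts K - {c, m}"
    using finite_distinct_list[of "verts K - {c, m}"] nodeD(4)[OF K] by auto
  let ?hs = "m # ys"
  have "represents K 2 (map Some ?hs @ [Some c, None] @ map Some (if False then ?hs else rev ?hs) @ [Some c, None])"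
    by (rule represents_twin_vertices) (use ys nodeD(1)[OF K] m c cm in \<open>auto simp: star_at_def\<close>)
  then have "represents K 2 (rev (map Some ?hs @ [Some c, None] @ map Some (rev ?hs) @ [Some c, None]))"
    unfolding represents_rev by simp
  then have "represents K 2 ((None # Some c # map Some ?hs @ None # Some c # map Some (rev ys)) @ [Some m])"
    by (simp add: rev_map)
  then have "represents K 2 ([Some m] @ (None # Some c # map Some ?hs @ None # Some c # map Some (rev ys)))"
    unfolding represents_append_commute[of K 2 "[Some m]"] .
  then show ?thesis by auto
qed

section \<open>Counting leaves and corners\<close>

lemma attached_leaf:
  assumes D: "decomp_tree F D" and K: "K \<in> D" "m \<in> verts K" and m: "m \<in> verts F"
    and H: "node H" "verts H \<inter> \<Union>(verts ` D) = {m}"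
  shows "node_nbrs (insert H D) H = {K}"
    and "J \<in> D \<Longrightarrow>
        node_nbrs (insert H D) J = (if J = K then insert H (node_nbrs D K) else node_nbrs D J)"
proof -
  have HD: "H \<notin> D" using attached_notin[OF H] .
  have mH: "m \<in> verts H" using H by auto
  have 1: "verts H \<inter> verts J \<noteq> {} \<longleftrightarrow> J = K" if J: "J \<in> D" for J
  proof
    assume "verts H \<inter> verts J \<noteq> {}"
    then have "m \<in> verts J" using J H(2) by auto
    then show "J = K" using decomp_tree_real_unique[OF D J K(1) _ _ K(2)] m by blast
  qed (use mH K in auto)
  show "node_nbrs (insert H D) H = {K}" using 1 K HD by (auto simp: node_nbrs_def)
  assume J: "J \<in> D"
  then have "J \<noteq> H" using HD by blast
  then show "node_nbrs (insert H D) J = (if J = K then insert H (node_nbrs D K) else node_nbrs D J)"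
    using node_nbrs_insert[of J H D] 1[OF J] by (auto simp: Int_commute)
qed

text \<open>A new node is a leaf, and its neighbour ceases to be one if it was. A lone node counts
  as two leaves by convention, which is also the number after the first attachment.\<close>

lemma number_of_leaves_insert:
  assumes D: "decomp_tree F D" and K: "K \<in> D" "m \<in> verts K" and m: "m \<in> verts F"
    and H: "node H" "verts H \<inter> \<Union>(verts ` D) = {m}"
  shows "number_of_leaves (insert H D) =
    (if leaf_node D K \<or> card D = 1 then number_of_leaves D else Suc (number_of_leaves D))"
proof -
  have HD: "H \<notin> D" using attached_notin[OF H] .
  have fin: "finite D" using decomp_treeD(2)[OF D] .
  have c0: "card D \<noteq> 0" using fin K by auto
  have cD: "card (insert H D) = Suc (card D)" using HD fin by simp
  note N = attached_leaf[OF D K m H]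
  have lH: "leaf_node (insert H D) H" using N(1) by (simp add: leaf_node_def)
  show ?thesis
  proof (cases "card D = 1")
    case True
    then have DK: "D = {K}" using K by (auto simp: card_1_singleton_iff)
    have "node_nbrs D K = {}" unfolding DK by (auto simp: node_nbrs_def)
    then have "leaf_node (insert H D) K" using N(2)[OF K(1)] K by (simp add: leaf_node_def)
    then have "{J. leaf_node (insert H D) J} = {H, K}" using lH DK by (auto simp: leaf_node_def)
    moreover have "H \<noteq> K" using HD K by auto
    ultimately show ?thesis using True cD by (simp add: number_of_leaves_def)
  next
    case False
    then have "card D \<ge> 2" using c0 by simp
    then have ne: "node_nbrs D K \<noteq> {}" using decomp_tree_has_nbr[OF D K(1)] by simp
    have finK: "finite (node_nbrs D K)" using fin by (simp add: node_nbrs_def)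
    have "H \<notin> node_nbrs D K" using HD by (simp add: node_nbrs_def)
    then have "card (node_nbrs (insert H D) K) = Suc (card (node_nbrs D K))"
      using N(2)[OF K(1)] finK by simp
    then have nK: "\<not> leaf_node (insert H D) K" using ne finK by (simp add: leaf_node_def)
    have "leaf_node (insert H D) J \<longleftrightarrow> J = H \<or> (J \<noteq> K \<and> leaf_node D J)" for J
      using lH nK N(2)[of J] HD by (cases "J = H"; cases "J = K") (auto simp: leaf_node_def)
    then have e: "{J. leaf_node (insert H D) J} = insert H ({J. leaf_node D J} - {K})"
      using HD K by (auto simp: leaf_node_def)
    have finL: "finite {J. leaf_node D J}" using finite_subset[OF _ fin, of "{J. leaf_node D J}"]
      by (auto simp: leaf_node_def)
    have "H \<notin> {J. leaf_node D J} - {K}" using HD by (auto simp: leaf_node_def)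
    then have "card {J. leaf_node (insert H D) J} = Suc (card ({J. leaf_node D J} - {K}))"
      unfolding e using finL by simp
    also have "\<dots> =
        (if leaf_node D K then card {J. leaf_node D J} else Suc (card {J. leaf_node D J}))"
      using finL card_Suc_Diff1[OF finL, of K] by auto
    finally show ?thesis using False cD c0 by (simp add: number_of_leaves_def)
  qed
qed

lemma number_of_leaves_ge_2: "decomp_tree F D \<Longrightarrow> number_of_leaves D \<ge> 2"
proof (induction rule: decomp_tree.induct)
  case (single F)
  then show ?case by (simp add: number_of_leaves_def)
next
  case (glue F D H m)
  then obtain K where "K \<in> D" "m \<in> verts K" by auto
  then show ?case using number_of_leaves_insert[OF glue(1) _ _ glue(4,2,5)] glue.IH by auto
qed

lemma decomp_tree_ex_leaf:
  assumes "decomp_tree F D" "card D \<noteq> 1"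
  shows "\<exists>H x. leaf_node D H \<and> x \<in> verts H \<inter> verts F"
  using assms
proof cases
  case (glue F' D' H m)
  obtain K where "K \<in> D'" "m \<in> verts K" using glue(7) by auto
  then have "leaf_node D H" using attached_leaf(1)[OF glue(3) _ _ glue(6,4,7)] glue(2)
    by (simp add: leaf_node_def)
  moreover obtain x where "x \<in> verts H" "x \<noteq> m" using node_outside[OF glue(4)] by metis
  ultimately show ?thesis using glue(1) by auto
qed simp

text \<open>The leaf detached in the induction is the one that contains \<open>x\<close>, so the
  claim must be available for every leaf and every vertex of it.\<close>

lemma decomp_tree_represents:
  assumes "decomp_tree F D" "\<forall>K\<in>D. clique_or_star K" "H \<in> D" "leaf_node D H \<or>
      card D = 1" "x \<in> verts H \<inter> verts F"
  shows "\<exists>w. represents F (number_of_leaves D) (Some x # None # w)"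
  using assms
proof (induction "card D" arbitrary: F D H x rule: less_induct)
  case less
  show ?case
  proof (cases "card D = 1")
    case True
    then have "D = {F}" using decomp_tree_single[OF less.prems(1)] by simp
    then show ?thesis using represents_node[of F x] decomp_treeD(1)[OF less.prems(1)] less.prems
      by (simp add: number_of_leaves_def)
  next
    case False
    then have lf: "leaf_node D H" using less.prems by simp
    obtain F' m
      where F': "decomp_tree F' (D - {H})" "F = glue F' H m" "m \<in> range Marker" "m \<in> verts F'"
      "verts H \<inter> \<Union>(verts ` (D - {H})) = {m}" "node H" using decomp_tree_leaf[OF less.prems(1) lf]
        by blast
    let ?D' = "D - {H}"
    have finD: "finite D" using decomp_treeD(2)[OF less.prems(1)] .
    have cD: "card ?D' < card D" using finD less.prems(3) by (rule card_Diff1_less)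
    have cs': "\<forall>K\<in>?D'. clique_or_star K" using less.prems(2) by blast
    obtain K where K: "K \<in> ?D'" "m \<in> verts K" using F'(5) by auto
    have D: "insert H ?D' = D" using less.prems(3) by auto
    note nl = number_of_leaves_insert[OF F'(1) K F'(4,6,5), unfolded D]
    have i: "verts F' \<inter> verts H = {m}" using F'(4,5) decomp_treeD(3)[OF F'(1)] by blast
    have sF': "simple_graph F'" using nodeD(1)[OF decomp_treeD(1)[OF F'(1)]] .
    \<comment> \<open>If the node that holds \<open>m\<close> is a leaf of the smaller tree, the
      induction hypothesis already puts a corner next to \<open>m\<close>. Otherwise a corner is
      spent there, and the number of leaves has grown by one as well.\<close>
    have "\<exists>w. represents F' (number_of_leaves D) (Some m # None # w)"
    proof (cases "leaf_node ?D' K \<or> card ?D' = 1")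
      case True
      then show ?thesis using less.hyps[OF cD F'(1) cs' K(1) True, of m] K F'(4) nl by simp
    next
      case f: False
      then obtain J y where J: "leaf_node ?D' J" "y \<in> verts J \<inter> verts F'"
        using decomp_tree_ex_leaf[OF F'(1)] by blast
      then have "J \<in> ?D'" by (simp add: leaf_node_def)
      then obtain w where "represents F' (number_of_leaves ?D') w"
        using less.hyps[OF cD F'(1) cs' _ _ J(2)] J(1) by blast
      then obtain w1 w2 where "represents F' (number_of_leaves ?D') (Some m # w1 @ Some m # w2)"
        using represents_rotate[OF _ F'(4)] by blast
      then have "represents F' (Suc (number_of_leaves ?D')) (Some m # None # w1 @ Some m # w2)"
        by (rule represents_insert_corner)
      then show ?thesis using nl f by auto
    qed
    then obtain w where w: "represents F' (number_of_leaves D) (Some m # None # w)" by blast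
    have "x \<in> verts H - {m}" using less.prems(5) F'(2) by auto
    then show ?thesis
      using represents_glue_corner[OF w sF' F'(6) _ i] less.prems(2,3) unfolding F'(2) by blast
  qed
qed

section \<open>Pruned decomposition trees\<close>

text \<open>Whether \<open>m\<close> may be deleted is decided within its own node: deletion
  commutes with gluing along other markers, and gluing preserves connectedness.\<close>

lemma decomp_tree_remove_connected:
  assumes "decomp_tree F D" "K \<in> D" "m \<in> verts K" "m \<in> verts F"
      "connected_graph (induced K (verts K - {m}))"
  shows "connected_graph (induced F (verts F - {m}))"
  using assms
proof induction
  case (glue F D H j)
  note P = decomp_tree_props[OF glue(1)]
  have nF: "node F" using P by simp
  have i: "verts F \<inter> verts H = {j}" using glue(4,5) P by blast
  have mj: "m \<noteq> j" using glue.prems by auto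
  note s = nodeD(1)[OF nF] nodeD(1)[OF glue(2)]
  have c: "card (verts F) \<ge> 3" "card (verts H) \<ge> 3" using nodeD(3)[OF nF] nodeD(3)[OF glue(2)] .
  \<comment> \<open>A node has three vertices, so two are left after a deletion, as
    \<open>connected_glue\<close> requires.\<close>
  have ci: "card (verts (induced J (verts J - {m}))) \<ge> 2" if "node J" for J :: "'a dvertex ugraph"
  proof -
    have e: "verts (induced J (verts J - {m})) = verts J - {m}" by auto
    have "card (verts J) \<le> Suc (card (verts J - {m}))"
      by (cases "m \<in> verts J") (simp_all add: card_Suc_Diff1[OF nodeD(4)[OF that]] del:
          card_Diff_insert)
    then show ?thesis unfolding e using nodeD(3)[OF that] by simp
  qed
  have rem: "induced (glue A B j) (verts (glue A B j) - {m}) = glue (induced A (verts A - {m})) B j"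
    if AB: "node A" "node B" "verts A \<inter> verts B = {j}" "m \<notin> verts B" for A B
  proof (rule graph_eqI)
    note sA = nodeD(1)[OF AB(1)] and sB = nodeD(1)[OF AB(2)]
    show "simple_graph (induced (glue A B j) (verts (glue A B j) - {m}))"
      by (intro simple_graph_induced simple_graph_glue sA sB) (use AB in auto)
    show "simple_graph (glue (induced A (verts A - {m})) B j)"
      by (intro simple_graph_glue simple_graph_induced sA sB) (use AB in auto)
    show "verts (induced (glue A B j) (verts (glue A B j) - {m})) =
        verts (glue (induced A (verts A - {m})) B j)"
      using AB(4) by auto
    fix u v
    have nB: "\<not> adj B x y" if "x = m \<or> y = m \<or> x \<notin> verts B \<or> y \<notin> verts B" for x y
      using simple_graph_adjD[OF sB] that AB(4) by blast
    have nA: "\<not> adj A x y" if "x \<notin> verts A \<or> y \<notin> verts A" for x y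
      using simple_graph_adjD[OF sA] that by blast
    have jA: "j \<in> verts A" using AB by auto
    show "adj (induced (glue A B j) (verts (glue A B j) - {m})) u v =
        adj (glue (induced A (verts A - {m})) B j) u v"
      unfolding adj_glue[OF simple_graph_induced[OF sA] sB] adj_induced adj_glue[OF sA sB]
          verts_glue
      using nA nB mj jA by auto
  qed
  show ?case
  proof (cases "K = H")
    case True
    have mF: "m \<notin> verts F" using True glue.prems i mj by auto
    have "connected_graph (glue (induced H (verts H - {m})) F j)"
      using i mF mj glue.prems(4) True c nodeD[OF nF] ci[OF glue(2)] s
      by (intro connected_glue simple_graph_induced) auto
    moreover have "glue (induced H (verts H - {m})) F j =
        induced (glue F H j) (verts (glue F H j) - {m})"
      using rem[OF glue(2) nF _ mF] i glue_commute[of F H j] by (simp add: Int_commute)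
    ultimately show ?thesis by simp
  next
    case False
    then have KD: "K \<in> D" using glue.prems by simp
    have mH: "m \<notin> verts H" using glue(5) KD glue.prems mj by auto
    then have mF: "m \<in> verts F" using glue.prems by auto
    have "connected_graph (induced F (verts F - {m}))" using glue.IH KD glue.prems mF by blast
    then have "connected_graph (glue (induced F (verts F - {m})) H j)"
      using i mH mj c nodeD[OF glue(2)] ci[OF nF] s
      by (intro connected_glue simple_graph_induced) auto
    then show ?thesis using rem[OF nF glue(2) i mH] by simp
  qed
qed auto

lemma connected_remove:
  assumes H: "node H" and c: "clique_graph H \<or> star_at H c" "c \<noteq> m"
  shows "connected_graph (induced H (verts H - {m}))"
proof -
  have s: "simple_graph (induced H (verts H - {m}))" using nodeD(1)[OF H]
    by (rule simple_graph_induced)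
  have "\<exists>r\<in>verts H - {m}. \<forall>v\<in>verts H - {m}. v \<noteq> r \<longrightarrow> adj H v r"
  proof (cases "clique_graph H")
    case True
    obtain x where "x \<in> verts H" "x \<noteq> m" using node_outside[OF H] by metis
    then show ?thesis using True by (intro bexI[of _ x]) (auto simp: clique_graph_def)
  next
    case False
    then have "star_at H c" using c by simp
    then show ?thesis using c(2) by (intro bexI[of _ c]) (auto simp: star_at_def)
  qed
  then obtain r where r: "r \<in> verts H - {m}" "\<And>v. v \<in> verts H - {m} \<Longrightarrow> v \<noteq> r \<Longrightarrow> adj H v r" by blast
  show ?thesis
  proof (rule connected_graphI[of r])
    show "r \<in> verts (induced H (verts H - {m}))" using r by auto
    show "joined (induced H (verts H - {m})) v r"
      if v: "v \<in> verts (induced H (verts H - {m}))" for v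
    proof (cases "v = r")
      case True then show ?thesis using r by (auto intro!: joined_refl)
    next
      case False
      then have "adj (induced H (verts H - {m})) v r" using r v by auto
      then show ?thesis by (rule joined_adj[OF s])
    qed
  qed
qed

text \<open>No edge of the tree joins the centre of one star to a leaf of another: such a pair would
  glue to a single star.\<close>

definition star_reduced :: "'b ugraph set \<Rightarrow> bool" where
  "star_reduced D \<longleftrightarrow> (\<forall>A\<in>D. \<forall>B\<in>D. \<forall>m c. A \<noteq> B \<and> m \<in> verts A \<and> m \<in> verts B \<and>
     star_at A m \<and> star_at B c \<longrightarrow> c = m)"

lemma star_reduced_subset: "star_reduced D \<Longrightarrow> P \<subseteq> D \<Longrightarrow> star_reduced P"
  unfolding star_reduced_def by (meson subsetD)

text \<open>A pendant vertex of every leaf of the pruned tree is chosen: deleting it together with its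
  neighbour, the centre of the leaf, leaves the rest of the tree connected.\<close>

lemma leaf_node_pendant:
  assumes D: "decomp_tree F D" and cs: "\<forall>K\<in>D. clique_or_star K" and lf: "leaf_node D H"
    and np: "\<not> (\<exists>P'. prune_step D P')"
    and red: "star_reduced D"
  shows "\<exists>x\<in>verts H \<inter> verts F. closed_nbhd F x \<subseteq> verts H \<and>
    (\<forall>b\<in>verts F - verts H. \<forall>b'\<in>verts F - verts H. joined (induced F (verts F - closed_nbhd F x)) b
        b')"
proof -
  obtain F' m
    where F': "decomp_tree F' (D - {H})" "F = glue F' H m" "m \<in> range Marker" "m \<in> verts F'"
      "verts H \<inter> \<Union>(verts ` (D - {H})) = {m}" "node H" using decomp_tree_leaf[OF D lf] by blast
  obtain K where K: "K \<in> D" "K \<noteq> H" "m \<in> verts K" using F'(5) by auto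
  have HD: "H \<in> D" using lf by (simp add: leaf_node_def)
  have mH: "m \<in> verts H" using F'(5) by auto
  have "K \<in> node_nbrs D H" using K mH by (auto simp: node_nbrs_def)
  \<comment> \<open>With a universal marker the leaf could still be pruned. So \<open>H\<close> is a
    star whose marker is one of its leaves, and any third vertex is pendant.\<close>
  then have nu: "\<not> universal H m" using prune_step.intros[OF lf, of K m] np K mH by blast
  then have "\<not> clique_graph H" using clique_graph_universal[OF _ mH] by blast
  then obtain c where c: "star_at H c" using cs HD by (auto simp: clique_or_star_def)
  have cm: "c \<noteq> m" using c nu by (auto simp: star_at_def universal_def)
  have cH: "c \<in> verts H" using c by (simp add: star_at_def)
  obtain x where x: "x \<in> verts H" "x \<noteq> m" "x \<noteq> c" using node_outside[OF F'(6)] by metis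
  have sF': "simple_graph F'" "simple_graph H" using nodeD(1) decomp_treeD(1)[OF F'(1)] F'(6)
    by auto
  have i: "verts F' \<inter> verts H = {m}" using F'(4,5) decomp_treeD(3)[OF F'(1)] by blast
  have nb: "closed_nbhd F x \<subseteq> {x, c}"
  proof
    fix v assume v: "v \<in> closed_nbhd F x"
    show "v \<in> {x, c}"
    proof (rule ccontr)
      assume nv: "v \<notin> {x, c}"
      then have a: "adj F x v" "v \<in> verts F" using v by (auto simp: closed_nbhd_def)
      show False
      proof (cases "v \<in> verts H")
        case True
        then have "adj H x v" using a adj_glue_right[OF sF' i, of x v] x unfolding F'(2) by auto
        then show False using c x nv by (auto simp: star_at_def)
      next
        case False
        then have "v \<in> verts F' - {m}" using a F'(2) by auto
        then have "adj H m x" using a adj_glue_cross[OF sF' i, of x v] x unfolding F'(2) by auto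
        then show False using c x cm by (auto simp: star_at_def)
      qed
    qed
  qed
  have KD: "K \<in> D - {H}" using K by blast
  have nK: "node K" using decomp_treeD(4)[OF D] K by blast
  have "connected_graph (induced K (verts K - {m}))"
  proof (cases "clique_graph K")
    case True
    then show ?thesis using connected_remove[OF nK, of c m] cm by blast
  next
    case False
    then obtain c' where c': "star_at K c'" using cs K by (auto simp: clique_or_star_def)
    \<comment> \<open>If \<open>K\<close> were a star centred at the marker, deleting the marker
      would shatter it; \<open>star_reduced\<close> excludes this, as \<open>m\<close> is a leaf of
      the star \<open>H\<close>.\<close>
    then have "c' \<noteq> m" using red K HD mH c cm unfolding star_reduced_def by blast
    then show ?thesis using connected_remove[OF nK, of c' m] c' by blast
  qed
  then have con: "connected_graph (induced F' (verts F' - {m}))"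
    using decomp_tree_remove_connected[OF F'(1) KD K(3) F'(4)] by blast
  have sF: "simple_graph F" using nodeD(1)[OF decomp_treeD(1)[OF D]] .
  have "joined (induced F (verts F - closed_nbhd F x)) b b'"
    if b: "b \<in> verts F - verts H" "b' \<in> verts F - verts H" for b b'
  proof (rule joined_map[where f = "\<lambda>x. x"])
    show "joined (induced F' (verts F' - {m})) b b'" using con b F'(2)
      by (auto simp: connected_graph_def)
    have out: "y \<in> verts F - closed_nbhd F x" if y: "y \<in> verts F' - {m}" for y
    proof -
      have "y \<notin> verts H" using y i by auto
      then have "y \<notin> closed_nbhd F x" using nb x cH by auto
      then show ?thesis using y F'(2) by auto
    qed
    then show "y \<in> verts (induced F (verts F - closed_nbhd F x))"
      if "y \<in> verts (induced F' (verts F' - {m}))" for y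
      using that by auto
    show "joined (induced F (verts F - closed_nbhd F x)) y z"
      if yz: "adj (induced F' (verts F' - {m})) y z" for y z
    proof (rule joined_adj[OF simple_graph_induced[OF sF]])
      have "adj F y z" using yz adj_glue_left[OF sF' i, of y z] unfolding F'(2) by auto
      then show "adj (induced F (verts F - closed_nbhd F x)) y z" using yz out by auto
    qed
  qed
  moreover have "x \<in> verts F" using x F'(2) by auto
  moreover have "closed_nbhd F x \<subseteq> verts H" using nb x cH by auto
  ultimately show ?thesis using x by blast
qed

lemma decomp_tree_asteroidal:
  assumes D: "decomp_tree F D" and cs: "\<forall>K\<in>D. clique_or_star K" and c1: "card D \<noteq> 1"
    and np: "\<not> (\<exists>P'. prune_step D P')"
    and red: "star_reduced D"
  shows "\<exists>A. asteroidal_set F A \<and> card A = number_of_leaves D"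
proof -
  let ?L = "{H. leaf_node D H}"
  define Q where "Q H x \<longleftrightarrow> x \<in> verts H \<inter> verts F \<and>
    (\<forall>b\<in>verts F - verts H. \<forall>b'\<in>verts F - verts H. joined (induced F (verts F - closed_nbhd F x)) b
        b')" for H :: "'a dvertex ugraph" and x
  have "\<forall>H\<in>?L. \<exists>x. Q H x"
  proof
    fix H assume "H \<in> ?L"
    then obtain x where "x \<in> verts H \<inter> verts F" "\<forall>b\<in>verts F - verts H. \<forall>b'\<in>verts F - verts H.
        joined (induced F (verts F - closed_nbhd F x)) b b'"
      using leaf_node_pendant[OF D cs _ np red, of H] by auto
    then show "\<exists>x. Q H x" unfolding Q_def by blast
  qed
  then obtain x where "\<forall>H\<in>?L. Q H (x H)" using bchoice[of ?L Q] by blast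
  then have x: "x H \<in> verts H" "x H \<in> verts F"
      "\<And>b b'. b \<in> verts F - verts H \<Longrightarrow> b' \<in> verts F - verts H \<Longrightarrow>
          joined (induced F (verts F - closed_nbhd F (x H))) b b'"
    if "leaf_node D H" for H
    using that by (simp_all add: Q_def)
  \<comment> \<open>A vertex of \<open>F\<close> lies in one node only, so the representatives of
    the other leaves lie outside \<open>H\<close>, where deleting the neighbourhood of
    \<open>x H\<close> does no harm.\<close>
  have other: "x K \<in> verts F - verts H" if "leaf_node D H" "leaf_node D K" "H \<noteq> K" for H K
  proof -
    have "H \<in> D" "K \<in> D" using that by (auto simp: leaf_node_def)
    moreover have "x K \<in> verts K" "x K \<in> verts F" using x that by auto
    ultimately show ?thesis using decomp_tree_real_unique[OF D, of K H "x K"] that(3) by blast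
  qed
  have inj: "inj_on x ?L"
  proof (rule inj_onI, rule ccontr)
    fix H K assume h: "H \<in> ?L" "K \<in> ?L" "x H = x K" "H \<noteq> K"
    then have "x K \<notin> verts H" using other[of H K] by auto
    moreover have "x H \<in> verts H" using x(1)[of H] h(1) by simp
    ultimately show False using h(3) by simp
  qed
  have "asteroidal_set F (x ` ?L)"
    unfolding asteroidal_set_def
  proof (intro conjI ballI)
    show "x ` ?L \<subseteq> verts F" using x by auto
    fix a b c assume "a \<in> x ` ?L" "b \<in> x ` ?L - {a}" "c \<in> x ` ?L - {a}"
    then obtain H K J
      where h: "a = x H" "b = x K" "c =
        x J" "leaf_node D H" "leaf_node D K" "leaf_node D J" "H \<noteq> K" "H \<noteq> J"
      by auto
    then show "joined (induced F (verts F - closed_nbhd F a)) b c"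
      using x(3)[OF h(4) other[OF h(4,5,7)] other[OF h(4,6,8)]] by simp
  qed
  moreover have "card (x ` ?L) = number_of_leaves D"
    using inj c1 by (simp add: card_image number_of_leaves_def)
  ultimately show ?thesis by blast
qed

text \<open>Both bounds survive the removal of a leaf: words of the smaller graph become words of
  the larger one with the same number of corners, and its asteroidal sets are transported by the
  embedding.\<close>

lemma prune_step_props:
  assumes D: "decomp_tree F D" and cs: "\<forall>K\<in>D. clique_or_star K" and p: "prune_step D P"
  shows "\<exists>F' f. decomp_tree F' P \<and> P \<subset> D \<and> (\<forall>k w. represents F' k w \<longrightarrow>
      (\<exists>w'. represents F k w')) \<and> embedding f F' F"
proof -
  obtain H K m
    where h: "leaf_node D H" "K \<in> node_nbrs D H" "m \<in> verts H \<inter> verts K" "universal H m" "P =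
      D - {H}"
    using p by cases auto
  obtain F' m'
    where F': "decomp_tree F' (D - {H})" "F = glue F' H m'" "m' \<in> range Marker" "m' \<in> verts F'"
      "verts H \<inter> \<Union>(verts ` (D - {H})) = {m'}" "node H" using decomp_tree_leaf[OF D h(1)] by blast
  have "K \<in> D - {H}" using h(2) by (auto simp: node_nbrs_def)
  then have "m \<in> verts H \<inter> \<Union>(verts ` (D - {H}))" using h(3) by blast
  then have m: "m' = m" using F'(5) by simp
  have HD: "H \<in> D" using h(1) by (simp add: leaf_node_def)
  have nF': "node F'" using decomp_treeD(1)[OF F'(1)] .
  have i: "verts F' \<inter> verts H = {m}" using F'(4,5) decomp_treeD(3)[OF F'(1)] m by blast
  have "\<exists>w'. represents F k w'" if "represents F' k w" for k w
    using represents_glue_twins[OF that nodeD(1)[OF nF'] F'(6) _ i h(4)] cs HD m F'(2) by blast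
  moreover obtain y where y: "adj H m y"
    using connected_has_nbr[OF nodeD(2)[OF F'(6)], of m] h(3) nodeD(3)[OF F'(6)] by auto
  have "embedding (\<lambda>x. if x = m then y else x) F' F"
    using embedding_glue[OF nodeD(1)[OF nF'] nodeD(1)[OF F'(6)] _ i y] F'(2,4) m by blast
  ultimately show ?thesis using F'(1) h(5) HD by blast
qed

lemma prune_steps_props:
  assumes "prune_step\<^sup>*\<^sup>* D P" "decomp_tree F D" "\<forall>K\<in>D. clique_or_star K"
  shows "\<exists>F' f. decomp_tree F' P \<and> P \<subseteq> D \<and> (\<forall>k w. represents F' k w \<longrightarrow>
      (\<exists>w'. represents F k w')) \<and> embedding f F' F"
  using assms(1)
proof induction
  case base
  then show ?case using assms(2) embedding_id by blast
next
  case (step P Q)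
  then obtain F' f
    where 1: "decomp_tree F' P" "P \<subseteq> D" "\<forall>k w. represents F' k w \<longrightarrow>
      (\<exists>w'. represents F k w')" "embedding f F' F"
    by blast
  then obtain F'' g
    where "decomp_tree F'' Q" "Q \<subset> P" "\<forall>k w. represents F'' k w \<longrightarrow>
      (\<exists>w'. represents F' k w')" "embedding g F'' F'"
    using prune_step_props[OF 1(1) _ step(2)] assms(3) by blast
  then show ?case using 1 embedding_comp by blast
qed

section \<open>Transfer between a graph and its copy among the decomposition vertices\<close>

lemma adj_embed: "adj (embed G) (Orig u) (Orig v) \<longleftrightarrow> adj G u v"
proof -
  have "{Orig u, Orig v} = Orig ` {u, v}" by simp
  then show ?thesis unfolding adj_def embed_def
    using inj_image_mem_iff[of "image Orig" "{u, v}" "edges G"]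
      by (simp add: inj_def inj_image_eq_iff)
qed

lemma verts_embed [simp]: "verts (embed G) = Orig ` verts G"
  by (simp add: embed_def)

lemma simple_graph_embed:
  assumes "simple_graph G" shows "simple_graph (embed G)"
proof -
  have "card (Orig ` e) = card e" for e :: "'a set" by (rule card_image) (simp add: inj_on_def)
  then show ?thesis using assms by (auto simp: simple_graph_def embed_def)
qed

lemma embedding_embed: "embedding Orig G (embed G)"
  by (auto simp: embedding_def adj_embed inj_on_def)

text \<open>The value at markers is irrelevant, since \<open>embed G\<close> contains none.\<close>

lemma embedding_unembed: "embedding (\<lambda>x. case x of Orig a \<Rightarrow> a | Marker n \<Rightarrow> undefined) (embed G) G"
  by (auto simp: embedding_def adj_embed inj_on_def)

lemma node_embed:
  assumes s: "simple_graph G" and c: "connected_graph G" and n: "\<not> clique_graph G"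
  shows "node (embed G)"
proof -
  have se: "simple_graph (embed G)" using s by (rule simple_graph_embed)
  have "connected_graph (embed G)"
    using c joined_embedding[OF embedding_embed s se] unfolding connected_graph_def by auto
  moreover have "card (verts (embed G)) \<ge> 3"
  proof -
    obtain u v where uv: "u \<in> verts G" "v \<in> verts G" "u \<noteq> v" "\<not> adj G u v" using n
      by (auto simp: clique_graph_def)
    have fin: "finite (verts G)" using s by (simp add: simple_graph_def)
    then have "card {u, v} \<le> card (verts G)" using uv by (intro card_mono) auto
    then obtain w where w: "adj G u w" using connected_has_nbr[OF c uv(1)] uv(3) by auto
    then have "w \<in> verts G" "w \<noteq> u" "w \<noteq> v" using simple_graph_adjD[OF s w] uv by auto
    then have "card {u, v, w} \<le> card (verts G)" using uv fin by (intro card_mono) auto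
    moreover have "card {u, v, w} = 3" using uv(3) \<open>w \<noteq> u\<close> \<open>w \<noteq> v\<close> by auto
    moreover have "card (verts (embed G)) = card (verts G)" by (simp add: card_image inj_on_def)
    ultimately show ?thesis by simp
  qed
  ultimately show ?thesis using se by (simp add: node_def)
qed

lemma polygon_graph_embed:
  assumes "polygon_graph k (embed G)" shows "polygon_graph k G"
proof (cases "k = 2")
  case True
  then obtain \<sigma> \<pi>
    where s: "bij_betw \<sigma> (verts (embed G)) {..<card (verts (embed G))}"
      "\<pi> permutes {..<card (verts (embed G))}"
    "\<forall>u\<in>verts (embed G). \<forall>v\<in>verts (embed G). \<sigma> u < \<sigma> v \<longrightarrow> (adj (embed G) u v \<longleftrightarrow> \<pi> (\<sigma> v) < \<pi> (\<sigma> u))"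
    using assms by (auto simp: polygon_graph_def permutation_graph_def)
  have c: "card (verts (embed G)) = card (verts G)" by (simp add: card_image inj_on_def)
  have "bij_betw Orig (verts G) (verts (embed G))" by (simp add: bij_betw_def inj_on_def)
  then have "bij_betw (\<sigma> \<circ> Orig) (verts G) {..<card (verts G)}" using bij_betw_trans s(1) c by metis
  moreover have "\<forall>u\<in>verts G. \<forall>v\<in>verts G. (\<sigma> \<circ> Orig) u < (\<sigma> \<circ> Orig) v \<longrightarrow> (adj G u v \<longleftrightarrow>
      \<pi> ((\<sigma> \<circ> Orig) v) < \<pi> ((\<sigma> \<circ> Orig) u))"
    using s(3) adj_embed[of G] by auto
  ultimately have "permutation_graph G" using s(2) unfolding c permutation_graph_def by blast
  then show ?thesis using True by (simp add: polygon_graph_def)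
next
  case False
  then have "\<exists>p c. convex_polygon k p \<and> (\<forall>v\<in>verts (embed G). is_chord k p (c v)) \<and>
      (\<forall>u\<in>verts (embed G). \<forall>v\<in>verts (embed G). u \<noteq> v \<longrightarrow> (adj (embed G) u v \<longleftrightarrow> c u \<inter> c v \<noteq> {}))"
    using assms unfolding polygon_graph_def by simp
  then obtain p c where p: "convex_polygon k p" "\<forall>v\<in>verts (embed G). is_chord k p (c v)"
    and a: "\<forall>u\<in>verts (embed G). \<forall>v\<in>verts (embed G). u \<noteq> v \<longrightarrow> (adj (embed G) u v \<longleftrightarrow> c u \<inter> c v \<noteq> {})"
    by (elim exE conjE)
  have "\<forall>v\<in>verts G. is_chord k p ((c \<circ> Orig) v)" using p(2) by simp
  moreover have "\<forall>u\<in>verts G. \<forall>v\<in>verts G. u \<noteq> v \<longrightarrow> (adj G u v \<longleftrightarrow> (c \<circ> Orig) u \<inter> (c \<circ> Orig) v \<noteq> {})"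
    using a adj_embed[of G] by simp
  ultimately have "\<exists>p c. convex_polygon k p \<and> (\<forall>v\<in>verts G. is_chord k p (c v)) \<and>
      (\<forall>u\<in>verts G. \<forall>v\<in>verts G. u \<noteq> v \<longrightarrow> (adj G u v \<longleftrightarrow> c u \<inter> c v \<noteq> {}))" using p(1) by blast
  then show ?thesis using False unfolding polygon_graph_def by simp
qed

lemma split_decomposition_tree:
  assumes "node (embed G)" "split_decomposition G D"
  shows "decomp_tree (embed G) D"
  using assms simple_decomp_rtranclp[of "{embed G}" D "embed G"] decomp_tree.single
  by (auto simp: split_decomposition_def)

lemma decomp_tree_marker:
  assumes "decomp_tree F D" "K \<in> D" "x \<in> verts K"
  shows "x \<in> verts F \<or> x \<in> range Marker"
  using assms by induction auto

section \<open>Existence and minimality of the decompositions\<close>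

text \<open>Two extremal choices. A decomposition with the most nodes has only prime nodes, so the
  admissible ones exist; an admissible one with the fewest nodes refines no other, because
  refinement increases the number of nodes.\<close>

lemma ex_standard_decomposition:
  assumes G: "node (embed G)"
  shows "\<exists>T. standard_decomposition G T"
proof -
  have bound: "card D \<le> card (verts (embed G))" if "split_decomposition G D" for D
    using decomp_tree_props[OF split_decomposition_tree[OF G that]] by linarith
  have "split_decomposition G {embed G}" by (simp add: split_decomposition_def)
  then obtain D
    where D: "split_decomposition G D" "\<And>D'. split_decomposition G D' \<Longrightarrow> card D' \<le> card D"
    using ex_has_greatest_nat[of "split_decomposition G" _ card "Suc (card (verts (embed G)))"]
        bound
    by (metis le_imp_less_Suc)
  note tD = split_decomposition_tree[OF G D(1)]
  have "prime_graph H" if H: "H \<in> D" for H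
  proof (rule ccontr)
    assume "\<not> prime_graph H"
    then obtain V1 V2 where s: "is_split H V1 V2" by (auto simp: prime_graph_def)
    have "finite (\<Union>K\<in>D. verts K)" using decomp_treeD(2,4)[OF tD] nodeD(4) by blast
    then have "finite (Marker -` (\<Union>K\<in>D. verts K))" by (rule finite_vimageI) (simp add: inj_def)
    then obtain n where n: "Marker n \<notin> (\<Union>K\<in>D. verts K)" using ex_new_if_finite infinite_UNIV_nat
      by (metis vimageI)
    obtain D' where D': "simple_decomp D D'" using simple_decomp.intros[OF H s n] by blast
    then have "split_decomposition G D'" using D(1) by (auto simp: split_decomposition_def)
    then show False using D(2)[of D'] simple_decomp_props(2)[OF tD D'] by simp
  qed
  then have "split_decomposition G D \<and> prime_clique_star D" using D(1)
    by (simp add: prime_clique_star_def)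
  then obtain T where T: "split_decomposition G T \<and> prime_clique_star T"
    "\<And>D'. split_decomposition G D' \<and> prime_clique_star D' \<Longrightarrow> card T \<le> card D'"
    using ex_has_least_nat[of "\<lambda>D. split_decomposition G D \<and> prime_clique_star D" D card] by blast
  have "\<not> strict_refinement T D'" if "split_decomposition G D'" "prime_clique_star D'" for D'
    using T(2)[of D'] that simple_decomp_tranclp_card[of D' T "embed G"] split_decomposition_tree[OF
        G that(1)]
    by (auto simp: strict_refinement_def)
  then show ?thesis using T(1) unfolding standard_decomposition_def by blast
qed

text \<open>If \<open>m\<close> is the centre of the star \<open>A\<close> and a leaf of the star
  \<open>B\<close>, the two glue to one star with the centre of \<open>B\<close>. The merged tree is
  again admissible and is strictly refined by \<open>T\<close>.\<close>

lemma standard_decomposition_reduced: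
  assumes G: "node (embed G)" and T: "standard_decomposition G T"
  shows "star_reduced T"
proof (unfold star_reduced_def, intro ballI allI impI, rule ccontr)
  fix A B m c
  assume AB: "A \<in> T" "B \<in> T"
    and h: "A \<noteq> B \<and> m \<in> verts A \<and> m \<in> verts B \<and> star_at A m \<and> star_at B c" and "c \<noteq> m"
  then have AB: "A \<in> T" "B \<in> T" "A \<noteq> B" "m \<in> verts A" "m \<in> verts B"
    and st: "star_at A m" "star_at B c" "c \<noteq> m" by auto
  have sd: "split_decomposition G T" "prime_clique_star T" using T
    by (auto simp: standard_decomposition_def)
  note tT = split_decomposition_tree[OF G sd(1)]
  have nA: "node A" "node B" using decomp_treeD(4)[OF tT] AB by auto
  note s = nodeD(1)[OF nA(1)] nodeD(1)[OF nA(2)]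
  let ?M = "glue A B m" and ?T = "T - {A, B}"
  have i: "verts A \<inter> verts B = {m}" using decomp_tree_share[OF tT AB(1-3)] AB by blast
  have dM: "decomp_tree (embed G) (insert ?M ?T)" using decomp_tree_merge[OF tT AB] .
  have sdM: "split_decomposition G (insert ?M ?T)"
    using decomp_tree_imp_simple_decomp[OF dM] by (simp add: split_decomposition_def)
  have mO: "m \<in> range Marker"
  proof -
    have "m \<notin> verts (embed G)" using decomp_tree_real_unique[OF tT AB(1-3)] AB by blast
    then show ?thesis using decomp_tree_marker[OF tT AB(1,4)] by blast
  qed
  have "m \<notin> \<Union>(verts ` ?T)" using decomp_tree_two[OF tT AB(1,2) _ AB(3) _ _ AB(4,5)] by blast
  moreover have "?M \<notin> ?T"
  proof
    \<comment> \<open>If the merged node were already present, it would share with \<open>A\<close>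
      two vertices other than \<open>m\<close>, but distinct nodes share at most one.\<close>
    assume M: "?M \<in> ?T"
    obtain x where x: "x \<in> verts A" "x \<noteq> m" using node_outside[OF nA(1)] by metis
    obtain y where y: "y \<in> verts A" "y \<noteq> m" "y \<noteq> x" using node_outside[OF nA(1)] by metis
    show False using decomp_tree_share[OF tT AB(1), of ?M x y] M x y by auto
  qed
  ultimately have "simple_decomp (insert ?M ?T) (insert B (insert A ?T))"
    using simple_decomp_glue[OF nA i mO] by blast
  moreover have "insert B (insert A ?T) = T" using AB by auto
  ultimately have "strict_refinement T (insert ?M ?T)" by (auto simp: strict_refinement_def)
  moreover have "prime_clique_star (insert ?M ?T)"
  proof -
    have "star_at ?M c"
    proof -
      have cB: "c \<in> verts B" "c \<notin> verts A" using st i by (auto simp: star_at_def)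
      have "adj ?M u v \<longleftrightarrow> u = c \<and> v \<in> verts ?M - {c} \<or> v = c \<and> u \<in> verts ?M - {c}" for u v
      proof -
        have a1: "adj A m x \<longleftrightarrow> x \<in> verts A \<and> x \<noteq> m" and a2: "x \<noteq> m \<Longrightarrow> y \<noteq> m \<Longrightarrow> \<not> adj A x y" for x y
          using st(1) by (auto simp: star_at_def)
        have b1: "adj B m x \<longleftrightarrow> x = c"
          and b2: "adj B x y \<longleftrightarrow> x = c \<and> y \<in> verts B \<and> y \<noteq> c \<or> y = c \<and> x \<in> verts B \<and> x \<noteq> c" for x y
          using st(2,3) AB(5) by (auto simp: star_at_def)
        have e: "adj ?M u v \<longleftrightarrow> u \<noteq> m \<and> v \<noteq> m \<and>
          (adj A u v \<or> adj B u v \<or> adj A m u \<and> adj B m v \<or> adj A m v \<and> adj B m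
              u)" by (rule adj_glue[OF s])
        show ?thesis
        proof (cases "u = m \<or> v = m")
          case True
          then show ?thesis unfolding e verts_glue using st(3) by auto
        next
          case False
          then have um: "u \<noteq> m" "v \<noteq> m" by auto
          have "adj ?M u v \<longleftrightarrow>
              (u = c \<and> v \<in> verts B \<and> v \<noteq> c \<or> v = c \<and> u \<in> verts B \<and> u \<noteq> c) \<or> u \<in> verts A \<and> v = c \<or>
              v \<in> verts A \<and> u = c"
            unfolding e a1 b1 b2 using um a2[OF um] st(3) AB(5) by auto
          then show ?thesis unfolding verts_glue using um cB by auto
        qed
      qed
      then show ?thesis using cB st(3) by (auto simp: star_at_def)
    qed
    then have "star_graph ?M" using star_graph_iff[OF nodeD(1)[OF node_glue[OF nA i]]] by blast
    then show ?thesis using sd(2) by (auto simp: prime_clique_star_def)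
  qed
  ultimately show False using T sdM unfolding standard_decomposition_def by blast
qed

lemma ex_pruned_decomposition_tree:
  assumes G: "node (embed G)"
  shows "\<exists>P. pruned_decomposition_tree G P"
proof -
  obtain T where T: "standard_decomposition G T" using ex_standard_decomposition[OF G] by blast
  then have fin: "finite T" using decomp_treeD(2)[OF split_decomposition_tree[OF G]]
    by (auto simp: standard_decomposition_def)
  have sub: "P \<subseteq> T" if "prune_step\<^sup>*\<^sup>* T P" for P
    using that by induction (auto elim!: prune_step.cases)
  have "prune_step\<^sup>*\<^sup>* T T" by simp
  then obtain P where P: "prune_step\<^sup>*\<^sup>* T P" "\<And>Q. prune_step\<^sup>*\<^sup>* T Q \<Longrightarrow> card P \<le> card Q"
    using ex_has_least_nat[of "prune_step\<^sup>*\<^sup>* T" T card] by blast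
  have "\<not> prune_step P Q" for Q
  proof
    assume pq: "prune_step P Q"
    then have "Q \<subset> P" by cases (auto simp: leaf_node_def)
    then have "card Q < card P" using finite_subset[OF sub[OF P(1)] fin]
      by (rule psubset_card_mono[rotated])
    moreover have "prune_step\<^sup>*\<^sup>* T Q" using P(1) pq by simp
    ultimately show False using P(2)[of Q] by simp
  qed
  then show ?thesis using T P(1) unfolding pruned_decomposition_tree_def by blast
qed

lemma asteroidal_number_props:
  assumes "simple_graph G"
  shows "asteroidal_set G A \<Longrightarrow> card A \<le> asteroidal_number G"
    and "\<exists>A. asteroidal_set G A \<and> card A = asteroidal_number G"
proof -
  let ?C = "{card A | A. asteroidal_set G A}"
  have fin: "finite (verts G)" using assms by (simp add: simple_graph_def)
  have "?C \<subseteq> {..card (verts G)}" using card_mono[OF fin] by (auto simp: asteroidal_set_def)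
  then have f: "finite ?C" by (rule finite_subset) simp
  show "asteroidal_set G A \<Longrightarrow> card A \<le> asteroidal_number G"
    unfolding asteroidal_number_def using f by (intro Max_ge) auto
  have "asteroidal_set G {}" by (simp add: asteroidal_set_def)
  then have "?C \<noteq> {}" by blast
  then have "Max ?C \<in> ?C" using f by (rule Max_in[rotated])
  then show "\<exists>A. asteroidal_set G A \<and> card A = asteroidal_number G" unfolding asteroidal_number_def
    by auto
qed

text \<open>The bound that matches the convention of two leaves for a pruned tree with a single
  node.\<close>

lemma asteroidal_number_ge_2:
  assumes "simple_graph G" "\<not> clique_graph G"
  shows "asteroidal_number G \<ge> 2"
proof -
  obtain u v where uv: "u \<in> verts G" "v \<in> verts G" "u \<noteq> v" "\<not> adj G u v" using assms(2)
    by (auto simp: clique_graph_def)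
  have "\<not> adj G v u" using uv(4) adj_commute by metis
  then have "asteroidal_set G {u, v}"
    using uv by (auto simp: asteroidal_set_def closed_nbhd_def intro!: joined_refl)
  then show ?thesis using asteroidal_number_props(1)[OF assms(1)] uv(3) by fastforce
qed

theorem theorem7:
  fixes G :: "'a ugraph"
  assumes "simple_graph G"
    and "connected_graph G"
    and "distance_hereditary G"
    and "\<not> clique_graph G"
  shows "polygon_number G = asteroidal_number G
    \<and> (\<exists>P. pruned_decomposition_tree G P)
    \<and> (\<forall>P. pruned_decomposition_tree G P \<longrightarrow> number_of_leaves P = asteroidal_number G)"
proof -
  have nG: "node (embed G)" using node_embed assms by blast
  have dhE: "distance_hereditary (embed G)"
    using distance_hereditary_embedding[OF embedding_unembed nodeD(1,2)[OF nG] assms(1,3)] .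
  have main: "number_of_leaves P = asteroidal_number G \<and> polygon_number G = asteroidal_number G"
    if P: "pruned_decomposition_tree G P" for P
  proof -
    obtain T where T: "standard_decomposition G T" "prune_step\<^sup>*\<^sup>* T P"
      and np: "\<not> (\<exists>P'. prune_step P P')"
      using P unfolding pruned_decomposition_tree_def by blast
    have sd: "split_decomposition G T" "prime_clique_star T" using T(1)
      by (auto simp: standard_decomposition_def)
    note tT = split_decomposition_tree[OF nG sd(1)]
    have cs: "\<forall>K\<in>T. clique_or_star K"
    proof
      fix K assume K: "K \<in> T"
      have nK: "node K" using decomp_treeD(4)[OF tT] K by blast
      obtain f where f: "embedding f K (embed G)" using decomp_tree_node_embedding[OF tT K] by blast
      have "distance_hereditary K"
        using distance_hereditary_embedding[OF f nodeD(1,2)[OF nK] nodeD(1)[OF nG] dhE] .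
      then show "clique_or_star K" using distance_hereditary_node[OF nK] sd(2) K
        by (auto simp: prime_clique_star_def)
    qed
    obtain F f where F: "decomp_tree F P" "P \<subseteq> T" "\<forall>k w. represents F k w \<longrightarrow>
        (\<exists>w'. represents (embed G) k w')"
      "embedding f F (embed G)" using prune_steps_props[OF T(2) tT cs] by blast
    have csP: "\<forall>K\<in>P. clique_or_star K" using cs F(2) by blast
    have nF: "node F" using decomp_treeD(1)[OF F(1)] .
    let ?L = "number_of_leaves P"
    have L2: "?L \<ge> 2" using number_of_leaves_ge_2[OF F(1)] .
    have "\<exists>H x. H \<in> P \<and> (leaf_node P H \<or> card P = 1) \<and> x \<in> verts H \<inter> verts F"
    proof (cases "card P = 1")
      case True
      then have "P = {F}" using decomp_tree_single[OF F(1)] by simp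
      moreover obtain x where "x \<in> verts F" using node_outside[OF nF] by metis
      ultimately show ?thesis using True by blast
    next
      case False
      then show ?thesis using decomp_tree_ex_leaf[OF F(1) False] by (auto simp: leaf_node_def)
    qed
    then obtain w where "represents F ?L w" using decomp_tree_represents[OF F(1) csP] by blast
    then obtain w' where w': "represents (embed G) ?L w'" using F(3) by blast
    have "polygon_graph ?L (embed G)"
    proof (cases "?L = 2")
      case True then show ?thesis using represents_imp_permutation_graph[of "embed G" w'] w'
        by (simp add: polygon_graph_def)
    next
      case False then show ?thesis using represents_imp_polygon_graph[OF w'] L2 by simp
    qed
    then have pg: "polygon_graph ?L G" by (rule polygon_graph_embed)
    have "\<exists>A. asteroidal_set G A \<and> card A \<ge> ?L"
    proof (cases "card P = 1")
      case True
      then have "?L = 2" by (simp add: number_of_leaves_def)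
      then show ?thesis
        using asteroidal_number_ge_2[OF assms(1,4)] asteroidal_number_props(2)[OF assms(1)] by auto
    next
      case False
      obtain A where A: "asteroidal_set F A" "card A = ?L"
        using decomp_tree_asteroidal[OF F(1) csP False np star_reduced_subset[OF
            standard_decomposition_reduced[OF nG T(1)] F(2)]]
        by blast
      have e: "embedding ((\<lambda>x. case x of Orig a \<Rightarrow> a | Marker n \<Rightarrow> undefined) \<circ> f) F G"
        using embedding_comp[OF F(4) embedding_unembed] .
      show ?thesis using asteroidal_set_embedding[OF e nodeD(1)[OF nF] assms(1) A(1)] A(2)
        by (metis order_refl)
    qed
    then have "?L \<le> asteroidal_number G" using asteroidal_number_props(1)[OF assms(1)] le_trans
      by blast
    moreover have "asteroidal_number G \<le> k" if "k \<ge> 2 \<and> polygon_graph k G" for k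
      using asteroidal_number_props(2)[OF assms(1)] asteroidal_set_polygon_graph[OF assms(1)] that
        by metis
    moreover have "polygon_number G \<le> ?L"
      unfolding polygon_number_def using Least_le[of "\<lambda>k. k \<ge> 2 \<and> polygon_graph k G" ?L] L2 pg
        by simp
    moreover have "polygon_number G \<ge> 2 \<and> polygon_graph (polygon_number G) G"
      unfolding polygon_number_def using LeastI[of "\<lambda>k. k \<ge> 2 \<and> polygon_graph k G" ?L] L2 pg by simp
    ultimately show ?thesis by (meson le_antisym le_trans)
  qed
  then show ?thesis using ex_pruned_decomposition_tree[OF nG] by blast
qed

end
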